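(* Let $X$ be an infinite-dimensional Banach space with an asymptotic structure given by a family $\mathcal{B}(X)$, and let $r$ and $g$ be the upper and lower envelopes for $X$. There exist $1\le p,q\le\infty$ and $C,c>0$, and for every $\varepsilon>0$ there exist $C_\varepsilon,c_\varepsilon>0$, such that for all $a\in c_{00}$ $$c_\varepsilon\|a\|_{\ell_{q+\varepsilon}}\le g(a)\le C\|a\|_{\ell_q}\qquad\text{and}\qquad c\,\|a\|_{\ell_p}\le r(a)\le C_\varepsilon\|a\|_{\ell_{p-\varepsilon}}.$$ Here the last inequality is understood for $0<\varepsilon<p$ when $p<\infty$, with $\|a\|_{\ell_s}=(\sum_i|a_i|^s)^{1/s}$ for all $0<s<\infty$; when $p=\infty$ it means that for every finite $s$ there is a constant $C_s$ with $r(a)\le C_s\|a\|_{\ell_s}$ for all $a \in c_{00}$. When $q=\infty$, $q+\varepsilon$ means $\infty$.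
   Context: $S(Z)$ denotes the unit sphere of a normed space $Z$. $\mathcal{M}_n$ is the space of all $n$-dimensional Banach spaces with a (distinguished, ordered) normalized basis whose basis constant is at most $2$. Two finite sequences $\{x_i\}_{i=1}^n,\{e_i\}_{i=1}^n$ are $(1+\varepsilon)$-equivalent if $\|J\|\,\|J^{-1}\|\le 1+\varepsilon$, where $J$ is the linear map $x_i\mapsto e_i$ between their spans. $\mathcal{B}(X)$ is a family of infinite-dimensional subspaces of $X$ satisfying the filtration condition: for all $X_1,X_2\in\mathcal{B}(X)$ there is $X_3\in\mathcal{B}(X)$ with $X_3\subset X_1\cap X_2$. The main example is the family $\mathcal{B}^0(X)$ of all (closed) subspaces of finite codimension. Standing assumption (automatic for $\mathcal{B}^0(X)$): for every finite-dimensional subspace $F\subset X$ and every $\delta>0$ there is $Z\in\mathcal{B}(X)$ with $\|f\|\le(1+\delta)\|f+z\|$ for all $f\in F$, $z\in Z$; so the subspace player below can always ensure that the chosen vectors have basis constant less than $1+\delta$. Asymptotic game: there are two players, $\mathbf{S}$ and $\mathbf{V}$. In the $k$th move $\mathbf{S}$ chooses $X_k\in\mathcal{B}(X)$, and then $\mathbf{V}$ chooses $x_k\in S(X_k)$ such that $x_1,\dots,x_k$ is a basic sequence with basis constant at most $2$ (if $\mathbf{V}$ has no admissible choice, $\mathbf{V}$ loses). In the vector game for $E\in\mathcal{M}_n$ with basis $\{e_i\}$ and $\varepsilon>0$, $\mathbf{V}$ wins if after $n$ moves $\{x_i\}_{i=1}^n$ is $(1+\varepsilon)$-equivalent to $\{e_i\}_{i=1}^n$.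 $E$ is an asymptotic space for $X$ if $\mathbf{V}$ has a winning strategy in this game for every $\varepsilon>0$; $\{X\}_n$ is the set of all $n$-dimensional asymptotic spaces, each equipped with its distinguished (natural) basis. $c_{00}$ is the space of scalar sequences that are eventually zero. The upper and lower envelopes for $X$ are the functions defined for $a=(a_1,\dots,a_m,0,\dots)\in c_{00}$ by $r(a)=\sup\|\sum_i a_ie_i\|$ and $g(a)=\inf\|\sum_i a_ie_i\|$, where the supremum and infimum are over all natural bases $\{e_i\}_{i=1}^n$ of asymptotic spaces $E\in\{X\}_n$ and all $n$ (with $n\ge m$, so that the sums make sense). *)

theory Defs
  imports "HOL-Analysis.Analysis"
begin

text \<open>
  Banach spaces over the scalar field \<open>'k\<close>, to be read as the reals or the complex numbers: both are
  instances of the sort below (by Frobenius' theorem they are the only ones, up to isomorphism).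
  The class \<open>banach\<close> carries only the real structure of the space, so the scalar action is an
  explicit parameter, required to extend it.  For \<open>'k = real\<close> it is \<open>scaleR\<close>.
\<close>
locale banach_space_over = vector_space scal
  for scal :: "'k::{real_normed_field,euclidean_space} \<Rightarrow> 'a::banach \<Rightarrow> 'a" +
  assumes scal_of_real: "scal (of_real t) x = t *\<^sub>R x"
    and norm_scal: "norm (scal c x) = norm c * norm x"

definition fin_dim :: "('k::field \<Rightarrow> 'a::ab_group_add \<Rightarrow> 'a) \<Rightarrow> 'a set \<Rightarrow> bool" where
  "fin_dim scal F \<longleftrightarrow> (\<exists>S. finite S \<and> F \<subseteq> module.span scal S)"

text \<open>
  \<open>B\<close> defines an asymptotic structure: infinite-dimensional subspaces, the filtration condition, and
  the standing assumption on finite-dimensional subspaces.  Members of \<open>B\<close> need not be closed.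
\<close>
definition asymptotic_family ::
  "('k::field \<Rightarrow> 'a::real_normed_vector \<Rightarrow> 'a) \<Rightarrow> 'a set set \<Rightarrow> bool" where
  "asymptotic_family scal B \<longleftrightarrow>
     (\<forall>Z\<in>B. module.subspace scal Z \<and> \<not> fin_dim scal Z) \<and>
     (\<forall>X1\<in>B. \<forall>X2\<in>B. \<exists>X3\<in>B. X3 \<subseteq> X1 \<inter> X2) \<and>
     (\<forall>F \<delta>. module.subspace scal F \<and> fin_dim scal F \<and> 0 < \<delta> \<longrightarrow>
        (\<exists>Z\<in>B. \<forall>f\<in>F. \<forall>z\<in>Z. norm f \<le> (1 + \<delta>) * norm (f + z)))"

text \<open>
  An \<open>n\<close>-dimensional space with a distinguished ordered basis \<open>e\<^sub>0, \<dots>, e\<^sub>n\<^sub>-\<^sub>1\<close> is given, up to isometry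
  preserving the basis, by its norm in coordinates, \<open>N a = \<parallel>\<Sum>i<n. a i e\<^sub>i\<parallel>\<close>, where \<open>a\<close> ranges over
  the \<open>n\<close>-tuples of scalars, encoded as sequences vanishing from index \<open>n\<close> on.  Values of \<open>N\<close> at other
  sequences are irrelevant.
\<close>
definition tuples :: "nat \<Rightarrow> (nat \<Rightarrow> 'k::zero) set" where
  "tuples n = {a. \<forall>i\<ge>n. a i = 0}"

definition is_norm :: "nat \<Rightarrow> ((nat \<Rightarrow> 'k::real_normed_field) \<Rightarrow> real) \<Rightarrow> bool" where
  "is_norm n N \<longleftrightarrow>
     (\<forall>a\<in>tuples n. N a = 0 \<longrightarrow> a = (\<lambda>_. 0)) \<and>
     (\<forall>a\<in>tuples n. \<forall>c. N (\<lambda>i. c * a i) = norm c * N a) \<and>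
     (\<forall>a\<in>tuples n. \<forall>b\<in>tuples n. N (\<lambda>i. a i + b i) \<le> N a + N b)"

text \<open>
  \<open>id_norm n N M\<close> is the operator norm of the linear map that takes the basis of the \<open>n\<close>-dimensional
  space with coordinate norm \<open>N\<close> to a sequence of vectors with coordinate (semi)norm \<open>M\<close>.
  The tuple \<open>a = 0\<close> contributes \<open>0 / 0 = 0\<close>.
\<close>
definition id_norm ::
  "nat \<Rightarrow> ((nat \<Rightarrow> 'k::zero) \<Rightarrow> real) \<Rightarrow> ((nat \<Rightarrow> 'k) \<Rightarrow> real) \<Rightarrow> ereal" where
  "id_norm n N M = (SUP a\<in>tuples n. ereal (M a / N a))"

text \<open>The supremum of the norms of the basis projections.\<close>
definition basis_constant :: "nat \<Rightarrow> ((nat \<Rightarrow> 'k::zero) \<Rightarrow> real) \<Rightarrow> ereal" where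
  "basis_constant n N = (SUP m\<in>{..n}. id_norm n N (\<lambda>a. N (\<lambda>i. if i < m then a i else 0)))"

definition equivalent_bases ::
  "nat \<Rightarrow> real \<Rightarrow> ((nat \<Rightarrow> 'k::zero) \<Rightarrow> real) \<Rightarrow> ((nat \<Rightarrow> 'k) \<Rightarrow> real) \<Rightarrow> bool" where
  "equivalent_bases n K N M \<longleftrightarrow> id_norm n N M * id_norm n M N \<le> ereal K"

definition based_spaces :: "nat \<Rightarrow> ((nat \<Rightarrow> 'k::real_normed_field) \<Rightarrow> real) set" where
  "based_spaces n =
     {N. is_norm n N \<and> (\<forall>j<n. N (\<lambda>i. if i = j then 1 else 0) = 1) \<and> basis_constant n N \<le> 2}"

definition coord_norm ::
  "('k \<Rightarrow> 'a::real_normed_vector \<Rightarrow> 'a) \<Rightarrow> nat \<Rightarrow> (nat \<Rightarrow> 'a) \<Rightarrow> (nat \<Rightarrow> 'k) \<Rightarrow> real" where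
  "coord_norm scal n x a = norm (\<Sum>i<n. scal (a i) (x i))"

definition basic_sequence ::
  "('k::field \<Rightarrow> 'a::real_normed_vector \<Rightarrow> 'a) \<Rightarrow> real \<Rightarrow> nat \<Rightarrow> (nat \<Rightarrow> 'a) \<Rightarrow> bool" where
  "basic_sequence scal K n x \<longleftrightarrow>
     inj_on x {..<n} \<and> \<not> module.dependent scal (x ` {..<n}) \<and>
     basis_constant n (coord_norm scal n x) \<le> ereal K"

text \<open>
  A strategy of the vector player maps the finite list of moves of the subspace player made so far
  to a vector (her own earlier moves are determined by the strategy).  It is winning if, whatever
  the subspace player does, all vectors are admissible and the outcome is \<open>(1+\<epsilon>)\<close>-equivalent to the
  basis of the given space.
\<close>
definition vector_player_wins ::
  "('k::field \<Rightarrow> 'a::real_normed_vector \<Rightarrow> 'a) \<Rightarrow> 'a set set \<Rightarrow> nat \<Rightarrow>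
     ((nat \<Rightarrow> 'k) \<Rightarrow> real) \<Rightarrow> real \<Rightarrow> bool" where
  "vector_player_wins scal B n N \<epsilon> \<longleftrightarrow>
     (\<exists>\<sigma> :: 'a set list \<Rightarrow> 'a. \<forall>Y x.
        (\<forall>k<n. Y k \<in> B) \<and> (\<forall>k<n. x k = \<sigma> (map Y [0..<Suc k])) \<longrightarrow>
        (\<forall>k<n. x k \<in> Y k \<inter> sphere 0 1 \<and> basic_sequence scal 2 (Suc k) x) \<and>
        equivalent_bases n (1 + \<epsilon>) (coord_norm scal n x) N)"

definition asymptotic_spaces ::
  "('k::real_normed_field \<Rightarrow> 'a::real_normed_vector \<Rightarrow> 'a) \<Rightarrow> 'a set set \<Rightarrow> nat \<Rightarrow>
     ((nat \<Rightarrow> 'k) \<Rightarrow> real) set" where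
  "asymptotic_spaces scal B n =
     {N \<in> based_spaces n. \<forall>\<epsilon>>0. vector_player_wins scal B n N \<epsilon>}"

definition c00 :: "(nat \<Rightarrow> 'k::zero) set" where
  "c00 = {a. finite {i. a i \<noteq> 0}}"

text \<open>Since \<open>a \<in> tuples n\<close>, the number \<open>N a\<close> below is the norm of \<open>\<Sum>i. a i e\<^sub>i\<close> in the space \<open>N\<close>.\<close>
definition upper_envelope ::
  "('k::real_normed_field \<Rightarrow> 'a::real_normed_vector \<Rightarrow> 'a) \<Rightarrow> 'a set set \<Rightarrow> (nat \<Rightarrow> 'k) \<Rightarrow> ereal" where
  "upper_envelope scal B a =
     Sup {ereal (N a) | n N. 1 \<le> n \<and> a \<in> tuples n \<and> N \<in> asymptotic_spaces scal B n}"

definition lower_envelope ::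
  "('k::real_normed_field \<Rightarrow> 'a::real_normed_vector \<Rightarrow> 'a) \<Rightarrow> 'a set set \<Rightarrow> (nat \<Rightarrow> 'k) \<Rightarrow> ereal" where
  "lower_envelope scal B a =
     Inf {ereal (N a) | n N. 1 \<le> n \<and> a \<in> tuples n \<and> N \<in> asymptotic_spaces scal B n}"

text \<open>Intended for \<open>0 < s \<le> \<infinity>\<close> and \<open>a \<in> c00\<close>.\<close>
definition lp_norm :: "ereal \<Rightarrow> (nat \<Rightarrow> 'k::real_normed_vector) \<Rightarrow> real" where
  "lp_norm s a =
     (if s = \<infinity> then SUP i. norm (a i)
      else (\<Sum>i | a i \<noteq> 0. norm (a i) powr real_of_ereal s) powr (1 / real_of_ereal s))"

end

theory Submission
  imports Defs
begin

text \<open>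
  Let \<open>f n\<close> be the largest value of \<open>N a\<close> over \<open>n\<close>-dimensional asymptotic spaces \<open>N\<close> and coefficients of
  modulus at most \<open>1\<close>, and \<open>h n\<close> the smallest value over coefficients of modulus at least \<open>1\<close>
  (\<open>max_flat\<close> and \<open>min_spread\<close> below).  Normalized successive blocks of an asymptotic basis again span
  an asymptotic space; cutting a vector of length \<open>n * m\<close> into \<open>n\<close> blocks of length \<open>m\<close> therefore gives
  \<open>f (n * m) \<le> f n * f m\<close> and \<open>h (n * m) \<ge> h n * h m\<close>.  So there are exponents \<open>\<alpha>\<close>, \<open>\<beta>\<close> with
  \<open>n powr \<beta> \<le> f n\<close> and \<open>h n \<le> n powr \<alpha>\<close>, both sharp up to \<open>n powr \<epsilon>\<close>, and \<open>p = 1 / \<beta>\<close>, \<open>q = 1 / \<alpha>\<close>.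
  
  The two estimates with a loss of \<open>\<epsilon>\<close> come from counting coordinates by size: a vector is a sum of
  pieces with coordinates of comparable modulus (\<open>upper_estimate\<close>), and the coordinates of modulus at
  least \<open>v\<close> start blocks of norm at least \<open>v / 2\<close> (\<open>lower_estimate\<close>).
  
  The estimate of the upper envelope from below loses no \<open>\<epsilon>\<close>.  A vector of length \<open>L\<close> that is extremal
  for \<open>f\<close> is cut into intervals of lengths proportional to \<open>\<bar>a j\<bar> powr p\<close>.  If \<open>L\<close> is a scale at which
  \<open>f n / n powr (\<beta> - \<eta>)\<close> attains a record, the blocks have norms at most a constant times
  \<open>\<bar>a j\<bar> * f L\<close>, so in the space of the normalized blocks some vector dominated by \<open>a\<close> has norm bounded
  below (\<open>max_flat_large_pieces\<close>).  Unimodular multipliers turn this vector into \<open>a\<close> itself, because a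
  convex function is largest at extreme points.
  
  The estimate of the lower envelope from above is the heart of the matter (\<open>spread_out_minimizer\<close>).
  The lower envelope is neither convex nor monotone in the moduli of the coefficients, so the blocks
  must have norms proportional to \<open>\<bar>a j\<bar>\<close> up to a negligible error.  Greedy cutting achieves this only if
  the coordinates are small compared with the norms of the blocks, whereas a vector \<open>c\<close> extremal for \<open>h\<close>
  may have large coordinates at every scale.  The remedy is to play many copies of \<open>c\<close> in parallel,
  with coefficients \<open>d k\<close> of modulus at most \<open>1\<close>.  The triangle inequality bounds the norm of the result
  by \<open>(\<Sum>k. \<bar>d k\<bar>)\<close> times the norm of \<open>c\<close>, and this factor disappears when the scale is chosen; but now a
  coordinate \<open>c j\<close> occurs in a group of norm at least \<open>\<bar>c j\<bar> * g d\<close>, where \<open>g\<close> is the lower envelope.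
  If \<open>g\<close> is unbounded on coefficients of modulus at most \<open>1\<close>, then \<open>d\<close> can be chosen so that single
  coordinates are negligible; if it is bounded there, the estimate is trivial.
  
  For the game, closure under blocks is seen by simulating one game inside another.  Everything else
  follows from \<open>tree_limit\<close>: whatever vectors \<open>\<tau>(Z1, \<dots>, Zi)\<close> the vector player can choose, the iterated
  limit of the norm of \<open>\<Sum>i. a i \<tau>(Z1, \<dots>, Zi)\<close>, along an ultrafilter of ever smaller members of the
  family, is the norm of an asymptotic space.
\<close>

section \<open>Tuples and successive blocks\<close>

definition restr :: "nat set \<Rightarrow> (nat \<Rightarrow> 'k::zero) \<Rightarrow> nat \<Rightarrow> 'k" where
  "restr I a = (\<lambda>i. if i \<in> I then a i else 0)"

lemma restr_in: "i \<in> I \<Longrightarrow> restr I a i = a i"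
  and restr_out: "i \<notin> I \<Longrightarrow> restr I a i = 0"
  by (simp_all add: restr_def)

lemma restr_tuples: "a \<in> tuples n \<Longrightarrow> restr I a \<in> tuples n"
  by (auto simp: restr_def tuples_def)

lemma restr_restr: "restr I (restr J a) = restr (I \<inter> J) a"
  by (auto simp: restr_def)

lemma tuples_supportD: "a \<in> tuples n \<Longrightarrow> a i \<noteq> 0 \<Longrightarrow> i < n"
  unfolding tuples_def by (rule ccontr) simp

lemma tuples_support: "a \<in> tuples n \<Longrightarrow> {i. a i \<noteq> 0} \<subseteq> {..<n}"
  using tuples_supportD by blast

lemma blocks_strict:
  fixes t :: "nat \<Rightarrow> nat"
  assumes "\<forall>j<k. t j < t (Suc j)" and "i < j" and "j \<le> k"
  shows "t i < t j"
  using assms(2,3)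
proof (induction j)
  case (Suc j)
  then have step: "t j < t (Suc j)" using assms(1) by simp
  show ?case
  proof (cases "i = j")
    case False
    then have "t i < t j" using Suc by simp
    then show ?thesis using step by simp
  qed (use step in simp)
qed simp

lemma blocks_disjoint:
  fixes t :: "nat \<Rightarrow> nat"
  assumes "\<forall>j<k. t j < t (Suc j)" and "i < k" "j < k"
    and "l \<in> {t i..<t (Suc i)}" "l \<in> {t j..<t (Suc j)}"
  shows "i = j"
proof (rule ccontr)
  assume "i \<noteq> j"
  then consider "Suc i \<le> j" | "Suc j \<le> i" by linarith
  then show False
  proof cases
    case 1
    then have "t (Suc i) \<le> t j"
      using blocks_strict[OF assms(1), of "Suc i" j] assms(3) by (cases "Suc i = j") auto
    then show False using assms(4,5) by auto
  next
    case 2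
    then have "t (Suc j) \<le> t i"
      using blocks_strict[OF assms(1), of "Suc j" i] assms(2) by (cases "Suc j = i") auto
    then show False using assms(4,5) by auto
  qed
qed

lemma sum_blocks:
  fixes t :: "nat \<Rightarrow> nat" and x :: "nat \<Rightarrow> 'k::comm_monoid_add"
  assumes "\<forall>j<k. t j < t (Suc j)"
  shows "(\<Sum>j<k. restr {t j..<t (Suc j)} x i) = restr {t 0..<t k} x i"
  using assms
proof (induction k)
  case 0
  then show ?case by (simp add: restr_def)
next
  case (Suc k)
  have "t 0 \<le> t k"
    using blocks_strict[OF Suc.prems, of 0 k] by (cases "k = 0") auto
  moreover have "t k < t (Suc k)" using Suc.prems by blast
  moreover have "(\<Sum>j<k. restr {t j..<t (Suc j)} x i) = restr {t 0..<t k} x i"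
    using Suc.IH Suc.prems by simp
  ultimately show ?case by (simp add: restr_def)
qed

lemma sum_delta_blocks:
  fixes t :: "nat \<Rightarrow> nat" and b :: "nat \<Rightarrow> 'k::semiring_1"
  assumes "\<forall>j<k. t j < t (Suc j)" "j < k" "i \<in> {t j..<t (Suc j)}"
  shows "(\<Sum>l<k. b l * restr {t l..<t (Suc l)} u i) = b j * u i"
proof -
  have "(\<Sum>l<k. b l * restr {t l..<t (Suc l)} u i) = (\<Sum>l<k. if l = j then b j * u i else 0)"
  proof (rule sum.cong)
    fix l assume "l \<in> {..<k}"
    then have l: "l < k" by simp
    show "b l * restr {t l..<t (Suc l)} u i = (if l = j then b j * u i else 0)"
    proof (cases "i \<in> {t l..<t (Suc l)}")
      case True
      have "l = j" by (rule blocks_disjoint[OF assms(1) l assms(2) True assms(3)])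
      then show ?thesis using restr_in[OF True, of u] by simp
    next
      case False
      then have "l \<noteq> j" using assms(3) by blast
      then show ?thesis using restr_out[OF False, of u] by simp
    qed
  qed simp
  then show ?thesis using assms(2) by simp
qed

text \<open>
  Every element of \<open>S\<close> starts a block that contains no other element of \<open>S\<close>.  The blocks cover
  everything from \<open>Min S\<close> up to \<open>n\<close>.
\<close>
lemma enumerate_positions:
  fixes S :: "nat set"
  assumes "S \<subseteq> {..<n}" and "card S = k" and "0 < k"
  obtains t where "\<forall>j<k. t j < t (Suc j)" and "t k = n" and "t ` {..<k} = S"
    and "\<And>j. j < k \<Longrightarrow> {t j..<t (Suc j)} \<inter> S = {t j}"
proof -
  have fin: "finite S" using assms(1) finite_subset by blast
  define xs where "xs = sorted_list_of_set S"
  have len: "length xs = k" and set: "set xs = S" and sw: "sorted_wrt (<) xs"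
    using fin assms(2) by (auto simp: xs_def)
  define t where "t = (\<lambda>j. if j < k then xs ! j else n)"
  have strict: "\<forall>j<k. t j < t (Suc j)"
  proof (intro allI impI)
    fix j assume j: "j < k"
    show "t j < t (Suc j)"
    proof (cases "Suc j < k")
      case True
      then show ?thesis using sorted_wrt_nth_less[OF sw, of j "Suc j"] len j by (simp add: t_def)
    next
      case False
      have "xs ! j \<in> S" using set len j nth_mem by blast
      then show ?thesis using False assms(1) j by (auto simp: t_def)
    qed
  qed
  have "t ` {..<k} = (\<lambda>j. xs ! j) ` {..<k}" by (rule image_cong) (simp_all add: t_def)
  also have "\<dots> = set xs" using len by (auto simp: set_conv_nth)
  finally have img: "t ` {..<k} = S" using set by simp
  have meet: "{t j..<t (Suc j)} \<inter> S = {t j}" if j: "j < k" for j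
  proof
    have "t j < t (Suc j)" using strict j by simp
    moreover have "t j \<in> S" using img j by blast
    ultimately show "{t j} \<subseteq> {t j..<t (Suc j)} \<inter> S" by simp
    show "{t j..<t (Suc j)} \<inter> S \<subseteq> {t j}"
    proof
      fix i assume i: "i \<in> {t j..<t (Suc j)} \<inter> S"
      then obtain l where l: "l < k" "i = t l" using img by blast
      have "t l < t (Suc l)" using strict l(1) by simp
      then have "l = j" by (intro blocks_disjoint[OF strict l(1) j, of i]) (use i l(2) in simp_all)
      then show "i \<in> {t j}" using l by simp
    qed
  qed
  show thesis by (rule that[OF strict _ img meet]) (auto simp: t_def)
qed

section \<open>Norms with basis constant at most two\<close>

lemma basis_constant_le_two:
  assumes "\<And>a m. a \<in> tuples n \<Longrightarrow> m \<le> n \<Longrightarrow> N (restr {..<m} a) \<le> 2 * N a"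
    and "\<And>a. a \<in> tuples n \<Longrightarrow> 0 \<le> N a"
  shows "basis_constant n N \<le> 2"
  unfolding basis_constant_def id_norm_def
proof (intro SUP_least)
  fix m :: nat and a :: "nat \<Rightarrow> 'a"
  assume m: "m \<in> {..n}" and a: "a \<in> tuples n"
  have "N (restr {..<m} a) / N a \<le> 2"
    using assms(1)[OF a, of m] assms(2)[OF a] m by (cases "N a = 0") (auto simp: pos_divide_le_eq)
  then show "ereal (N (\<lambda>i. if i < m then a i else 0) / N a) \<le> 2"
    by (simp add: restr_def)
qed

locale normed_class =
  fixes F :: "nat \<Rightarrow> ((nat \<Rightarrow> 'k::real_normed_field) \<Rightarrow> real) set"
  assumes based: "N \<in> F n \<Longrightarrow> N \<in> based_spaces n"
begin

lemma norm_on: "N \<in> F n \<Longrightarrow> is_norm n N"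
  and unit: "N \<in> F n \<Longrightarrow> j < n \<Longrightarrow> N (\<lambda>i. if i = j then 1 else 0) = 1"
  using based[of N n] by (simp_all add: based_spaces_def)

lemma scale: "N \<in> F n \<Longrightarrow> a \<in> tuples n \<Longrightarrow> N (\<lambda>i. c * a i) = norm c * N a"
  using norm_on[of N n] unfolding is_norm_def by simp

lemma scale_real:
  assumes "N \<in> F n" "a \<in> tuples n" "0 \<le> c" and b: "\<And>i. b i = of_real c * a i"
  shows "N b = c * N a"
proof -
  have "b = (\<lambda>i. of_real c * a i)" using b by blast
  then show ?thesis using scale[OF assms(1,2), of "of_real c"] assms(3) by simp
qed

lemma triangle: "N \<in> F n \<Longrightarrow> a \<in> tuples n \<Longrightarrow> b \<in> tuples n \<Longrightarrow> N (\<lambda>i. a i + b i) \<le> N a + N b"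
  using norm_on[of N n] unfolding is_norm_def by simp

lemma zero: "N \<in> F n \<Longrightarrow> N (\<lambda>_. 0) = 0"
  using scale[of N n "\<lambda>_. 0" 0] by (simp add: tuples_def)

lemma zero_iff: "N \<in> F n \<Longrightarrow> a \<in> tuples n \<Longrightarrow> N a = 0 \<longleftrightarrow> a = (\<lambda>_. 0)"
  using norm_on[of N n] zero[of N n] unfolding is_norm_def by auto

lemma neg: "N \<in> F n \<Longrightarrow> a \<in> tuples n \<Longrightarrow> N (\<lambda>i. - a i) = N a"
  using scale[of N n a "-1"] by simp

lemma diff: "N \<in> F n \<Longrightarrow> a \<in> tuples n \<Longrightarrow> b \<in> tuples n \<Longrightarrow> N (\<lambda>i. a i - b i) \<le> N a + N b"
  using triangle[of N n a "\<lambda>i. - b i"] neg[of N n b] by (simp add: tuples_def)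

lemma nonneg:
  assumes "N \<in> F n" "a \<in> tuples n"
  shows "0 \<le> N a"
  using diff[OF assms assms(2)] zero[OF assms(1)] by simp

lemma initial:
  assumes N: "N \<in> F n" and a: "a \<in> tuples n"
  shows "N (restr {..<m} a) \<le> 2 * N a"
proof (cases "m \<le> n \<and> N a \<noteq> 0")
  case True
  then have "ereal (N (restr {..<m} a) / N a) \<le> id_norm n N (\<lambda>a. N (\<lambda>i. if i < m then a i else 0))"
    unfolding id_norm_def by (intro SUP_upper2[OF a]) (simp add: restr_def)
  also have "\<dots> \<le> basis_constant n N"
    unfolding basis_constant_def by (rule SUP_upper) (use True in simp)
  also have "\<dots> \<le> ereal 2" using based[OF N] by (simp add: based_spaces_def)
  finally show ?thesis using True nonneg[OF N a] by (simp add: pos_divide_le_eq)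
next
  case False
  then consider "n < m" | "a = (\<lambda>_. 0)" using zero_iff[OF N a] by linarith
  then show ?thesis
  proof cases
    case 1
    then have "restr {..<m} a = a" using a by (auto simp: restr_def tuples_def fun_eq_iff)
    then show ?thesis using nonneg[OF N a] by simp
  next
    case 2
    then show ?thesis using zero[OF N] by (simp add: restr_def)
  qed
qed

lemma sum_le:
  assumes "N \<in> F n" "finite S" "\<And>k. k \<in> S \<Longrightarrow> g k \<in> tuples n"
  shows "N (\<lambda>i. \<Sum>k\<in>S. g k i) \<le> (\<Sum>k\<in>S. N (g k))"
  using assms(2,3)
proof (induction S rule: finite_induct)
  case empty
  then show ?case using zero[OF assms(1)] by simp
next
  case (insert k S)
  have "(\<lambda>i. \<Sum>k\<in>S. g k i) \<in> tuples n" using insert.prems by (auto simp: tuples_def)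
  then have "N (\<lambda>i. g k i + (\<Sum>k\<in>S. g k i)) \<le> N (g k) + N (\<lambda>i. \<Sum>k\<in>S. g k i)"
    using triangle[OF assms(1)] insert.prems by blast
  also have "\<dots> \<le> N (g k) + (\<Sum>k\<in>S. N (g k))" using insert.IH insert.prems by simp
  finally show ?case using insert.hyps by simp
qed

lemma add_le:
  assumes N: "N \<in> F n" and a: "a \<in> tuples n" and b: "b \<in> tuples n" and c: "\<And>i. c i = a i + b i"
  shows "N c \<le> N a + N b"
  using triangle[OF N a b] by (simp add: c[symmetric])

lemma single:
  assumes "N \<in> F n" "j < n"
  shows "N (\<lambda>i. if i = j then c else 0) = norm c"
proof -
  have "(\<lambda>i. if i = j then c else 0) = (\<lambda>i. c * (if i = j then 1 else 0))" by auto
  then show ?thesis using scale[OF assms(1), of "\<lambda>i. if i = j then 1 else 0" c] unit[OF assms] assms(2)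
    by (simp add: tuples_def)
qed

lemma le_sum_norms:
  assumes "N \<in> F n" "a \<in> tuples n"
  shows "N a \<le> (\<Sum>i<n. norm (a i))"
proof -
  have "a = (\<lambda>i. \<Sum>j<n. if i = j then a j else 0)"
    using assms(2) by (auto simp: tuples_def fun_eq_iff not_less)
  then have "N a \<le> (\<Sum>j<n. N (\<lambda>i. if i = j then a j else 0))"
    using sum_le[OF assms(1), of "{..<n}" "\<lambda>j i. if i = j then a j else 0"] by (simp add: tuples_def)
  then show ?thesis using single[OF assms(1)] by simp
qed

lemma final:
  assumes "N \<in> F n" "a \<in> tuples n"
  shows "N (restr {m..} a) \<le> 3 * N a"
proof -
  have "restr {m..} a = (\<lambda>i. a i - restr {..<m} a i)" by (auto simp: restr_def)
  then show ?thesis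
    using diff[OF assms restr_tuples[OF assms(2)], of "{..<m}"] initial[OF assms, of m] by simp
qed

lemma interval:
  assumes "N \<in> F n" "a \<in> tuples n"
  shows "N (restr {s..<t} a) \<le> 4 * N a"
proof (cases "s \<le> t")
  case True
  then have "restr {s..<t} a = (\<lambda>i. restr {..<t} a i - restr {..<s} a i)" by (auto simp: restr_def)
  then show ?thesis
    using diff[OF assms(1) restr_tuples[OF assms(2)] restr_tuples[OF assms(2)], of "{..<t}" "{..<s}"]
      initial[OF assms, of t] initial[OF assms, of s] by simp
next
  case False
  then have "restr {s..<t} a = (\<lambda>_. 0)" by (auto simp: restr_def)
  then show ?thesis using zero[OF assms(1)] nonneg[OF assms] by simp
qed

lemma coordinate:
  assumes "N \<in> F n" "a \<in> tuples n"
  shows "norm (a i) \<le> 4 * N a"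
proof (cases "i < n")
  case True
  have "restr {i..<Suc i} a = (\<lambda>j. if j = i then a i else 0)" by (auto simp: restr_def)
  then show ?thesis using interval[OF assms, of i "Suc i"] single[OF assms(1) True] by simp
next
  case False
  then show ?thesis using nonneg[OF assms] assms(2) by (simp add: tuples_def)
qed

lemma first_coordinate:
  assumes N: "N \<in> F n" and a: "a \<in> tuples n" and z: "\<And>j. j < i \<Longrightarrow> a j = 0"
  shows "norm (a i) \<le> 2 * N a"
proof (cases "i < n")
  case True
  have "restr {..<Suc i} a = (\<lambda>j. if j = i then a i else 0)" using z by (auto simp: restr_def less_Suc_eq)
  then show ?thesis using initial[OF N a, of "Suc i"] single[OF N True] by simp
next
  case False
  then show ?thesis using nonneg[OF N a] a by (simp add: tuples_def)
qed

end

text \<open>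
  The lemmas are wanted both for all based spaces and for classes with better closure properties.
\<close>
interpretation based: normed_class based_spaces
  by unfold_locales

section \<open>Classes closed under blocks and parallel sums\<close>

text \<open>
  The estimates for the envelopes use only these properties of asymptotic spaces.  The vector \<open>u\<close> in
  \<open>block\<close> carries all blocks at once.  For asymptotic spaces, the \<open>M\<close> in \<open>parallel\<close> contains \<open>T\<close> almost
  isometric copies of \<open>N\<close>, interlaced so that the \<open>j\<close>-th vectors of all copies come before the \<open>(j+1)\<close>-st ones;
  the bound is the triangle inequality for the sum of the copies of \<open>c\<close>, weighted by \<open>d\<close>.
\<close>
locale envelope_class = normed_class F
  for F :: "nat \<Rightarrow> ((nat \<Rightarrow> 'k::real_normed_field) \<Rightarrow> real) set" +
  assumes nonempty: "F n \<noteq> {}"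
    and block: "N \<in> F n \<Longrightarrow> u \<in> tuples n \<Longrightarrow> \<forall>j<k. t j < t (Suc j) \<Longrightarrow> t k \<le> n \<Longrightarrow>
      \<forall>j<k. N (restr {t j..<t (Suc j)} u) = 1 \<Longrightarrow>
      (\<lambda>b. N (\<lambda>i. \<Sum>j<k. b j * restr {t j..<t (Suc j)} u i)) \<in> F k"
    and parallel: "N \<in> F n \<Longrightarrow> c \<in> tuples n \<Longrightarrow> d \<in> tuples T \<Longrightarrow> 0 < \<delta> \<Longrightarrow>
      \<exists>M\<in>F (n * T). M (\<lambda>i. c (i div T) * d (i mod T)) \<le> (\<Sum>k<T. norm (d k)) * N c + \<delta>"
begin

lemma subsequence:
  assumes N: "N \<in> F n" and s: "\<forall>j<m. s j < s (Suc j)" "s m \<le> n" and \<theta>: "\<forall>j<m. norm (\<theta> j) = 1"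
  shows "\<exists>M\<in>F m. \<forall>b. M b = N (\<lambda>i. \<Sum>j<m. if i = s j then \<theta> j * b j else 0)"
proof -
  define u where "u = (\<lambda>i. \<Sum>j<m. if i = s j then \<theta> j else 0)"
  have lt: "s j < n" if "j < m" for j
    using blocks_strict[OF s(1) that order.refl] s(2) by linarith
  have "u i = 0" if "n \<le> i" for i
    unfolding u_def
  proof (rule sum.neutral, intro ballI)
    fix j assume "j \<in> {..<m}"
    then show "(if i = s j then \<theta> j else 0) = 0" using lt[of j] that by simp
  qed
  then have u: "u \<in> tuples n" by (simp add: tuples_def)
  have restru: "restr {s j..<s (Suc j)} u = (\<lambda>i. if i = s j then \<theta> j else 0)" if j: "j < m" for j
  proof
    fix i
    have "u i = (\<Sum>l<m. if l = j then (if i = s j then \<theta> j else 0) else 0)"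
      if i: "i \<in> {s j..<s (Suc j)}"
      unfolding u_def
    proof (rule sum.cong)
      fix l assume "l \<in> {..<m}"
      then have l: "l < m" "s l < s (Suc l)" using s(1) by auto
      show "(if i = s l then \<theta> l else 0) = (if l = j then (if i = s j then \<theta> j else 0) else 0)"
      proof (cases "i = s l")
        case True
        have "l = j" by (rule blocks_disjoint[OF s(1) l(1) j _ i]) (use True l in simp)
        then show ?thesis by simp
      next
        case False
        then show ?thesis by (cases "l = j") simp_all
      qed
    qed simp
    moreover have "s j < s (Suc j)" using j s(1) by blast
    moreover have "(\<Sum>l<m. if l = j then (if i = s j then \<theta> j else 0) else 0)
        = (if i = s j then \<theta> j else 0)" using j by simp
    ultimately have "u i = (if i = s j then \<theta> j else 0)" if "i \<in> {s j..<s (Suc j)}"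
      using that by simp
    moreover have "i \<noteq> s j" if "i \<notin> {s j..<s (Suc j)}"
      using that \<open>s j < s (Suc j)\<close> by auto
    ultimately show "restr {s j..<s (Suc j)} u i = (if i = s j then \<theta> j else 0)"
      unfolding restr_def by presburger
  qed
  have "(\<lambda>b. N (\<lambda>i. \<Sum>j<m. b j * restr {s j..<s (Suc j)} u i)) \<in> F m"
    by (rule block[OF N u s]) (use restru single[OF N lt] \<theta> in auto)
  moreover have "(\<lambda>i. \<Sum>j<m. b j * restr {s j..<s (Suc j)} u i)
      = (\<lambda>i. \<Sum>j<m. if i = s j then \<theta> j * b j else 0)" for b
    by (intro ext sum.cong) (auto simp: restru mult.commute)
  ultimately show ?thesis by (intro bexI) auto
qed

lemma twist:
  assumes N: "N \<in> F n" and \<theta>: "\<forall>j<n. norm (\<theta> j) = 1"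
  shows "\<exists>M\<in>F n. \<forall>b\<in>tuples n. M b = N (\<lambda>i. \<theta> i * b i)"
proof -
  obtain M where M: "M \<in> F n" "\<And>b. M b = N (\<lambda>i. \<Sum>j<n. if i = j then \<theta> j * b j else 0)"
    using subsequence[OF N, of n "\<lambda>j. j" \<theta>] \<theta> by auto
  have eq: "(\<lambda>i. \<Sum>j<n. if i = j then \<theta> j * b j else 0) = (\<lambda>i. \<theta> i * b i)" if "b \<in> tuples n" for b
    using that by (auto simp: tuples_def fun_eq_iff not_less)
  have "M b = N (\<lambda>i. \<theta> i * b i)" if "b \<in> tuples n" for b
    unfolding M(2) eq[OF that] ..
  then show ?thesis using M(1) by blast
qed

lemma window:
  assumes N: "N \<in> F n" and "s + m \<le> n"
  shows "\<exists>M\<in>F m. \<forall>b\<in>tuples m. M b = N (\<lambda>i. if s \<le> i then b (i - s) else 0)"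
proof -
  obtain M where M: "M \<in> F m" "\<And>b. M b = N (\<lambda>i. \<Sum>j<m. if i = s + j then b j else 0)"
    using subsequence[OF N, of m "\<lambda>j. s + j" "\<lambda>_. 1"] assms(2) by (auto cong: if_cong)
  have eq: "(\<lambda>i. \<Sum>j<m. if i = s + j then b j else 0) = (\<lambda>i. if s \<le> i then b (i - s) else 0)"
    if b: "b \<in> tuples m" for b
  proof
    fix i
    show "(\<Sum>j<m. if i = s + j then b j else 0) = (if s \<le> i then b (i - s) else 0)"
    proof (cases "s \<le> i")
      case True
      then have "(\<Sum>j<m. if i = s + j then b j else 0) = (\<Sum>j<m. if j = i - s then b j else 0)"
        by (intro sum.cong) auto
      then show ?thesis using True b by (auto simp: tuples_def)
    qed (auto intro!: sum.neutral)
  qed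
  have "M b = N (\<lambda>i. if s \<le> i then b (i - s) else 0)" if "b \<in> tuples m" for b
    unfolding M(2) eq[OF that] ..
  then show ?thesis using M(1) by blast
qed

text \<open>
  The form in which closure under blocks is applied: the norm of a vector is the norm, in the space of
  its normalized blocks, of the sequence of the norms of the blocks.
\<close>
lemma block_norms:
  assumes N: "N \<in> F n" and x: "x \<in> tuples n" and t: "\<forall>j<k. t j < t (Suc j)" "t k \<le> n"
  shows "\<exists>M\<in>F k. M (\<lambda>j. if j < k then of_real (N (restr {t j..<t (Suc j)} x)) else 0)
    = N (restr {t 0..<t k} x)"
proof -
  define A where "A = (\<lambda>j. restr {t j..<t (Suc j)} x)"
  have A: "A j \<in> tuples n" for j using x by (simp add: A_def restr_tuples)
  \<comment> \<open>A zero block is replaced by a unit vector, which then gets the coefficient \<open>0\<close>.\<close>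
  define v where "v = (\<lambda>j. if N (A j) = 0 then (\<lambda>i. if i = t j then 1 else 0)
      else (\<lambda>i. of_real (1 / N (A j)) * A j i))"
  have lt: "t j < n" if "j < k" for j
    using blocks_strict[OF t(1) that order.refl] t(2) by linarith
  have v: "v j \<in> tuples n" if "j < k" for j
    using A lt[OF that] by (auto simp: v_def tuples_def)
  have Nv: "N (v j) = 1" if "j < k" for j
    using scale[OF N A, of "of_real (1 / N (A j))" j] nonneg[OF N A, of j] unit[OF N lt[OF that]]
    by (auto simp: v_def norm_divide)
  define u where "u = (\<lambda>i. \<Sum>j<k. restr {t j..<t (Suc j)} (v j) i)"
  have "u i = 0" if "n \<le> i" for i
    unfolding u_def
  proof (rule sum.neutral, intro ballI)
    fix j assume "j \<in> {..<k}"
    then show "restr {t j..<t (Suc j)} (v j) i = 0"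
      using v[of j] that by (simp add: restr_def tuples_def)
  qed
  then have u: "u \<in> tuples n" by (simp add: tuples_def)
  have restru: "restr {t j..<t (Suc j)} u = v j" if j: "j < k" for j
  proof
    fix i
    have inside: "u i = v j i" if i: "i \<in> {t j..<t (Suc j)}"
    proof -
      have "u i = (\<Sum>l<k. if l = j then v j i else 0)"
        unfolding u_def
      proof (rule sum.cong)
        fix l assume "l \<in> {..<k}"
        then have l: "l < k" by simp
        show "restr {t l..<t (Suc l)} (v l) i = (if l = j then v j i else 0)"
        proof (cases "i \<in> {t l..<t (Suc l)}")
          case True
          have "l = j" by (rule blocks_disjoint[OF t(1) l j True i])
          then show ?thesis using i by (simp add: restr_def)
        next
          case False
          then have "l \<noteq> j" using i by blast
          then show ?thesis using False by (auto simp: restr_def)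
        qed
      qed simp
      then show ?thesis using j by simp
    qed
    have out: "v j i = 0" if i: "i \<notin> {t j..<t (Suc j)}"
    proof -
      have "t j < t (Suc j)" using t(1) j by blast
      then have "i \<noteq> t j" using i by auto
      moreover have "A j i = 0" unfolding A_def by (rule restr_out[OF i])
      ultimately show ?thesis by (simp add: v_def)
    qed
    show "restr {t j..<t (Suc j)} u i = v j i"
    proof (cases "i \<in> {t j..<t (Suc j)}")
      case True
      then show ?thesis unfolding restr_in[OF True] by (rule inside)
    next
      case False
      then show ?thesis unfolding restr_out[OF False] by (rule out[symmetric])
    qed
  qed
  let ?M = "\<lambda>b. N (\<lambda>i. \<Sum>j<k. b j * restr {t j..<t (Suc j)} u i)"
  have M: "?M \<in> F k" by (rule block[OF N u t]) (use restru Nv in auto)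
  have total: "(\<Sum>j<k. (if j < k then of_real (N (A j)) else 0) * restr {t j..<t (Suc j)} u i)
      = restr {t 0..<t k} x i" for i
  proof -
    have "(\<Sum>j<k. (if j < k then of_real (N (A j)) else 0) * restr {t j..<t (Suc j)} u i)
       = (\<Sum>j<k. restr {t j..<t (Suc j)} x i)"
    proof (rule sum.cong)
      fix j assume "j \<in> {..<k}"
      then have j: "j < k" by simp
      have "of_real (N (A j)) * v j i = A j i"
      proof (cases "N (A j) = 0")
        case True
        then have "A j = (\<lambda>_. 0)" using zero_iff[OF N A] by simp
        then show ?thesis using True by simp
      qed (simp add: v_def)
      then show "(if j < k then of_real (N (A j)) else 0) * restr {t j..<t (Suc j)} u i
          = restr {t j..<t (Suc j)} x i"
        unfolding restru[OF j] using j A_def by auto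
    qed simp
    then show ?thesis using sum_blocks[OF t(1), of x i] by simp
  qed
  have "?M (\<lambda>j. if j < k then of_real (N (A j)) else 0) = N (restr {t 0..<t k} x)"
    unfolding total ..
  then show ?thesis unfolding A_def by (rule bexI[OF _ M])
qed

end

section \<open>Growth exponents and proportional partitions\<close>

lemma record_high:
  fixes \<Psi> :: "nat \<Rightarrow> real"
  assumes unb: "\<And>K. \<exists>n. K < \<Psi> n"
  obtains L where "L0 \<le> L" and "\<And>n. n \<le> L \<Longrightarrow> \<Psi> n \<le> \<Psi> L"
proof -
  define K where "K = Max (\<Psi> ` {..L0})"
  define L where "L = (LEAST n. K < \<Psi> n)"
  have L: "K < \<Psi> L" unfolding L_def using unb LeastI_ex by metis
  have below: "\<Psi> n \<le> K" if "n < L" for n using not_less_Least that unfolding L_def by fastforce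
  have "\<Psi> n \<le> K" if "n \<le> L0" for n unfolding K_def using that by (intro Max_ge) auto
  from this[of L] have "L0 \<le> L" using L by (cases "L \<le> L0") auto
  moreover have "\<Psi> n \<le> \<Psi> L" if "n \<le> L" for n
    using below[of n] L that by (cases "n = L") auto
  ultimately show thesis using that by blast
qed

text \<open>
  Fekete's lemma for \<open>ln f\<close> as a function of \<open>ln n\<close>.  Monotonicity of \<open>f\<close>, which would reduce the last
  estimate to powers of a single \<open>k\<close>, is replaced by subadditivity: \<open>n = k * q + r\<close> gives
  \<open>f n \<le> f k * f q + k\<close>, and the contraction \<open>f k < k powr s\<close> absorbs the additive error.
\<close>
lemma submultiplicative_exponent:
  fixes f :: "nat \<Rightarrow> real"
  assumes one: "\<And>n. 1 \<le> n \<Longrightarrow> 1 \<le> f n" and le: "\<And>n. 1 \<le> n \<Longrightarrow> f n \<le> real n"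
    and mult: "\<And>n m. 1 \<le> n \<Longrightarrow> 1 \<le> m \<Longrightarrow> f (n * m) \<le> f n * f m"
    and add: "\<And>n m. 1 \<le> n \<Longrightarrow> 1 \<le> m \<Longrightarrow> f (n + m) \<le> f n + f m"
  obtains \<beta> where "0 \<le> \<beta>" "\<beta> \<le> 1" "\<And>n. 1 \<le> n \<Longrightarrow> real n powr \<beta> \<le> f n"
    "\<And>s. \<beta> < s \<Longrightarrow> \<exists>C>0. \<forall>n\<ge>1. f n \<le> C * real n powr s"
proof -
  define A where "A = (\<lambda>n. ln (f n) / ln (real n)) ` {2..}"
  define \<beta> where "\<beta> = Inf A"
  have A0: "0 \<le> x" if "x \<in> A" for x
    using that one unfolding A_def by fastforce
  have bdd: "bdd_below A" using A0 by (meson bdd_belowI)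
  have ne: "A \<noteq> {}" by (auto simp: A_def)
  have "0 \<le> \<beta>" unfolding \<beta>_def using ne A0 by (meson cInf_greatest)
  moreover have "\<beta> \<le> 1"
  proof -
    have "\<beta> \<le> ln (f 2) / ln 2" unfolding \<beta>_def
      by (rule cInf_lower[OF _ bdd]) (auto simp: A_def intro!: image_eqI[of _ _ 2])
    also have "\<dots> \<le> 1" using le[of 2] one[of 2] by simp
    finally show ?thesis .
  qed
  moreover have "real n powr \<beta> \<le> f n" if n: "1 \<le> n" for n
  proof (cases "n = 1")
    case False
    then have n2: "2 \<le> n" using n by simp
    have "\<beta> \<le> ln (f n) / ln (real n)" unfolding \<beta>_def
      by (rule cInf_lower[OF _ bdd]) (use n2 in \<open>auto simp: A_def\<close>)
    then have "\<beta> * ln (real n) \<le> ln (f n)" using n2 by (simp add: field_simps)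
    then have "exp (\<beta> * ln (real n)) \<le> exp (ln (f n))" by simp
    then show ?thesis using n2 one[OF n] by (simp add: powr_def)
  qed (use one in simp)
  moreover have "\<exists>C>0. \<forall>n\<ge>1. f n \<le> C * real n powr s" if s: "\<beta> < s" for s
  proof -
    obtain x where x: "x \<in> A" "x < s" using cInf_lessD[OF ne] s unfolding \<beta>_def by blast
    then obtain k where k: "2 \<le> k" "ln (f k) / ln (real k) < s" by (auto simp: A_def)
    then have "ln (f k) < s * ln (real k)" by (simp add: field_simps)
    then have "exp (ln (f k)) < exp (s * ln (real k))" by simp
    moreover have "exp (ln (f k)) = f k" using k(1) one[of k] by simp
    ultimately have fk: "f k < real k powr s" using k(1) by (simp add: powr_def)
    have sp: "0 < s" using \<open>0 \<le> \<beta>\<close> s by linarith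
    define \<rho> where "\<rho> = f k / real k powr s"
    have \<rho>: "0 < \<rho>" "\<rho> < 1" using fk k(1) one[of k] by (auto simp: \<rho>_def)
    define C where "C = real k / (1 - \<rho>)"
    have C: "real k \<le> C" "C * \<rho> + real k = C"
    proof -
      have "real k * (1 - \<rho>) \<le> real k * 1" using \<rho> by (intro mult_left_mono) auto
      then show "real k \<le> C" unfolding C_def using \<rho> by (simp add: field_simps)
      show "C * \<rho> + real k = C" unfolding C_def using \<rho> by (simp add: field_simps)
    qed
    have Cp: "0 < C" using C(1) k(1) by linarith
    have "f n \<le> C * real n powr s" if "1 \<le> n" for n
      using that
    proof (induction n rule: less_induct)
      case (less n)
      have n1: "1 \<le> real n powr s" using less.prems sp by (simp add: ge_one_powr_ge_zero)
      show ?case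
      proof (cases "n < k")
        case True
        have "f n \<le> C * 1" using le[OF less.prems] True C(1) by simp
        also have "\<dots> \<le> C * real n powr s" using n1 Cp by (intro mult_left_mono) auto
        finally show ?thesis .
      next
        case False
        define q r where "q = n div k" and "r = n mod k"
        have n: "n = k * q + r" "r < k" using k(1) by (auto simp: q_def r_def)
        have q: "1 \<le> q" using False k(1) by (simp add: q_def div_greater_zero_iff Suc_le_eq)
        have "2 * q \<le> k * q" using k(1) by simp
        then have qn: "q < n" using q n(1) by linarith
        have "f (k * q) \<le> f k * f q" by (rule mult) (use k q in auto)
        also have "\<dots> \<le> f k * (C * real q powr s)"
          using less.IH[OF qn q] one[of k] k(1) by (intro mult_left_mono) auto
        also have "\<dots> \<le> C * \<rho> * real n powr s"
        proof -
          have "(real k * real q) powr s \<le> real n powr s"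
            using n(1) sp by (intro powr_mono2) (auto simp flip: of_nat_mult)
          then have "real k powr s * real q powr s \<le> real n powr s" by (simp add: powr_mult)
          then have "C * \<rho> * (real k powr s * real q powr s) \<le> C * \<rho> * real n powr s"
            using Cp \<rho> by (intro mult_left_mono) auto
          moreover have "f k = \<rho> * real k powr s" using k(1) by (simp add: \<rho>_def)
          ultimately show ?thesis by (simp add: mult_ac)
        qed
        finally have 1: "f (k * q) \<le> C * \<rho> * real n powr s" .
        have 2: "f n \<le> f (k * q) + real k"
        proof (cases "r = 0")
          case False
          then have "f n \<le> f (k * q) + f r" using add[of "k * q" r] n k(1) q by simp
          then show ?thesis using le[of r] False n(2) by simp
        qed (use n in simp)
        have "real k * 1 \<le> real k * real n powr s" using n1 by (intro mult_left_mono) auto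
        then have "f n \<le> (C * \<rho> + real k) * real n powr s" using 1 2 by (simp add: algebra_simps)
        then show ?thesis using C(2) by simp
      qed
    qed
    then show ?thesis using Cp by blast
  qed
  ultimately show thesis using that by blast
qed

lemma proportional_partition:
  fixes \<gamma> :: "nat \<Rightarrow> real"
  assumes "\<And>j. j < m \<Longrightarrow> 0 < \<gamma> j" and sum: "(\<Sum>j<m. \<gamma> j) = 1" and L: "\<And>j. j < m \<Longrightarrow> 2 \<le> \<gamma> j * real L"
  obtains t where "t 0 = 0" "t m = L" "\<forall>j<m. t j < t (Suc j)"
    "\<And>j. j < m \<Longrightarrow> \<gamma> j * real L / 2 \<le> real (t (Suc j) - t j)"
    "\<And>j. j < m \<Longrightarrow> real (t (Suc j) - t j) \<le> 2 * (\<gamma> j * real L)"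
proof -
  define T where "T = (\<lambda>j. real L * (\<Sum>i<j. \<gamma> i))"
  define t where "t = (\<lambda>j. nat \<lfloor>T j\<rfloor>)"
  have T0: "0 \<le> T j" if "j \<le> m" for j
    unfolding T_def using that assms(1) by (intro mult_nonneg_nonneg sum_nonneg) (auto intro: less_imp_le)
  have tT: "real (t j) \<le> T j" "T j < real (t j) + 1" if "j \<le> m" for j
    using T0[OF that] by (auto simp: t_def)
  have step: "T (Suc j) = T j + \<gamma> j * real L" for j by (simp add: T_def algebra_simps)
  have bounds: "t j < t (Suc j) \<and> \<gamma> j * real L / 2 \<le> real (t (Suc j) - t j)
      \<and> real (t (Suc j) - t j) \<le> 2 * (\<gamma> j * real L)" if j: "j < m" for j
  proof -
    have a: "real (t (Suc j)) - real (t j) < \<gamma> j * real L + 1"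
      "\<gamma> j * real L - 1 < real (t (Suc j)) - real (t j)"
      using tT[of j] tT[of "Suc j"] step[of j] j by auto
    have lt: "t j < t (Suc j)" using a(2) L[OF j] by linarith
    then have eq: "real (t (Suc j) - t j) = real (t (Suc j)) - real (t j)" by (simp add: of_nat_diff)
    show ?thesis using a L[OF j] lt unfolding eq by linarith
  qed
  show thesis
  proof (rule that[of t])
    show "t 0 = 0" "t m = L" by (simp_all add: t_def T_def sum)
  qed (use bounds in blast)+
qed

text \<open>
  Intervals of lengths proportional to \<open>\<gamma>\<close>, together with an exponent \<open>\<eta>\<close> so small that the \<open>\<eta>\<close>-th power
  of the ratio of the lengths of a part and of the whole costs at most a factor \<open>2\<close>.  Combined with a
  scale \<open>L\<close> at which a function perturbed by \<open>n powr \<eta>\<close> attains a record, this bounds the unperturbed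
  function on all parts by its value at \<open>L\<close>.
\<close>
lemma proportional_scales:
  fixes \<gamma> :: "nat \<Rightarrow> real"
  assumes m: "1 \<le> m" and \<gamma>: "\<And>j. j < m \<Longrightarrow> 0 < \<gamma> j" "(\<Sum>j<m. \<gamma> j) = 1"
  obtains \<eta> L0 where "0 < \<eta>" "1 \<le> L0"
    "\<And>L. L0 \<le> L \<Longrightarrow> \<exists>t. t 0 = 0 \<and> t m = L \<and> (\<forall>j<m. t j < t (Suc j)) \<and>
      (\<forall>j<m. let q = real (t (Suc j) - t j) / real L in \<gamma> j / 2 \<le> q \<and> q \<le> 2 * \<gamma> j \<and> 1 / 2 \<le> q powr \<eta>)"
proof -
  define g where "g = Min (\<gamma> ` {..<m}) / 2"
  have ne: "\<gamma> ` {..<m} \<noteq> {}" using m by (auto simp: lessThan_empty_iff)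
  have gle: "2 * g \<le> \<gamma> j" if "j < m" for j using that by (auto simp: g_def)
  have g0: "0 < g" unfolding g_def using ne \<gamma>(1) by simp
  have "\<gamma> 0 \<le> (\<Sum>j<m. \<gamma> j)" by (rule member_le_sum) (use m \<gamma>(1) less_imp_le in auto)
  then have g1: "g < 1" using gle[of 0] m g0 \<gamma>(2) by simp
  \<comment> \<open>This is the solution of \<open>g powr \<eta> = 1 / 2\<close>.\<close>
  define \<eta> where "\<eta> = ln 2 / (- ln g)"
  have \<eta>: "0 < \<eta>" unfolding \<eta>_def using g0 g1 by (intro divide_pos_pos) auto
  have "g powr (- \<eta>) = 2" using g0 g1 by (simp add: \<eta>_def powr_def)
  moreover have "g powr \<eta> = inverse (g powr (- \<eta>))" by (simp add: powr_minus)
  ultimately have g\<eta>: "g powr \<eta> = 1 / 2" by simp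
  show thesis
  proof (rule that[OF \<eta>])
    show "1 \<le> Suc (nat \<lceil>2 / g\<rceil>)" by simp
    fix L assume L: "Suc (nat \<lceil>2 / g\<rceil>) \<le> L"
    then have L0: "0 < real L" by simp
    have "2 / g \<le> real L" using L by linarith
    then have "2 \<le> g * real L" using g0 by (simp add: field_simps)
    moreover have "g * real L \<le> \<gamma> j * real L" if "j < m" for j
      using gle[OF that] g0 by (intro mult_right_mono) auto
    ultimately have gL: "2 \<le> \<gamma> j * real L" if "j < m" for j using that by force
    obtain t where t: "t 0 = 0" "t m = L" "\<forall>j<m. t j < t (Suc j)"
      "\<And>j. j < m \<Longrightarrow> \<gamma> j * real L / 2 \<le> real (t (Suc j) - t j)"
      "\<And>j. j < m \<Longrightarrow> real (t (Suc j) - t j) \<le> 2 * (\<gamma> j * real L)"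
      using proportional_partition[OF \<gamma> gL] by blast
    have "let q = real (t (Suc j) - t j) / real L in \<gamma> j / 2 \<le> q \<and> q \<le> 2 * \<gamma> j \<and> 1 / 2 \<le> q powr \<eta>"
      if j: "j < m" for j
    proof -
      define q where "q = real (t (Suc j) - t j) / real L"
      have q: "\<gamma> j / 2 \<le> q" "q \<le> 2 * \<gamma> j"
        using t(4,5)[OF j] L0 by (simp_all add: q_def pos_le_divide_eq pos_divide_le_eq)
      then have "g \<le> q" using gle[OF j] by linarith
      then have "1 / 2 \<le> q powr \<eta>" using powr_mono2[of \<eta> g q] g0 \<eta> g\<eta> by simp
      then show ?thesis using q by (simp add: Let_def q_def)
    qed
    then show "\<exists>t. t 0 = 0 \<and> t m = L \<and> (\<forall>j<m. t j < t (Suc j)) \<and>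
      (\<forall>j<m. let q = real (t (Suc j) - t j) / real L in \<gamma> j / 2 \<le> q \<and> q \<le> 2 * \<gamma> j \<and> 1 / 2 \<le> q powr \<eta>)"
      using t(1-3) by blast
  qed
qed

lemma powr_add_le:
  fixes u v \<beta> :: real
  assumes "0 \<le> u" "0 \<le> v" "0 \<le> \<beta>" "\<beta> \<le> 1"
  shows "(u + v) powr \<beta> \<le> u powr \<beta> + v powr \<beta>"
proof (cases "u + v = 0")
  case False
  define w where "w = u + v"
  have w: "0 < w" using False assms unfolding w_def by linarith
  have le: "z / w \<le> z powr \<beta> / w powr \<beta>" if "0 \<le> z" "z \<le> w" for z
  proof (cases "z = 0")
    case False
    have "(z / w) powr 1 \<le> (z / w) powr \<beta>"
      using that w assms False by (intro powr_mono') auto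
    then show ?thesis using that w by (simp add: powr_divide)
  qed simp
  have "1 = u / w + v / w" using w by (simp add: w_def flip: add_divide_distrib)
  also have "\<dots> \<le> u powr \<beta> / w powr \<beta> + v powr \<beta> / w powr \<beta>"
    using le[of u] le[of v] assms by (simp add: w_def)
  finally show ?thesis using w by (simp add: field_simps w_def)
qed (use assms in simp)

section \<open>The upper envelope\<close>

context envelope_class
begin

definition max_flat :: "nat \<Rightarrow> real" where
  "max_flat n = Sup {N x | N x. N \<in> F n \<and> x \<in> tuples n \<and> (\<forall>i<n. norm (x i) \<le> 1)}"

lemma max_flat_bound:
  assumes "N \<in> F n" "x \<in> tuples n" "\<forall>i<n. norm (x i) \<le> 1"
  shows "N x \<le> real n"
proof -
  have "N x \<le> (\<Sum>i<n. norm (x i))" by (rule le_sum_norms[OF assms(1,2)])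
  also have "\<dots> \<le> (\<Sum>i<n. 1)" by (rule sum_mono) (use assms(3) in auto)
  finally show ?thesis by simp
qed

lemma max_flat_bdd: "bdd_above {N x | N x. N \<in> F n \<and> x \<in> tuples n \<and> (\<forall>i<n. norm (x i) \<le> 1)}"
  using max_flat_bound by (intro bdd_aboveI[of _ "real n"]) blast

lemma le_max_flat:
  assumes "N \<in> F n" "x \<in> tuples n" "\<forall>i<n. norm (x i) \<le> 1"
  shows "N x \<le> max_flat n"
  unfolding max_flat_def by (rule cSup_upper[OF _ max_flat_bdd]) (use assms in blast)

lemma max_flat_nonempty: "{N x | N x. N \<in> F n \<and> x \<in> tuples n \<and> (\<forall>i<n. norm (x i) \<le> 1)} \<noteq> {}"
proof -
  obtain N where "N \<in> F n" using nonempty by blast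
  moreover have "(\<lambda>_. 0) \<in> tuples n" "\<forall>i<n. norm ((\<lambda>_. 0::'k) i) \<le> 1" by (auto simp: tuples_def)
  ultimately show ?thesis by blast
qed

lemma max_flat_least:
  assumes "\<And>N x. N \<in> F n \<Longrightarrow> x \<in> tuples n \<Longrightarrow> \<forall>i<n. norm (x i) \<le> 1 \<Longrightarrow> N x \<le> K"
  shows "max_flat n \<le> K"
  unfolding max_flat_def by (rule cSup_least[OF max_flat_nonempty]) (use assms in blast)

lemma max_flat_le: "max_flat n \<le> real n"
  by (rule max_flat_least) (rule max_flat_bound)

lemma max_flat_ge: "1 \<le> n \<Longrightarrow> 1 \<le> max_flat n"
proof -
  assume n: "1 \<le> n"
  obtain N where N: "N \<in> F n" using nonempty by blast
  have "N (\<lambda>i. if i = 0 then 1 else 0) \<le> max_flat n"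
    by (rule le_max_flat[OF N]) (use n in \<open>auto simp: tuples_def\<close>)
  then show ?thesis using unit[OF N, of 0] n by simp
qed

lemma max_flat_nonneg: "0 \<le> max_flat n"
proof -
  obtain N where N: "N \<in> F n" using nonempty by blast
  show ?thesis using le_max_flat[OF N, of "\<lambda>_. 0"] zero[OF N] by (simp add: tuples_def)
qed

lemma scaled_max_flat:
  assumes N: "N \<in> F n" and x: "x \<in> tuples n" and le: "\<forall>i<n. norm (x i) \<le> v" and v: "0 \<le> v"
  shows "N x \<le> v * max_flat n"
proof (cases "v = 0")
  case True
  then have "x i = 0" for i using le x by (cases "i < n") (auto simp: tuples_def)
  then have "x = (\<lambda>_. 0)" by blast
  then show ?thesis using zero[OF N] True by simp
next
  case False
  define y where "y = (\<lambda>i. of_real (1 / v) * x i)"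
  have y: "y \<in> tuples n" using x by (simp add: y_def tuples_def)
  have "N y \<le> max_flat n"
    by (rule le_max_flat[OF N y]) (use le False v in \<open>auto simp: y_def norm_mult norm_divide field_simps\<close>)
  moreover have "N y = (1 / v) * N x"
    unfolding y_def using scale[OF N x, of "of_real (1 / v)"] v by (simp add: norm_divide)
  ultimately show ?thesis using False v by (simp add: field_simps)
qed

lemma window_norm:
  assumes N: "N \<in> F n" and x: "x \<in> tuples n" and "s + m \<le> n"
  shows "\<exists>M\<in>F m. M (\<lambda>i. if i < m then x (s + i) else 0) = N (restr {s..<s + m} x)"
proof -
  obtain M where M: "M \<in> F m" "\<And>b. b \<in> tuples m \<Longrightarrow> M b = N (\<lambda>i. if s \<le> i then b (i - s) else 0)"
    using window[OF N assms(3)] by blast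
  have "M (\<lambda>i. if i < m then x (s + i) else 0)
      = N (\<lambda>i. if s \<le> i then (if i - s < m then x (s + (i - s)) else 0) else 0)"
    by (rule M(2)) (simp add: tuples_def)
  also have "(\<lambda>i. if s \<le> i then (if i - s < m then x (s + (i - s)) else 0) else 0) = restr {s..<s + m} x"
  proof
    fix i
    show "(if s \<le> i then (if i - s < m then x (s + (i - s)) else 0) else 0) = restr {s..<s + m} x i"
      by (cases "s \<le> i") (auto simp: restr_def)
  qed
  finally show ?thesis using M(1) by blast
qed

lemma window_max_flat:
  assumes N: "N \<in> F n" and x: "x \<in> tuples n" "\<forall>i<n. norm (x i) \<le> 1" and "s + m \<le> n"
  shows "N (restr {s..<s + m} x) \<le> max_flat m"
proof -
  obtain M where M: "M \<in> F m" "M (\<lambda>i. if i < m then x (s + i) else 0) = N (restr {s..<s + m} x)"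
    using window_norm[OF N x(1) assms(4)] by blast
  have "M (\<lambda>i. if i < m then x (s + i) else 0) \<le> max_flat m"
    by (rule le_max_flat[OF M(1)]) (use x(2) assms(4) in \<open>auto simp: tuples_def\<close>)
  then show ?thesis using M(2) by simp
qed

lemma max_flat_add: "max_flat (n + m) \<le> max_flat n + max_flat m"
proof (rule max_flat_least)
  fix N and x :: "nat \<Rightarrow> 'k"
  assume N: "N \<in> F (n + m)" and x: "x \<in> tuples (n + m)" and le: "\<forall>i<n + m. norm (x i) \<le> 1"
  have "(\<lambda>i. restr {0..<0 + n} x i + restr {n..<n + m} x i) = x"
    using x by (auto simp: restr_def tuples_def fun_eq_iff)
  then have "N x \<le> N (restr {0..<0 + n} x) + N (restr {n..<n + m} x)"
    using triangle[OF N restr_tuples[OF x] restr_tuples[OF x], of "{0..<0 + n}" "{n..<n + m}"] by simp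
  moreover have "N (restr {0..<0 + n} x) \<le> max_flat n"
    by (rule window_max_flat[OF N x le]) simp
  moreover have "N (restr {n..<n + m} x) \<le> max_flat m"
    by (rule window_max_flat[OF N x le]) simp
  ultimately show "N x \<le> max_flat n + max_flat m" by linarith
qed

lemma max_flat_mult:
  assumes m: "1 \<le> m"
  shows "max_flat (n * m) \<le> max_flat n * max_flat m"
proof (rule max_flat_least)
  fix N and x :: "nat \<Rightarrow> 'k"
  assume N: "N \<in> F (n * m)" and x: "x \<in> tuples (n * m)"
    and le: "\<forall>i<n * m. norm (x i) \<le> 1"
  define t where "t = (\<lambda>j. j * m)"
  have strict: "\<forall>j<n. t j < t (Suc j)" using m by (simp add: t_def)
  obtain M where M: "M \<in> F n"
    "M (\<lambda>j. if j < n then of_real (N (restr {t j..<t (Suc j)} x)) else 0) = N (restr {t 0..<t n} x)"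
    using block_norms[OF N x strict] by (auto simp: t_def)
  have piece: "N (restr {t j..<t (Suc j)} x) \<le> max_flat m" if "j < n" for j
  proof -
    have "Suc j * m \<le> n * m" using that by (intro mult_le_mono1) simp
    then have "N (restr {j * m..<j * m + m} x) \<le> max_flat m"
      by (intro window_max_flat[OF N x le]) simp
    then show ?thesis by (simp add: t_def add.commute)
  qed
  have "restr {t 0..<t n} x = x" using x by (auto simp: t_def restr_def tuples_def fun_eq_iff)
  then have "N x = M (\<lambda>j. if j < n then of_real (N (restr {t j..<t (Suc j)} x)) else 0)" using M(2) by simp
  also have "\<dots> \<le> max_flat m * max_flat n"
    by (rule scaled_max_flat[OF M(1)])
      (use piece max_flat_nonneg nonneg[OF N restr_tuples[OF x]] in \<open>auto simp: tuples_def\<close>)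
  finally show "N x \<le> max_flat n * max_flat m" by (simp add: mult.commute)
qed

text \<open>
  Coordinates that vanish may be skipped, because the remaining basis vectors span a space of the class.
\<close>
lemma support_max_flat:
  assumes N: "N \<in> F n" and a: "a \<in> tuples n" and v: "0 \<le> v" "\<And>i. norm (a i) \<le> v"
    and k: "card {i. a i \<noteq> 0} = k" "0 < k"
  shows "N a \<le> v * max_flat k"
proof -
  have sub: "{i. a i \<noteq> 0} \<subseteq> {..<n}" by (rule tuples_support[OF a])
  obtain t where t: "\<forall>j<k. t j < t (Suc j)" "t k = n" "t ` {..<k} = {i. a i \<noteq> 0}"
    "\<And>j. j < k \<Longrightarrow> {t j..<t (Suc j)} \<inter> {i. a i \<noteq> 0} = {t j}"
    using enumerate_positions[OF sub k] by blast
  have lt: "t j < n" if "j < k" for j using blocks_strict[OF t(1) that order.refl] t(2) by simp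
  obtain M where M: "M \<in> F k"
    "M (\<lambda>j. if j < k then of_real (N (restr {t j..<t (Suc j)} a)) else 0) = N (restr {t 0..<t k} a)"
    using block_norms[OF N a t(1)] t(2) by auto
  have "restr {t j..<t (Suc j)} a = (\<lambda>i. if i = t j then a (t j) else 0)" if j: "j < k" for j
  proof
    fix i
    have "i \<in> {t j..<t (Suc j)} \<and> a i \<noteq> 0 \<longleftrightarrow> i = t j" using t(4)[OF j] by blast
    then show "restr {t j..<t (Suc j)} a i = (if i = t j then a (t j) else 0)"
      by (cases "i = t j"; cases "i \<in> {t j..<t (Suc j)}") (simp_all only: restr_in restr_out if_True if_False simp_thms)
  qed
  then have piece: "N (restr {t j..<t (Suc j)} a) = norm (a (t j))" if "j < k" for j
    using single[OF N lt[OF that]] that by simp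
  have "a i = 0" if "i \<notin> {t 0..<t k}" for i
  proof (rule ccontr)
    assume "a i \<noteq> 0"
    then obtain j where j: "j < k" "i = t j" using t(3) by blast
    have "t 0 \<le> t j" using blocks_strict[OF t(1), of 0 j] j by (cases "j = 0") auto
    then show False using that j lt t(2) by auto
  qed
  then have "restr {t 0..<t k} a i = a i" for i
    by (simp add: restr_def)
  then have "restr {t 0..<t k} a = a" by blast
  then have "N a = M (\<lambda>j. if j < k then of_real (N (restr {t j..<t (Suc j)} a)) else 0)"
    using M(2) by simp
  also have "\<dots> \<le> v * max_flat k"
    by (rule scaled_max_flat[OF M(1)]) (use piece v in \<open>auto simp: tuples_def\<close>)
  finally show ?thesis .
qed

end

context envelope_class
begin

text \<open>
  By induction on \<open>K\<close>: if \<open>v powr s = 2 powr (- K)\<close>, then at most \<open>2 ^ K\<close> coordinates exceed \<open>v\<close>, and the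
  others contribute at most \<open>v * max_flat (2 ^ Suc K)\<close>, a term of a geometric series since \<open>b < 1 / s\<close>.
\<close>
lemma upper_estimate_normalized:
  fixes b s :: real
  assumes b: "0 < b" "b < 1 / s" and s: "0 < s" and C: "0 < C" "\<And>n. 1 \<le> n \<Longrightarrow> max_flat n \<le> C * real n powr b"
    and N: "N \<in> F n" and a: "a \<in> tuples n" and one: "(\<Sum>i<n. norm (a i) powr s) \<le> 1"
    and K: "card {i. a i \<noteq> 0} \<le> 2 ^ K"
  shows "N a \<le> C * 2 powr b * (1 + (\<Sum>k<K. (2 powr (b - 1 / s)) ^ k))"
  using a one K
proof (induction K arbitrary: a)
  have flat: "N a \<le> v * (C * real K powr b)"
    if a: "a \<in> tuples n" and v: "0 \<le> v" "\<And>i. norm (a i) \<le> v" and K: "card {i. a i \<noteq> 0} \<le> K" "1 \<le> K"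
    for a v K
  proof (cases "card {i. a i \<noteq> 0} = 0")
    case True
    have "finite {i. a i \<noteq> 0}" by (rule finite_subset[OF tuples_support[OF a]]) simp
    then have "a = (\<lambda>_. 0)" using True by auto
    then show ?thesis using zero[OF N] C v by simp
  next
    case False
    then have "N a \<le> v * max_flat (card {i. a i \<noteq> 0})"
      using support_max_flat[OF N a v] by simp
    also have "\<dots> \<le> v * (C * real (card {i. a i \<noteq> 0}) powr b)"
      using C(2)[of "card {i. a i \<noteq> 0}"] False v(1) by (intro mult_left_mono) auto
    also have "\<dots> \<le> v * (C * real K powr b)"
      using K C(1) b v(1) by (intro mult_left_mono powr_mono2) auto
    finally show ?thesis .
  qed
  {
    case 0
    have "norm (a i) \<le> 1" for i
    proof (cases "i < n")
      case True
      have "norm (a i) powr s \<le> (\<Sum>i<n. norm (a i) powr s)"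
        by (rule member_le_sum) (use True in auto)
      then have "norm (a i) powr s \<le> 1 powr s" using 0 by simp
      moreover have "1 powr s < norm (a i) powr s" if "1 < norm (a i)"
        by (rule powr_less_mono2) (use s that in auto)
      ultimately have "\<not> 1 < norm (a i)" by auto
      then show ?thesis by simp
    next
      case False
      then show ?thesis using 0 by (simp add: tuples_def)
    qed
    then have "N a \<le> 1 * (C * real 1 powr b)" using flat[of a 1 1] 0 by simp
    also have "\<dots> \<le> C * 2 powr b" using C(1) b by (simp add: ge_one_powr_ge_zero)
    finally show ?case by simp
  next
    case (Suc K)
    define v where "v = 2 powr (- (real K / s))"
    define T where "T = {i. v < norm (a i)}"
    have "v powr s = 2 powr (- real K)" using s by (simp add: v_def powr_powr)
    then have v: "0 < v" "v powr s = 1 / 2 ^ K"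
      by (simp_all add: v_def powr_minus_divide powr_realpow)
    have "a i \<noteq> 0" if "i \<in> T" for i using that v(1) by (auto simp: T_def)
    then have T: "T \<subseteq> {..<n}" using tuples_supportD[OF Suc.prems(1)] by blast
    have "real (card T) * (v powr s) = (\<Sum>i\<in>T. v powr s)" by simp
    also have "\<dots> \<le> (\<Sum>i\<in>T. norm (a i) powr s)"
      using v s by (intro sum_mono powr_mono2) (auto simp: T_def)
    also have "\<dots> \<le> (\<Sum>i<n. norm (a i) powr s)" by (rule sum_mono2) (use T in auto)
    also have "\<dots> \<le> 1" by (rule Suc.prems(2))
    finally have "real (card T) \<le> 2 ^ K" by (simp add: v(2) field_simps)
    then have cT: "card T \<le> 2 ^ K" using of_nat_le_iff[of "card T" "2 ^ K", where 'a = real] by simp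
    have finT: "finite T" using T finite_subset by blast
    have "card {i. restr T a i \<noteq> 0} \<le> card T"
      by (rule card_mono[OF finT]) (auto simp: restr_def)
    then have "card {i. restr T a i \<noteq> 0} \<le> 2 ^ K" using cT by linarith
    moreover have "(\<Sum>i<n. norm (restr T a i) powr s) \<le> (\<Sum>i<n. norm (a i) powr s)"
      by (rule sum_mono) (simp add: restr_def)
    ultimately have 1: "N (restr T a) \<le> C * 2 powr b * (1 + (\<Sum>k<K. (2 powr (b - 1 / s)) ^ k))"
      using Suc.IH[OF restr_tuples[OF Suc.prems(1)], of T] Suc.prems(2) by linarith
    have fina: "finite {i. a i \<noteq> 0}"
      by (rule finite_subset[OF tuples_support[OF Suc.prems(1)]]) simp
    have "card {i. restr (-T) a i \<noteq> 0} \<le> card {i. a i \<noteq> 0}"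
      by (rule card_mono[OF fina]) (auto simp: restr_def)
    then have "card {i. restr (-T) a i \<noteq> 0} \<le> 2 ^ Suc K" using Suc.prems(3) by linarith
    then have "N (restr (-T) a) \<le> v * (C * real (2 ^ Suc K) powr b)"
      by (intro flat restr_tuples Suc.prems) (use v(1) in \<open>auto simp: restr_def T_def\<close>)
    also have "\<dots> = C * 2 powr b * (2 powr (b - 1 / s)) ^ K"
    proof -
      have "real (2 ^ Suc K) = 2 powr (real K + 1)" by (simp add: powr_add powr_realpow)
      then have "real (2 ^ Suc K) powr b = 2 powr (b * (real K + 1))"
        by (simp only: powr_powr mult.commute)
      moreover have "(2 powr (b - 1 / s)) ^ K = 2 powr ((b - 1 / s) * real K)"
        by (simp add: powr_powr flip: powr_realpow)
      ultimately show ?thesis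
        by (simp add: v_def algebra_simps powr_add powr_diff powr_minus_divide)
    qed
    finally have 2: "N (restr (-T) a) \<le> C * 2 powr b * (2 powr (b - 1 / s)) ^ K" .
    have "N a \<le> N (restr T a) + N (restr (-T) a)"
      by (rule add_le[OF N restr_tuples restr_tuples]) (use Suc.prems(1) in \<open>auto simp: restr_def\<close>)
    then show ?case using 1 2 by (simp add: algebra_simps)
  }
qed

lemma upper_estimate:
  fixes b s :: real
  assumes b: "0 < b" "b < 1 / s" and s: "0 < s" and C: "0 < C" "\<And>n. 1 \<le> n \<Longrightarrow> max_flat n \<le> C * real n powr b"
  shows "\<exists>C'>0. \<forall>n. \<forall>N\<in>F n. \<forall>a\<in>tuples n. N a \<le> C' * (\<Sum>i<n. norm (a i) powr s) powr (1 / s)"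
proof -
  define \<rho> where "\<rho> = (2::real) powr (b - 1 / s)"
  have "2 powr (b - 1 / s) < 2 powr (0::real)" by (rule powr_less_mono) (use b in auto)
  then have \<rho>: "0 < \<rho>" "\<rho> < 1" by (auto simp: \<rho>_def)
  define C' where "C' = C * 2 powr b * (1 + 1 / (1 - \<rho>))"
  have C': "0 < C'" unfolding C'_def using C(1) \<rho> by (intro mult_pos_pos add_pos_pos) auto
  have "N a \<le> C' * (\<Sum>i<n. norm (a i) powr s) powr (1 / s)" if N: "N \<in> F n" and a: "a \<in> tuples n" for n N a
  proof (cases "a = (\<lambda>_. 0)")
    case True
    then show ?thesis using zero[OF N] s C' by simp
  next
    case False
    then obtain i where i: "a i \<noteq> 0" by blast
    then have "i < n" by (rule tuples_supportD[OF a])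
    define S where "S = (\<Sum>i<n. norm (a i) powr s)"
    have "norm (a i) powr s \<le> S"
      unfolding S_def by (rule member_le_sum) (use \<open>i < n\<close> in auto)
    moreover have "0 < norm (a i) powr s" using i by simp
    ultimately have S: "0 < S" by linarith
    define l where "l = S powr (1 / s)"
    have l: "0 < l" "l powr s = S" using S s by (simp_all add: l_def powr_powr)
    define a' where "a' = (\<lambda>i. of_real (1 / l) * a i)"
    have a': "a' \<in> tuples n" using a by (simp add: a'_def tuples_def)
    have na: "norm (a' i) = norm (a i) / l" for i using l(1) by (simp add: a'_def norm_mult norm_divide)
    have "(\<Sum>i<n. norm (a' i) powr s) = S / l powr s"
      unfolding na S_def using l(1) by (simp add: powr_divide sum_divide_distrib)
    then have one: "(\<Sum>i<n. norm (a' i) powr s) \<le> 1" using l(2) S by simp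
    have "card {i. a' i \<noteq> 0} \<le> card {..<n}"
      by (rule card_mono[OF _ tuples_support[OF a']]) simp
    also have "\<dots> \<le> 2 ^ n" using less_exp[of n] by simp
    finally have cd: "card {i. a' i \<noteq> 0} \<le> 2 ^ n" .
    have "N a' \<le> C * 2 powr b * (1 + (\<Sum>k<n. \<rho> ^ k))"
      unfolding \<rho>_def by (rule upper_estimate_normalized[OF b s C N a' one cd])
    also have "\<dots> \<le> C'"
    proof -
      have "(\<Sum>k<n. \<rho> ^ k) = (1 - \<rho> ^ n) / (1 - \<rho>)"
        using \<rho> sum_gp_strict[of \<rho> n] by simp
      also have "\<dots> \<le> 1 / (1 - \<rho>)" using \<rho> by (intro divide_right_mono) auto
      finally show ?thesis unfolding C'_def using C(1) by (intro mult_left_mono add_left_mono) auto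
    qed
    finally have "N a' \<le> C'" .
    moreover have "N a' = 1 / l * N a"
      by (rule scale_real[OF N a]) (use l(1) in \<open>simp_all add: a'_def\<close>)
    ultimately show ?thesis using l(1) by (simp add: field_simps l_def S_def)
  qed
  then show ?thesis using C' by blast
qed

text \<open>
  A number of modulus at most \<open>1\<close> is a convex combination of two opposite unimodular ones.  Hence the
  coordinates of \<open>y\<close> can be replaced one after the other by unimodular multiples of those of \<open>a\<close>
  without decreasing the norm.
\<close>
lemma unimodular_domination:
  assumes N: "N \<in> F n" and a: "a \<in> tuples n" and y: "y \<in> tuples n" "\<And>i. norm (y i) \<le> norm (a i)"
  shows "\<exists>M\<in>F n. N y \<le> M a"
proof -
  have "\<exists>\<theta>. (\<forall>i. norm (\<theta> i) = 1) \<and> N y \<le> N (\<lambda>i. if i < k then \<theta> i * a i else y i)" for k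
  proof (induction k)
    case 0
    show ?case by (rule exI[of _ "\<lambda>_. 1"]) simp
  next
    case (Suc k)
    then obtain \<theta> where \<theta>: "\<And>i. norm (\<theta> i) = 1" "N y \<le> N (\<lambda>i. if i < k then \<theta> i * a i else y i)"
      by blast
    define r where "r = norm (y k) / norm (a k)"
    define e where "e = (if y k = 0 then 1 else (y k / a k) / of_real r)"
    have r: "0 \<le> r" "r \<le> 1" using y(2)[of k] by (auto simp: r_def divide_le_eq_1)
    have ak: "a k \<noteq> 0" if "y k \<noteq> 0" using y(2)[of k] that by auto
    have e: "norm e = 1" using ak by (auto simp: e_def r_def norm_divide norm_mult)
    have yk: "y k = of_real r * (e * a k)" using ak by (auto simp: e_def r_def)
    define z where "z = (\<lambda>c i. if i < k then \<theta> i * a i else if i = k then c * (e * a k) else y i)"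
    have z: "z c \<in> tuples n" for c using a y(1) by (auto simp: z_def tuples_def)
    have "N (\<lambda>i. if i < k then \<theta> i * a i else y i)
        \<le> N (\<lambda>i. of_real ((1 + r) / 2) * z 1 i) + N (\<lambda>i. of_real ((1 - r) / 2) * z (-1) i)"
    proof (rule add_le[OF N])
      fix i
      have r1: "(1 + r) / 2 + (1 - r) / 2 = 1" by (simp add: field_simps)
      have r2: "(1 + r) / 2 - (1 - r) / 2 = r" by (simp add: field_simps)
      have 1: "of_real ((1 + r) / 2) + of_real ((1 - r) / 2) = (1 :: 'k)"
        unfolding of_real_add[symmetric] r1 by (rule of_real_1)
      have 2: "of_real ((1 + r) / 2) - of_real ((1 - r) / 2) = (of_real r :: 'k)"
        unfolding of_real_diff[symmetric] r2 ..
      show "(if i < k then \<theta> i * a i else y i)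
          = of_real ((1 + r) / 2) * z 1 i + of_real ((1 - r) / 2) * z (-1) i"
      proof (cases "i = k")
        case True
        then have "z 1 i = e * a k" "z (-1) i = - (e * a k)" by (simp_all add: z_def)
        moreover have "y k = of_real ((1 + r) / 2) * (e * a k) + of_real ((1 - r) / 2) * - (e * a k)"
          unfolding yk 2[symmetric] left_diff_distrib by simp
        ultimately show ?thesis using True by simp
      next
        case False
        then have "z 1 i = z (-1) i" "(if i < k then \<theta> i * a i else y i) = z 1 i" by (auto simp: z_def)
        then show ?thesis unfolding \<open>z 1 i = z (-1) i\<close>[symmetric] distrib_right[symmetric] 1 by simp
      qed
    qed (use z in \<open>auto simp: tuples_def\<close>)
    also have "N (\<lambda>i. of_real ((1 + r) / 2) * z 1 i) = (1 + r) / 2 * N (z 1)"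
      by (rule scale_real[OF N z]) (use r in auto)
    also have "N (\<lambda>i. of_real ((1 - r) / 2) * z (-1) i) = (1 - r) / 2 * N (z (-1))"
      by (rule scale_real[OF N z]) (use r in auto)
    also have "(1 + r) / 2 * N (z 1) + (1 - r) / 2 * N (z (-1))
      \<le> (1 + r) / 2 * max (N (z 1)) (N (z (-1))) + (1 - r) / 2 * max (N (z 1)) (N (z (-1)))"
      using r by (intro add_mono mult_left_mono) auto
    also have "\<dots> = max (N (z 1)) (N (z (-1)))" by (simp add: algebra_simps add_divide_distrib diff_divide_distrib)
    finally have "N y \<le> N (z 1) \<or> N y \<le> N (z (-1))" using \<theta>(2) by linarith
    then obtain c where c: "c = 1 \<or> c = -1" "N y \<le> N (z c)" by blast
    have "z c = (\<lambda>i. if i < Suc k then (\<theta>(k := c * e)) i * a i else y i)"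
      by (auto simp: z_def fun_eq_iff less_Suc_eq mult.assoc)
    then have "N y \<le> N (\<lambda>i. if i < Suc k then (\<theta>(k := c * e)) i * a i else y i)" using c(2) by simp
    moreover have "\<forall>i. norm ((\<theta>(k := c * e)) i) = 1" using \<theta>(1) e c(1) by (auto simp: norm_mult)
    ultimately show ?case by blast
  qed
  then obtain \<theta> where \<theta>: "\<forall>i. norm (\<theta> i) = 1" "N y \<le> N (\<lambda>i. if i < n then \<theta> i * a i else y i)" by blast
  obtain M where M: "M \<in> F n" "\<And>b. b \<in> tuples n \<Longrightarrow> M b = N (\<lambda>i. \<theta> i * b i)"
    using twist[OF N, of \<theta>] \<theta>(1) by blast
  have "(\<lambda>i. if i < n then \<theta> i * a i else y i) = (\<lambda>i. \<theta> i * a i)"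
    using a y(1) by (auto simp: tuples_def fun_eq_iff)
  then have "N y \<le> M a" using \<theta>(2) M(2)[OF a] by simp
  then show ?thesis using M(1) by blast
qed

text \<open>
  At a scale \<open>L\<close> where \<open>max_flat n * n powr (\<eta> - \<beta>)\<close> attains a record, an interval of length about
  \<open>\<gamma> j * L\<close> has norm at most \<open>4 * max_flat L * \<gamma> j powr \<beta>\<close>.  The record function is unbounded because
  \<open>max_flat n \<ge> n powr \<beta>\<close>, so such scales are arbitrarily large.
\<close>
lemma max_flat_large_pieces:
  assumes \<beta>: "0 \<le> \<beta>" "\<beta> \<le> 1" "\<And>n. 1 \<le> n \<Longrightarrow> real n powr \<beta> \<le> max_flat n"
    and m: "1 \<le> m" and \<gamma>: "\<And>j. j < m \<Longrightarrow> 0 < \<gamma> j" "(\<Sum>j<m. \<gamma> j) = 1"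
  shows "\<exists>M\<in>F m. \<exists>v. (\<forall>j. 0 \<le> v j) \<and> (\<forall>j<m. v j \<le> \<gamma> j powr \<beta>) \<and>
    1 / 8 \<le> M (\<lambda>j. if j < m then of_real (v j) else 0)"
proof -
  obtain \<eta> L0 where \<eta>: "0 < \<eta>" "1 \<le> L0" and parts: "\<And>L. L0 \<le> L \<Longrightarrow> \<exists>t. t 0 = 0 \<and> t m = L \<and>
      (\<forall>j<m. t j < t (Suc j)) \<and> (\<forall>j<m. let q = real (t (Suc j) - t j) / real L in
        \<gamma> j / 2 \<le> q \<and> q \<le> 2 * \<gamma> j \<and> 1 / 2 \<le> q powr \<eta>)"
    using proportional_scales[OF m \<gamma>] by blast
  define \<Psi> where "\<Psi> = (\<lambda>n. max_flat n * real n powr (\<eta> - \<beta>))"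
  have unb: "\<exists>n. K < \<Psi> n" for K
  proof -
    obtain n where n: "1 \<le> n" "K < real n powr \<eta>"
    proof -
      define x where "x = max 1 (\<bar>K\<bar> + 1) powr (1 / \<eta>)"
      obtain n where n: "x < real n" using reals_Archimedean2 by blast
      have x1: "1 \<le> x" unfolding x_def using \<eta>(1) by (intro ge_one_powr_ge_zero) auto
      have "max 1 (\<bar>K\<bar> + 1) = x powr \<eta>" using \<eta>(1) by (simp add: x_def powr_powr)
      also have "\<dots> \<le> real n powr \<eta>" using n x1 \<eta>(1) by (intro powr_mono2) auto
      finally show thesis using n x1 by (intro that[of n]) auto
    qed
    have "real n powr \<eta> = real n powr \<beta> * real n powr (\<eta> - \<beta>)" using n(1) by (simp flip: powr_add)
    also have "\<dots> \<le> \<Psi> n" unfolding \<Psi>_def using \<beta>(3)[OF n(1)] by (intro mult_right_mono) auto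
    finally show ?thesis using n(2) by (intro exI[of _ n]) simp
  qed
  obtain L where L: "L0 \<le> L" "\<And>n. n \<le> L \<Longrightarrow> \<Psi> n \<le> \<Psi> L"
    using record_high[OF unb] by blast
  have L1: "1 \<le> L" using L(1) \<eta>(2) by simp
  obtain t where t: "t 0 = 0" "t m = L" "\<forall>j<m. t j < t (Suc j)"
    and ratio: "\<forall>j<m. let q = real (t (Suc j) - t j) / real L in \<gamma> j / 2 \<le> q \<and> q \<le> 2 * \<gamma> j \<and> 1 / 2 \<le> q powr \<eta>"
    using parts[OF L(1)] by blast
  have tL: "t (Suc j) \<le> L" if "j < m" for j
    using blocks_strict[OF t(3), of "Suc j" m] t(2) that by (cases "Suc j = m") auto
  have piece: "max_flat (t (Suc j) - t j) \<le> 4 * max_flat L * \<gamma> j powr \<beta>" if j: "j < m" for j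
  proof -
    define l where "l = t (Suc j) - t j"
    have lt: "t j < t (Suc j)" using t(3) j by blast
    have l: "1 \<le> l" "l \<le> L" using lt tL[OF j] by (auto simp: l_def)
    define q where "q = real l / real L"
    have q0: "0 < q" using l by (simp add: q_def)
    have q: "q \<le> 2 * \<gamma> j" "1 / 2 \<le> q powr \<eta>"
      using ratio j unfolding q_def l_def Let_def by simp_all
    have "max_flat l * real l powr (\<eta> - \<beta>) \<le> max_flat L * real L powr (\<eta> - \<beta>)"
      using L(2)[OF l(2)] by (simp add: \<Psi>_def)
    then have "max_flat l \<le> max_flat L * (real L powr (\<eta> - \<beta>) / real l powr (\<eta> - \<beta>))"
      using l by (simp add: field_simps)
    also have "real L powr (\<eta> - \<beta>) / real l powr (\<eta> - \<beta>) = q powr \<beta> * q powr (- \<eta>)"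
      using l L1 by (simp add: q_def powr_divide powr_diff powr_minus field_simps)
    also have "max_flat L * (q powr \<beta> * q powr (- \<eta>)) \<le> max_flat L * (2 * \<gamma> j powr \<beta> * 2)"
    proof (intro mult_left_mono mult_mono)
      have "q powr \<beta> \<le> (2 * \<gamma> j) powr \<beta>" using q0 q(1) \<beta>(1) by (intro powr_mono2) auto
      also have "\<dots> = 2 powr \<beta> * \<gamma> j powr \<beta>" using \<gamma>(1)[OF j] by (simp add: powr_mult)
      also have "\<dots> \<le> 2 * \<gamma> j powr \<beta>"
        using powr_mono[of \<beta> 1 "2::real"] \<beta>(2) by (intro mult_right_mono) auto
      finally show "q powr \<beta> \<le> 2 * \<gamma> j powr \<beta>" .
      show "q powr (- \<eta>) \<le> 2"
        using le_imp_inverse_le[OF q(2)] by (simp add: powr_minus)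
    qed (use max_flat_nonneg in auto)
    finally show ?thesis by (simp add: l_def mult_ac)
  qed
  have fL: "1 \<le> max_flat L" using max_flat_ge L1 by simp
  then have "max_flat L / 2 < max_flat L" by simp
  then have "\<not> max_flat L \<le> max_flat L / 2" by simp
  then have "\<exists>N x. N \<in> F L \<and> x \<in> tuples L \<and> (\<forall>i<L. norm (x i) \<le> 1) \<and> \<not> N x \<le> max_flat L / 2"
    using max_flat_least[of L "max_flat L / 2"] by blast
  then obtain N x where Nx: "N \<in> F L" "x \<in> tuples L" "\<forall>i<L. norm (x i) \<le> 1" "max_flat L / 2 < N x"
    by (auto simp: not_le)
  obtain M where M: "M \<in> F m"
    "M (\<lambda>j. if j < m then of_real (N (restr {t j..<t (Suc j)} x)) else 0) = N (restr {t 0..<t m} x)"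
    using block_norms[OF Nx(1,2) t(3)] t(2) by auto
  have "restr {t 0..<t m} x = x" using Nx(2) by (auto simp: t restr_def tuples_def fun_eq_iff)
  then have Mx: "max_flat L / 2 < M (\<lambda>j. if j < m then of_real (N (restr {t j..<t (Suc j)} x)) else 0)"
    using M(2) Nx(4) by simp
  define v where "v = (\<lambda>j. N (restr {t j..<t (Suc j)} x) / (4 * max_flat L))"
  have v0: "0 \<le> v j" for j using nonneg[OF Nx(1) restr_tuples[OF Nx(2)]] fL by (simp add: v_def)
  have v1: "v j \<le> \<gamma> j powr \<beta>" if j: "j < m" for j
  proof -
    have "t j \<le> t (Suc j)" using t(3) j by (simp add: less_imp_le)
    then have "N (restr {t j..<t (Suc j)} x) \<le> max_flat (t (Suc j) - t j)"
      using window_max_flat[OF Nx(1-3), of "t j" "t (Suc j) - t j"] tL[OF j] by simp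
    then have "N (restr {t j..<t (Suc j)} x) \<le> 4 * max_flat L * \<gamma> j powr \<beta>" using piece[OF j] by linarith
    then show ?thesis using fL by (simp add: v_def field_simps)
  qed
  have tup: "(\<lambda>j. if j < m then of_real (N (restr {t j..<t (Suc j)} x)) else 0) \<in> tuples m"
    by (simp add: tuples_def)
  have "M (\<lambda>j. if j < m then of_real (v j) else 0)
      = 1 / (4 * max_flat L) * M (\<lambda>j. if j < m then of_real (N (restr {t j..<t (Suc j)} x)) else 0)"
    by (rule scale_real[OF M(1) tup]) (use fL in \<open>auto simp: v_def simp flip: of_real_mult\<close>)
  also have "\<dots> \<ge> 1 / (4 * max_flat L) * (max_flat L / 2)"
    using Mx fL by (intro mult_left_mono) auto
  finally have "1 / 8 \<le> M (\<lambda>j. if j < m then of_real (v j) else 0)" using fL by simp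
  then show ?thesis using M(1) v0 v1 by blast
qed

lemma le_add_sum:
  assumes N: "N \<in> F n" and a: "a \<in> tuples n" and b: "b \<in> tuples n" and d: "\<And>i. i < n \<Longrightarrow> norm (a i - b i) \<le> d i"
  shows "N a \<le> N b + (\<Sum>i<n. d i)"
proof -
  have t: "(\<lambda>i. a i - b i) \<in> tuples n" using a b by (simp add: tuples_def)
  have "N a \<le> N b + N (\<lambda>i. a i - b i)" by (rule add_le[OF N b t]) simp
  also have "N (\<lambda>i. a i - b i) \<le> (\<Sum>i<n. norm (a i - b i))" by (rule le_sum_norms[OF N t])
  also have "\<dots> \<le> (\<Sum>i<n. d i)" by (rule sum_mono) (use d in auto)
  finally show ?thesis by simp
qed

text \<open>
  The proportions are \<open>\<bar>a i\<bar> powr (1 / \<beta>)\<close>, enlarged by \<open>\<delta>\<close> since the intervals must not be empty.  The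
  choice of \<open>\<delta>\<close> makes the total change of the coefficients at most \<open>1 / 16\<close>.
\<close>
lemma upper_envelope_lower_estimate:
  assumes \<beta>: "0 < \<beta>" "\<beta> \<le> 1" "\<And>n. 1 \<le> n \<Longrightarrow> real n powr \<beta> \<le> max_flat n"
    and m: "1 \<le> m" and a: "a \<in> tuples m"
  shows "\<exists>M\<in>F m. 1 / 16 * (\<Sum>i<m. norm (a i) powr (1 / \<beta>)) powr \<beta> \<le> M a"
proof (cases "(\<Sum>i<m. norm (a i) powr (1 / \<beta>)) = 0")
  case True
  obtain M where "M \<in> F m" using nonempty by blast
  then show ?thesis using True nonneg[OF _ a] by auto
next
  case False
  define S where "S = (\<Sum>i<m. norm (a i) powr (1 / \<beta>))"
  have S: "0 < S" using False sum_nonneg[of "{..<m}" "\<lambda>i. norm (a i) powr (1 / \<beta>)"] by (simp add: S_def)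
  define l where "l = S powr \<beta>"
  have l: "0 < l" "l powr (1 / \<beta>) = S" using S \<beta>(1) by (simp_all add: l_def powr_powr)
  define b where "b = (\<lambda>i. norm (a i) / l)"
  have b0: "0 \<le> b i" for i using l by (simp add: b_def)
  have b1: "(\<Sum>i<m. b i powr (1 / \<beta>)) = 1"
  proof -
    have "(\<Sum>i<m. b i powr (1 / \<beta>)) = S / l powr (1 / \<beta>)"
      unfolding b_def S_def using l(1) by (simp add: powr_divide sum_divide_distrib)
    then show ?thesis using l(2) S by simp
  qed
  define \<delta> where "\<delta> = (1 / (16 * real m)) powr (1 / \<beta>)"
  have \<delta>: "0 < \<delta>" "\<delta> powr \<beta> = 1 / (16 * real m)" using m \<beta>(1) by (simp_all add: \<delta>_def powr_powr)
  define \<gamma> where "\<gamma> = (\<lambda>i. (b i powr (1 / \<beta>) + \<delta>) / (1 + real m * \<delta>))"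
  have den: "1 \<le> 1 + real m * \<delta>" using \<delta>(1) m by simp
  have \<gamma>0: "0 < \<gamma> i" for i
    unfolding \<gamma>_def
  proof (rule divide_pos_pos)
    show "0 < b i powr (1 / \<beta>) + \<delta>" using \<delta>(1) by (intro add_nonneg_pos) auto
    show "0 < 1 + real m * \<delta>" using den by linarith
  qed
  have \<gamma>1: "(\<Sum>i<m. \<gamma> i) = 1"
    using den unfolding \<gamma>_def sum_divide_distrib[symmetric] sum.distrib b1 by simp
  have \<gamma>b: "\<gamma> i powr \<beta> \<le> b i + 1 / (16 * real m)" for i
  proof -
    have "\<gamma> i \<le> (b i powr (1 / \<beta>) + \<delta>) / 1"
      unfolding \<gamma>_def
    proof (rule divide_left_mono[OF den])
      show "0 \<le> b i powr (1 / \<beta>) + \<delta>" using \<delta>(1) by (intro add_nonneg_nonneg) auto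
      show "0 < (1 + real m * \<delta>) * 1" unfolding mult_1_right using den by linarith
    qed
    then have "\<gamma> i powr \<beta> \<le> (b i powr (1 / \<beta>) + \<delta>) powr \<beta>"
      using \<gamma>0[of i] \<beta>(1) by (intro powr_mono2) auto
    also have "\<dots> \<le> (b i powr (1 / \<beta>)) powr \<beta> + \<delta> powr \<beta>"
      using \<beta> \<delta>(1) by (intro powr_add_le) auto
    finally show ?thesis using \<beta>(1) b0[of i] \<delta>(2) by (simp add: powr_powr)
  qed
  obtain M v where M: "M \<in> F m" and v: "\<And>j. 0 \<le> v j" "\<And>j. j < m \<Longrightarrow> v j \<le> \<gamma> j powr \<beta>"
    and Mv: "1 / 8 \<le> M (\<lambda>j. if j < m then of_real (v j) else 0)"
    using max_flat_large_pieces[OF less_imp_le[OF \<beta>(1)] \<beta>(2,3) m \<gamma>0 \<gamma>1] by blast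
  define y :: "nat \<Rightarrow> 'k" where "y = (\<lambda>j. if j < m then of_real (min (v j) (b j)) else 0)"
  have y: "y \<in> tuples m" by (simp add: y_def tuples_def)
  have "M (\<lambda>j. if j < m then of_real (v j) else 0) \<le> M y + (\<Sum>j<m. 1 / (16 * real m))"
  proof (rule le_add_sum[OF M _ y])
    fix j assume j: "j < m"
    have "v j \<le> b j + 1 / (16 * real m)" using v(2)[OF j] \<gamma>b[of j] by linarith
    then show "norm ((if j < m then of_real (v j) else 0) - y j) \<le> 1 / (16 * real m)"
      using j by (simp add: y_def min_def flip: of_real_diff)
  qed (simp add: tuples_def)
  then have My: "1 / 16 \<le> M y" using Mv m by simp
  define a' where "a' = (\<lambda>i. of_real (1 / l) * a i)"
  have a': "a' \<in> tuples m" using a by (simp add: a'_def tuples_def)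
  have "norm (y i) \<le> norm (a' i)" for i
    using v(1)[of i] b0[of i] l(1) by (simp add: y_def a'_def b_def norm_mult norm_divide)
  then obtain M' where M': "M' \<in> F m" "M y \<le> M' a'" using unimodular_domination[OF M a' y] by blast
  have "M' a' = 1 / l * M' a" by (rule scale_real[OF M'(1) a]) (use l in \<open>simp_all add: a'_def\<close>)
  then have "M' a' = M' a / l" by simp
  then have "1 / 16 \<le> M' a / l" using My M'(2) by linarith
  then have "1 / 16 * l \<le> M' a" using l(1) by (simp add: field_simps)
  then show ?thesis using M'(1) unfolding l_def S_def by blast
qed

end

section \<open>The lower envelope: estimate from below\<close>

lemma supermultiplicative_exponent:
  fixes h :: "nat \<Rightarrow> real"
  assumes half: "\<And>n. 1 \<le> n \<Longrightarrow> 1 / 2 \<le> h n" and le: "\<And>n. 1 \<le> n \<Longrightarrow> h n \<le> real n"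
    and mult: "\<And>n m. 1 \<le> n \<Longrightarrow> 1 \<le> m \<Longrightarrow> h n * h m \<le> h (n * m)"
    and mono: "\<And>n m. 1 \<le> n \<Longrightarrow> n \<le> m \<Longrightarrow> h n \<le> 2 * h m"
  obtains \<alpha> where "0 \<le> \<alpha>" "\<alpha> \<le> 1" "\<And>n. 1 \<le> n \<Longrightarrow> h n \<le> real n powr \<alpha>"
    "\<And>s. 0 < s \<Longrightarrow> s < \<alpha> \<Longrightarrow> \<exists>c>0. \<forall>n\<ge>1. c * real n powr s \<le> h n"
proof -
  define A where "A = (\<lambda>n. ln (h n) / ln (real n)) ` {2..}"
  define \<alpha> where "\<alpha> = Sup A"
  have pos: "0 < h n" if "1 \<le> n" for n using half[OF that] by linarith
  have A1: "x \<le> 1" if "x \<in> A" for x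
  proof -
    obtain n where n: "2 \<le> n" "x = ln (h n) / ln (real n)" using \<open>x \<in> A\<close> by (auto simp: A_def)
    then have "ln (h n) \<le> ln (real n)" using le[of n] pos[of n] by simp
    then show ?thesis using n by (simp add: divide_le_eq_1)
  qed
  have bdd: "bdd_above A" using A1 by (meson bdd_aboveI)
  have ne: "A \<noteq> {}" by (auto simp: A_def)
  have \<alpha>1: "\<alpha> \<le> 1" unfolding \<alpha>_def using ne A1 by (meson cSup_least)
  have upper: "ln (h n) \<le> \<alpha> * ln (real n)" if n2: "2 \<le> n" for n
  proof -
    have "ln (h n) / ln (real n) \<le> \<alpha>" unfolding \<alpha>_def
      by (rule cSup_upper[OF _ bdd]) (use n2 in \<open>auto simp: A_def\<close>)
    then show ?thesis using n2 by (simp add: field_simps)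
  qed
  have \<alpha>0: "0 \<le> \<alpha>"
  proof (rule ccontr)
    assume "\<not> 0 \<le> \<alpha>"
    then have neg: "0 < - \<alpha>" by simp
    obtain k where k: "ln 2 / (- \<alpha> * ln 2) < real k" using reals_Archimedean2 by blast
    have "1 < real k * - \<alpha>" using k neg by (simp add: field_simps)
    have k0: "k \<noteq> 0"
    proof
      assume "k = 0"
      then show False using \<open>1 < real k * - \<alpha>\<close> by simp
    qed
    have "ln (1 / 2) \<le> ln (h (2 ^ k))" using half[of "2 ^ k"] by simp
    also have "\<dots> \<le> \<alpha> * ln (real (2 ^ k))"
    proof (rule upper)
      have "(2::nat) ^ 1 \<le> 2 ^ k" using k0 by (intro power_increasing) auto
      then show "(2::nat) \<le> 2 ^ k" by simp
    qed
    also have "\<dots> = \<alpha> * real k * ln 2" by (simp add: ln_realpow)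
    finally have "ln 2 * (real k * - \<alpha>) \<le> ln 2 * 1" by (simp add: ln_div algebra_simps)
    then have "real k * - \<alpha> \<le> 1" by (subst (asm) mult_le_cancel_left_pos) auto
    then show False using \<open>1 < real k * - \<alpha>\<close> by linarith
  qed
  have bound: "h n \<le> real n powr \<alpha>" if n: "1 \<le> n" for n
  proof (cases "n = 1")
    case True
    then show ?thesis using le[of 1] by simp
  next
    case False
    then have "exp (ln (h n)) \<le> exp (\<alpha> * ln (real n))" using upper[of n] n by simp
    moreover have "exp (ln (h n)) = h n" using pos[OF n] by simp
    ultimately show ?thesis using n by (simp add: powr_def)
  qed
  have lower: "\<exists>c>0. \<forall>n\<ge>1. c * real n powr s \<le> h n" if s: "0 < s" "s < \<alpha>" for s
  proof -
    obtain x where x: "x \<in> A" "s < x" using less_cSupE[of s A] s(2) ne unfolding \<alpha>_def by blast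
    then obtain k where k: "2 \<le> k" "s < ln (h k) / ln (real k)" by (auto simp: A_def)
    then have "s * ln (real k) < ln (h k)" by (simp add: field_simps)
    then have "exp (s * ln (real k)) < exp (ln (h k))" by simp
    moreover have "exp (ln (h k)) = h k" using pos[of k] k(1) by simp
    ultimately have hk: "real k powr s < h k" using k(1) by (simp add: powr_def)
    define c where "c = 1 / (4 * real k powr s)"
    have c: "0 < c" using k(1) by (simp add: c_def)
    have ks: "0 < real k powr s" using k(1) by simp
    have pw: "real (k ^ j) powr s / 2 \<le> h (k ^ j)" for j
    proof -
      have "(real k powr s) ^ j / 2 \<le> h (k ^ j)"
      proof (induction j)
        case 0
        then show ?case using half[of 1] by simp
      next
        case (Suc j)
        have "real k powr s * ((real k powr s) ^ j / 2) \<le> h k * h (k ^ j)"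
          by (rule mult_mono) (use hk Suc pos[of k] k(1) in auto)
        also have "\<dots> \<le> h (k * k ^ j)" by (rule mult) (use k(1) in auto)
        finally show ?case by simp
      qed
      moreover have "(real k powr s) ^ j = real (k ^ j) powr s"
        by (induction j) (simp_all add: powr_mult)
      ultimately show ?thesis by simp
    qed
    have "c * real n powr s \<le> h n" if n: "1 \<le> n" for n
    proof -
      obtain j where j: "k ^ j \<le> n" "n < k ^ Suc j"
      proof -
        define P where "P = (\<lambda>j. n < k ^ Suc j)"
        have "n < 2 ^ n" by simp
        also have "2 ^ n \<le> k ^ n" using k(1) by (rule power_mono) simp
        also have "\<dots> \<le> k ^ Suc n" using k(1) by (intro power_increasing) auto
        finally have "P n" by (simp add: P_def)
        define j where "j = (LEAST j. P j)"
        have "P j" unfolding j_def using \<open>P n\<close> by (rule LeastI)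
        moreover have "k ^ j \<le> n"
        proof (cases j)
          case 0
          then show ?thesis using n by simp
        next
          case (Suc i)
          then have "\<not> P i" using not_less_Least[of i P] unfolding j_def by simp
          then show ?thesis using Suc by (simp add: P_def)
        qed
        ultimately show thesis using that unfolding P_def by blast
      qed
      have "real n powr s \<le> real (k ^ Suc j) powr s" using j(2) s(1) by (intro powr_mono2) (auto simp del: power_Suc of_nat_power)
      also have "\<dots> = real k powr s * real (k ^ j) powr s" by (simp add: powr_mult)
      finally have "c * real n powr s \<le> c * (real k powr s * real (k ^ j) powr s)"
        using c by (intro mult_left_mono) auto
      also have "\<dots> = (real (k ^ j) powr s / 2) / 2" using ks unfolding c_def by (simp add: field_simps)
      also have "\<dots> \<le> h (k ^ j) / 2" using pw[of j] by simp
      also have "\<dots> \<le> h n"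
      proof -
        have "1 \<le> k ^ j" using k(1) by simp
        then have "h (k ^ j) \<le> 2 * h n" using j(1) by (rule mono)
        then show ?thesis by simp
      qed
      finally show ?thesis .
    qed
    then show ?thesis using c by blast
  qed
  show thesis using that[OF \<alpha>0 \<alpha>1 bound lower] by blast
qed

text \<open>
  A weak \<open>\<ell>\<^sub>u\<close> bound controls the \<open>\<ell>\<^sub>s\<close> norm for \<open>s > u\<close>: removing a minimal element of \<open>S\<close> repeatedly
  shows that the \<open>j\<close>-th largest value of \<open>f\<close> is at most \<open>A * j powr (- 1 / u)\<close>.
\<close>
lemma weak_type_sum:
  fixes f :: "'i \<Rightarrow> real" and u s A :: real
  assumes "finite S" and pos: "\<And>i. i \<in> S \<Longrightarrow> 0 < f i" and u: "0 < u" and A: "0 \<le> A" and s: "0 < s"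
    and weak: "\<And>v. 0 < v \<Longrightarrow> real (card {i \<in> S. v \<le> f i}) * v powr u \<le> A powr u"
  shows "(\<Sum>i\<in>S. f i powr s) \<le> A powr s * (\<Sum>j=1..card S. real j powr (- (s / u)))"
  using assms(1) pos weak
proof (induction "card S" arbitrary: S)
  case 0
  then show ?case by simp
next
  case (Suc k)
  have ne: "S \<noteq> {}" using Suc.hyps(2) by auto
  define i0 where "i0 = arg_min_on f S"
  have i0: "i0 \<in> S" "\<And>i. i \<in> S \<Longrightarrow> f i0 \<le> f i"
    unfolding i0_def using arg_min_if_finite[OF Suc.prems(1) ne, of f] arg_min_least[OF Suc.prems(1) ne, of _ f]
    by auto
  have "{i \<in> S. f i0 \<le> f i} = S" using i0 by blast
  then have "real (Suc k) * f i0 powr u \<le> A powr u"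
    using Suc.prems(3)[of "f i0"] Suc.prems(2)[OF i0(1)] Suc.hyps(2) by simp
  then have "(real (Suc k) * f i0 powr u) powr (s / u) \<le> (A powr u) powr (s / u)"
    using u s by (intro powr_mono2) auto
  then have "real (Suc k) powr (s / u) * f i0 powr s \<le> A powr s"
    using u Suc.prems(2)[OF i0(1)] by (simp add: powr_mult powr_powr)
  then have le: "f i0 powr s \<le> A powr s * real (Suc k) powr (- (s / u))"
    by (simp add: powr_minus field_simps)
  have card: "card (S - {i0}) = k" using Suc.hyps(2) i0(1) Suc.prems(1) by simp
  have "(\<Sum>i\<in>S - {i0}. f i powr s) \<le> A powr s * (\<Sum>j=1..card (S - {i0}). real j powr (- (s / u)))"
  proof (rule Suc.hyps(1))
    fix v :: real assume v: "0 < v"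
    have "card {i \<in> S - {i0}. v \<le> f i} \<le> card {i \<in> S. v \<le> f i}"
      by (rule card_mono) (use Suc.prems(1) in auto)
    then have "real (card {i \<in> S - {i0}. v \<le> f i}) * v powr u \<le> real (card {i \<in> S. v \<le> f i}) * v powr u"
      by (intro mult_right_mono) auto
    then show "real (card {i \<in> S - {i0}. v \<le> f i}) * v powr u \<le> A powr u"
      using Suc.prems(3)[OF v] by linarith
  qed (use Suc.prems card in auto)
  moreover have "(\<Sum>i\<in>S. f i powr s) = f i0 powr s + (\<Sum>i\<in>S - {i0}. f i powr s)"
    by (rule sum.remove[OF Suc.prems(1) i0(1)])
  moreover have "(\<Sum>j=1..card S. real j powr (- (s / u)))
      = (\<Sum>j=1..k. real j powr (- (s / u))) + real (Suc k) powr (- (s / u))"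
    unfolding Suc.hyps(2)[symmetric] by simp
  ultimately show ?case using le card by (simp add: distrib_left)
qed

lemma sum_powr_bounded:
  assumes "1 < (t::real)"
  obtains Z where "0 < Z" "\<And>n. (\<Sum>j=1..n. real j powr (- t)) \<le> Z"
proof -
  have sm: "summable (\<lambda>j. real j powr (- t))" using assms by (simp add: summable_real_powr_iff)
  have "(\<Sum>j=1..n. real j powr (- t)) \<le> (\<Sum>j. real j powr (- t)) + 1" for n
    using sum_le_suminf[OF sm, of "{1..n}"] by simp
  moreover have "0 \<le> (\<Sum>j. real j powr (- t))" by (rule suminf_nonneg[OF sm]) simp
  ultimately show thesis using that[of "(\<Sum>j. real j powr (- t)) + 1"] by simp
qed

context envelope_class
begin

definition min_spread :: "nat \<Rightarrow> real" where
  "min_spread n = Inf {N x | N x. N \<in> F n \<and> x \<in> tuples n \<and> (\<forall>i<n. 1 \<le> norm (x i))}"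

lemma min_spread_bdd: "bdd_below {N x | N x. N \<in> F n \<and> x \<in> tuples n \<and> (\<forall>i<n. 1 \<le> norm (x i))}"
  using nonneg by (intro bdd_belowI[of _ 0]) blast

lemma min_spread_le:
  assumes "N \<in> F n" "x \<in> tuples n" "\<forall>i<n. 1 \<le> norm (x i)"
  shows "min_spread n \<le> N x"
  unfolding min_spread_def by (rule cInf_lower[OF _ min_spread_bdd]) (use assms in blast)

lemma min_spread_nonempty: "{N x | N x. N \<in> F n \<and> x \<in> tuples n \<and> (\<forall>i<n. 1 \<le> norm (x i))} \<noteq> {}"
proof -
  obtain N where "N \<in> F n" using nonempty by blast
  moreover have "(\<lambda>i. if i < n then 1 else 0) \<in> tuples n"
    "\<forall>i<n. 1 \<le> norm ((\<lambda>i. if i < n then 1 else 0 :: 'k) i)" by (auto simp: tuples_def)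
  ultimately show ?thesis by blast
qed

lemma min_spread_greatest:
  assumes "\<And>N x. N \<in> F n \<Longrightarrow> x \<in> tuples n \<Longrightarrow> \<forall>i<n. 1 \<le> norm (x i) \<Longrightarrow> K \<le> N x"
  shows "K \<le> min_spread n"
  unfolding min_spread_def by (rule cInf_greatest[OF min_spread_nonempty]) (use assms in blast)

lemma min_spread_half: "1 \<le> n \<Longrightarrow> 1 / 2 \<le> min_spread n"
proof (rule min_spread_greatest)
  fix N and x :: "nat \<Rightarrow> 'k"
  assume n: "1 \<le> n" and N: "N \<in> F n" and x: "x \<in> tuples n" and ge: "\<forall>i<n. 1 \<le> norm (x i)"
  have "1 \<le> norm (x 0)" using ge n by simp
  then show "1 / 2 \<le> N x" using first_coordinate[OF N x, of 0] by simp
qed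

lemma min_spread_le_nat: "min_spread n \<le> real n"
proof -
  obtain N where N: "N \<in> F n" using nonempty by blast
  define x :: "nat \<Rightarrow> 'k" where "x = (\<lambda>i. if i < n then 1 else 0)"
  have x: "x \<in> tuples n" by (simp add: x_def tuples_def)
  have "min_spread n \<le> N x" by (rule min_spread_le[OF N x]) (simp add: x_def)
  also have "\<dots> \<le> real n" by (rule max_flat_bound[OF N x]) (simp add: x_def)
  finally show ?thesis .
qed

lemma window_min_spread:
  assumes N: "N \<in> F n" and x: "x \<in> tuples n" "\<forall>i<n. 1 \<le> norm (x i)" and "s + m \<le> n"
  shows "min_spread m \<le> N (restr {s..<s + m} x)"
proof -
  obtain M where M: "M \<in> F m" "M (\<lambda>i. if i < m then x (s + i) else 0) = N (restr {s..<s + m} x)"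
    using window_norm[OF N x(1) assms(4)] by blast
  have "min_spread m \<le> M (\<lambda>i. if i < m then x (s + i) else 0)"
    by (rule min_spread_le[OF M(1)]) (use x(2) assms(4) in \<open>auto simp: tuples_def\<close>)
  then show ?thesis using M(2) by simp
qed

lemma min_spread_mono: "n \<le> m \<Longrightarrow> min_spread n \<le> 2 * min_spread m"
proof -
  assume nm: "n \<le> m"
  have "min_spread n / 2 \<le> min_spread m"
  proof (rule min_spread_greatest)
    fix N and x :: "nat \<Rightarrow> 'k"
    assume N: "N \<in> F m" and x: "x \<in> tuples m" and ge: "\<forall>i<m. 1 \<le> norm (x i)"
    have "min_spread n \<le> N (restr {0..<0 + n} x)" by (rule window_min_spread[OF N x ge]) (use nm in simp)
    also have "{0..<0 + n} = {..<n}" by auto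
    also have "N (restr {..<n} x) \<le> 2 * N x" by (rule initial[OF N x])
    finally show "min_spread n / 2 \<le> N x" by simp
  qed
  then show ?thesis by simp
qed

text \<open>
  Larger block norms are harmless here, since \<open>min_spread\<close> is an infimum over coefficients of modulus at
  least \<open>1\<close>, not equal to \<open>1\<close>.
\<close>
lemma blocks_min_spread:
  assumes N: "N \<in> F n" and x: "x \<in> tuples n" and t: "\<forall>j<k. t j < t (Suc j)" "t k \<le> n"
    and w: "0 < w" "\<And>j. j < k \<Longrightarrow> w \<le> N (restr {t j..<t (Suc j)} x)"
  shows "w * min_spread k \<le> N (restr {t 0..<t k} x)"
proof -
  obtain M where M: "M \<in> F k"
    "M (\<lambda>j. if j < k then of_real (N (restr {t j..<t (Suc j)} x)) else 0) = N (restr {t 0..<t k} x)"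
    using block_norms[OF N x t] by blast
  define y :: "nat \<Rightarrow> 'k" where "y = (\<lambda>j. if j < k then of_real (N (restr {t j..<t (Suc j)} x) / w) else 0)"
  have y: "y \<in> tuples k" by (simp add: y_def tuples_def)
  have "min_spread k \<le> M y"
  proof (rule min_spread_le[OF M(1) y], intro allI impI)
    fix j assume j: "j < k"
    have "norm (y j) = N (restr {t j..<t (Suc j)} x) / w"
      using nonneg[OF N restr_tuples[OF x]] w(1) j unfolding y_def by (simp del: of_real_divide)
    moreover have "1 \<le> N (restr {t j..<t (Suc j)} x) / w" using w(1) w(2)[OF j] by simp
    ultimately show "1 \<le> norm (y j)" by simp
  qed
  moreover have "M (\<lambda>j. if j < k then of_real (N (restr {t j..<t (Suc j)} x)) else 0) = w * M y"
    by (rule scale_real[OF M(1) y]) (use w(1) in \<open>auto simp: y_def\<close>)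
  ultimately show ?thesis using M(2) w(1) by simp
qed

lemma min_spread_mult:
  assumes m: "1 \<le> m"
  shows "min_spread n * min_spread m \<le> min_spread (n * m)"
proof (rule min_spread_greatest)
  fix N and x :: "nat \<Rightarrow> 'k"
  assume N: "N \<in> F (n * m)" and x: "x \<in> tuples (n * m)" and ge: "\<forall>i<n * m. 1 \<le> norm (x i)"
  define t where "t = (\<lambda>j. j * m)"
  have strict: "\<forall>j<n. t j < t (Suc j)" using m by (simp add: t_def)
  have "min_spread m * min_spread n \<le> N (restr {t 0..<t n} x)"
  proof (rule blocks_min_spread[OF N x strict])
    show "0 < min_spread m" using min_spread_half[OF m] by linarith
    fix j assume "j < n"
    then have "Suc j * m \<le> n * m" by (intro mult_le_mono1) simp
    then have "min_spread m \<le> N (restr {j * m..<j * m + m} x)"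
      by (intro window_min_spread[OF N x ge]) simp
    then show "min_spread m \<le> N (restr {t j..<t (Suc j)} x)" by (simp add: t_def add.commute)
  qed (simp add: t_def)
  also have "restr {t 0..<t n} x = x" using x by (auto simp: t_def restr_def tuples_def fun_eq_iff)
  finally show "min_spread n * min_spread m \<le> N x" by (simp add: mult.commute)
qed

text \<open>
  Let each of the \<open>k\<close> coordinates of modulus at least \<open>v\<close> start a block.  The blocks have norm at least
  \<open>v / 2\<close>, so that \<open>v * k powr b\<close> is bounded by a multiple of \<open>N a\<close>: a weak-type estimate.
\<close>
lemma lower_estimate:
  fixes b s c :: real
  assumes b: "0 < b" "1 / s < b" and s: "0 < s" and c: "0 < c" "\<And>n. 1 \<le> n \<Longrightarrow> c * real n powr b \<le> min_spread n"
  shows "\<exists>c'>0. \<forall>n. \<forall>N\<in>F n. \<forall>a\<in>tuples n. c' * (\<Sum>i<n. norm (a i) powr s) powr (1 / s) \<le> N a"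
proof -
  have "1 < s * b" using b s by (simp add: field_simps)
  then obtain Z where Z: "0 < Z" "\<And>n. (\<Sum>j=1..n. real j powr (- (s * b))) \<le> Z"
    using sum_powr_bounded by blast
  define K where "K = 6 / c"
  have K: "0 < K" using c(1) by (simp add: K_def)
  have count: "v * real k powr b \<le> K * N a"
    if N: "N \<in> F n" and a: "a \<in> tuples n" and v: "0 < v" and k: "card {i. v \<le> norm (a i)} = k" "0 < k"
    for n N a v k
  proof -
    have "a i \<noteq> 0" if "v \<le> norm (a i)" for i using that v by auto
    then have sub: "{i. v \<le> norm (a i)} \<subseteq> {..<n}" using tuples_supportD[OF a] by blast
    obtain t where t: "\<forall>j<k. t j < t (Suc j)" "t k = n" "t ` {..<k} = {i. v \<le> norm (a i)}"
      using enumerate_positions[OF sub k] by blast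
    have "v / 2 * min_spread k \<le> N (restr {t 0..<t k} a)"
    proof (rule blocks_min_spread[OF N a t(1)])
      fix j assume j: "j < k"
      have tj: "t j < t (Suc j)" using t(1) j by blast
      have "v \<le> norm (a (t j))" using t(3) j by blast
      also have "a (t j) = restr {t j..<t (Suc j)} a (t j)" using tj by (simp add: restr_def)
      also have "norm \<dots> \<le> 2 * N (restr {t j..<t (Suc j)} a)"
        by (rule first_coordinate[OF N restr_tuples[OF a]]) (simp add: restr_def)
      finally show "v / 2 \<le> N (restr {t j..<t (Suc j)} a)" by simp
    qed (use v t(2) in auto)
    also have "restr {t 0..<t k} a = restr {t 0..} a"
      using a t(2) by (auto simp: restr_def tuples_def fun_eq_iff)
    also have "N (restr {t 0..} a) \<le> 3 * N a" by (rule final[OF N a])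
    finally have 1: "v / 2 * min_spread k \<le> 3 * N a" .
    have "v / 2 * (c * real k powr b) \<le> v / 2 * min_spread k" using c(2)[of k] k(2) v by (intro mult_left_mono) auto
    then have "v / 2 * (c * real k powr b) \<le> 3 * N a" using 1 by linarith
    then show ?thesis using c(1) by (simp add: K_def field_simps)
  qed
  define c' where "c' = 1 / (K * Z powr (1 / s))"
  have c': "0 < c'" using K Z(1) by (simp add: c'_def)
  have "c' * (\<Sum>i<n. norm (a i) powr s) powr (1 / s) \<le> N a" if N: "N \<in> F n" and a: "a \<in> tuples n" for n N a
  proof -
    define S where "S = {i. a i \<noteq> 0}"
    have S: "S \<subseteq> {..<n}" unfolding S_def by (rule tuples_support[OF a])
    then have finS: "finite S" using finite_subset by blast
    define A where "A = K * N a"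
    have A: "0 \<le> A" using K nonneg[OF N a] by (simp add: A_def)
    have weak: "real (card {i \<in> S. v \<le> norm (a i)}) * v powr (1 / b) \<le> A powr (1 / b)" if v: "0 < v" for v
    proof -
      have eq: "{i \<in> S. v \<le> norm (a i)} = {i. v \<le> norm (a i)}" using v by (auto simp: S_def)
      show ?thesis
      proof (cases "card {i. v \<le> norm (a i)} = 0")
        case False
        define k where "k = card {i. v \<le> norm (a i)}"
        have "v * real k powr b \<le> A" unfolding A_def using False by (intro count[OF N a v]) (auto simp: k_def)
        then have "(v * real k powr b) powr (1 / b) \<le> A powr (1 / b)" using v b(1) by (intro powr_mono2) auto
        moreover have "(v * real k powr b) powr (1 / b) = v powr (1 / b) * real k"
          using v b(1) by (simp add: powr_mult powr_powr)
        ultimately show ?thesis unfolding eq k_def[symmetric] by (simp add: mult.commute)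
      qed (simp add: eq)
    qed
    have "(\<Sum>i\<in>S. norm (a i) powr s) \<le> A powr s * (\<Sum>j=1..card S. real j powr (- (s / (1 / b))))"
      by (rule weak_type_sum[OF finS _ _ A s weak]) (use b(1) in \<open>auto simp: S_def\<close>)
    also have "\<dots> \<le> A powr s * Z" using Z(2)[of "card S"] by (intro mult_left_mono) auto
    also have "(\<Sum>i\<in>S. norm (a i) powr s) = (\<Sum>i<n. norm (a i) powr s)"
      by (rule sum.mono_neutral_left) (use S in \<open>auto simp: S_def\<close>)
    finally have "(\<Sum>i<n. norm (a i) powr s) powr (1 / s) \<le> (A powr s * Z) powr (1 / s)"
      using s by (intro powr_mono2 sum_nonneg) auto
    also have "\<dots> = A * Z powr (1 / s)" using A Z(1) s by (simp add: powr_mult powr_powr)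
    finally have "c' * (\<Sum>i<n. norm (a i) powr s) powr (1 / s) \<le> c' * (A * Z powr (1 / s))"
      using c' by (intro mult_left_mono) auto
    also have "\<dots> = N a" using K Z(1) by (simp add: c'_def A_def)
    finally show ?thesis .
  qed
  then show ?thesis using c' by blast
qed

end

section \<open>The lower envelope: estimate from above\<close>

lemma record_low:
  fixes \<Psi> :: "nat \<Rightarrow> real"
  assumes "L0 \<le> n" and bottom: "\<And>l. 1 \<le> l \<Longrightarrow> l \<le> L0 \<Longrightarrow> \<Psi> n \<le> \<Psi> l"
  obtains L where "L0 \<le> L" "L \<le> n" "\<And>l. 1 \<le> l \<Longrightarrow> l \<le> L \<Longrightarrow> \<Psi> L \<le> \<Psi> l"
proof -
  define P where "P = (\<lambda>L. L0 \<le> L \<and> (\<forall>l. 1 \<le> l \<and> l \<le> L0 \<longrightarrow> \<Psi> L \<le> \<Psi> l))"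
  define L where "L = (LEAST L. P L)"
  have Pn: "P n" using assms by (simp add: P_def)
  have PL: "P L" unfolding L_def by (rule LeastI[of P, OF Pn])
  have "\<Psi> L \<le> \<Psi> l" if l: "1 \<le> l" "l \<le> L" for l
  proof (cases "l \<le> L0")
    case True
    then show ?thesis using PL l by (simp add: P_def)
  next
    case False
    show ?thesis
    proof (cases "l = L")
      case False
      then have "\<not> P l" using not_less_Least[of l P] l unfolding L_def by simp
      then obtain l' where "1 \<le> l'" "l' \<le> L0" "\<not> \<Psi> l \<le> \<Psi> l'"
        using \<open>\<not> l \<le> L0\<close> by (auto simp: P_def)
      then show ?thesis using PL by (force simp: P_def)
    qed simp
  qed
  moreover have "L \<le> n" unfolding L_def by (rule Least_le[of P, OF Pn])
  moreover have "L0 \<le> L" using PL by (simp add: P_def)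
  ultimately show thesis using that by blast
qed

context envelope_class
begin

text \<open>
  The shortest initial piece of norm at least \<open>w\<close> exceeds \<open>w\<close> by at most its last coordinate.
\<close>
lemma greedy_piece:
  assumes N: "N \<in> F n" and x: "x \<in> tuples n" and w: "0 < w" "w \<le> N (restr {s..<e} x)"
    and small: "\<And>i. s \<le> i \<Longrightarrow> i < e \<Longrightarrow> norm (x i) \<le> \<epsilon>" and en: "e \<le> n"
  shows "\<exists>s'. s < s' \<and> s' \<le> e \<and> w \<le> N (restr {s..<s'} x) \<and> N (restr {s..<s'} x) \<le> w + \<epsilon>"
proof -
  define P where "P = (\<lambda>s'. w \<le> N (restr {s..<s'} x))"
  define s' where "s' = (LEAST s'. P s')"
  have Pe: "P e" using w(2) by (simp add: P_def)
  have Ps: "P s'" unfolding s'_def by (rule LeastI[of P, OF Pe])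
  have le: "s' \<le> e" unfolding s'_def by (rule Least_le[of P, OF Pe])
  have lt: "s < s'"
  proof (rule ccontr)
    assume "\<not> s < s'"
    then have "restr {s..<s'} x = (\<lambda>_. 0)" by (auto simp: restr_def)
    then show False using Ps zero[OF N] w(1) by (simp add: P_def)
  qed
  define r where "r = s' - 1"
  have r: "s' = Suc r" "s \<le> r" "r < e" using lt le by (auto simp: r_def)
  have rn: "r < n" using r(3) en by simp
  have "\<not> P r" using not_less_Least[of r P] r(1) unfolding s'_def by simp
  then have "N (restr {s..<r} x) < w" by (simp add: P_def)
  moreover have "N (restr {s..<s'} x) \<le> N (restr {s..<r} x) + N (\<lambda>i. if i = r then x r else 0)"
  proof (rule add_le[OF N restr_tuples[OF x]])
    show "(\<lambda>i. if i = r then x r else 0) \<in> tuples n" using rn by (simp add: tuples_def)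
    fix i
    show "restr {s..<s'} x i = restr {s..<r} x i + (if i = r then x r else 0)"
      using r by (auto simp: restr_def)
  qed
  moreover have "N (\<lambda>i. if i = r then x r else 0) \<le> \<epsilon>"
    using single[OF N rn, of "x r"] small[OF r(2,3)] by simp
  ultimately show ?thesis using lt le Ps by (intro exI[of _ s']) (simp add: P_def)
qed

text \<open>
  Let \<open>c\<close> be nearly extremal for \<open>min_spread n\<close>, with \<open>n\<close> huge, and let \<open>d\<close> have norm more than \<open>K\<close> in every
  space.  The vector \<open>x\<close> consists of \<open>n\<close> steps; step \<open>s\<close> is \<open>c s\<close> times \<open>d\<close> and has norm at least
  \<open>\<bar>c s\<bar> * K\<close>, while its coordinates have modulus at most \<open>\<bar>c s\<bar>\<close>.  Let \<open>low l\<close> be the least norm of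
  \<open>l\<close> successive steps.  It grows from at least \<open>1\<close> to at most \<open>3 * T * n powr \<alpha>\<close>, so there is a scale \<open>L\<close>
  with \<open>low l \<ge> low L * (l / L) powr (\<alpha> + \<eta>)\<close> for all \<open>l \<le> L\<close>.  In an interval of \<open>L\<close> steps that attains
  \<open>low L\<close>, any part of about \<open>\<gamma> j * L\<close> steps has norm at least a multiple of \<open>b j * low L\<close>.  Hence the greedy
  algorithm finds in it blocks of norms almost equal to \<open>\<Lambda> * b j\<close>, where \<open>\<Lambda>\<close> is a multiple of \<open>low L\<close>.
\<close>
lemma spread_out_minimizer:
  assumes \<alpha>: "0 \<le> \<alpha>" "\<alpha> \<le> 1" "\<And>n. 1 \<le> n \<Longrightarrow> min_spread n \<le> real n powr \<alpha>"
    and big: "\<And>K. \<exists>T\<ge>1. \<exists>d\<in>tuples T. (\<forall>k. norm (d k) \<le> 1) \<and> (\<forall>N\<in>F T. K < N d)"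
    and m: "1 \<le> m" and \<gamma>: "\<And>j. j < m \<Longrightarrow> 0 < \<gamma> j" "(\<Sum>j<m. \<gamma> j) = 1"
    and b: "\<And>j. j < m \<Longrightarrow> 0 < b j" "\<And>j. j < m \<Longrightarrow> b j \<le> \<gamma> j powr \<alpha>"
  shows "\<exists>M\<in>F m. M (\<lambda>j. if j < m then of_real (b j) else 0) \<le> 25"
proof -
  define K where "K = 48 * real m"
  have K: "4 \<le> K" using m by (simp add: K_def)
  obtain T d where T: "1 \<le> T" and d: "d \<in> tuples T" "\<And>k. norm (d k) \<le> 1" "\<And>N. N \<in> F T \<Longrightarrow> K < N d"
    using big[of K] by blast
  obtain \<eta> L0 where \<eta>: "0 < \<eta>" and L0: "1 \<le> L0" and parts: "\<And>L. L0 \<le> L \<Longrightarrow> \<exists>t. t 0 = 0 \<and> t m = L \<and>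
      (\<forall>j<m. t j < t (Suc j)) \<and> (\<forall>j<m. let q = real (t (Suc j) - t j) / real L in
        \<gamma> j / 2 \<le> q \<and> q \<le> 2 * \<gamma> j \<and> 1 / 2 \<le> q powr \<eta>)"
    using proportional_scales[OF m \<gamma>] by blast
  obtain n where n: "L0 \<le> n" "3 * real T * real L0 powr (\<alpha> + \<eta>) \<le> real n powr \<eta>"
  proof -
    define Y where "Y = 3 * real T * real L0 powr (\<alpha> + \<eta>)"
    have Y: "0 \<le> Y" by (simp add: Y_def)
    obtain n where n: "max (real L0) (Y powr (1 / \<eta>)) < real n" using reals_Archimedean2 by blast
    have "Y = (Y powr (1 / \<eta>)) powr \<eta>" using \<eta> Y by (simp add: powr_powr)
    also have "\<dots> \<le> real n powr \<eta>" using n \<eta> by (intro powr_mono2) auto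
    finally show thesis using n by (intro that[of n]) (auto simp: Y_def)
  qed
  have n1: "1 \<le> n" using n(1) L0 by simp
  have n\<alpha>: "1 \<le> real n powr \<alpha>" using n1 \<alpha>(1) by (intro ge_one_powr_ge_zero) auto
  have "\<not> 2 * real n powr \<alpha> \<le> min_spread n" using \<alpha>(3)[OF n1] n\<alpha> by linarith
  then have "\<exists>N x. N \<in> F n \<and> x \<in> tuples n \<and> (\<forall>i<n. 1 \<le> norm (x i)) \<and> \<not> 2 * real n powr \<alpha> \<le> N x"
    using min_spread_greatest[of n "2 * real n powr \<alpha>"] by blast
  then obtain N0 c where N0: "N0 \<in> F n" and c: "c \<in> tuples n" "\<And>i. i < n \<Longrightarrow> 1 \<le> norm (c i)"
    and N0c: "N0 c \<le> 2 * real n powr \<alpha>" by (auto simp: not_le less_imp_le)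
  define x where "x = (\<lambda>i. c (i div T) * d (i mod T))"
  obtain N where N: "N \<in> F (n * T)" and Nx': "N x \<le> (\<Sum>k<T. norm (d k)) * N0 c + 1"
    using parallel[OF N0 c(1) d(1) zero_less_one] unfolding x_def by blast
  have Nx: "N x \<le> 3 * real T * real n powr \<alpha>"
  proof -
    have "(\<Sum>k<T. norm (d k)) \<le> (\<Sum>k<T. 1)" by (rule sum_mono) (use d(2) in auto)
    then have "(\<Sum>k<T. norm (d k)) * N0 c \<le> real T * (2 * real n powr \<alpha>)"
      using N0c nonneg[OF N0 c(1)] by (intro mult_mono) auto
    moreover have "1 * 1 \<le> real T * real n powr \<alpha>" using T n\<alpha> by (intro mult_mono) auto
    ultimately show ?thesis using Nx' by simp
  qed
  have x: "x \<in> tuples (n * T)"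
    unfolding tuples_def
  proof (intro CollectI allI impI)
    fix i assume "n * T \<le> i"
    then have "n \<le> i div T" using T by (simp add: less_eq_div_iff_mult_less_eq)
    then show "x i = 0" using c(1) by (simp add: x_def tuples_def)
  qed
  define step where "step = (\<lambda>s l. restr {s * T..<(s + l) * T} x)"
  have step: "step s l \<in> tuples (n * T)" for s l unfolding step_def by (rule restr_tuples[OF x])
  have one_step: "norm (c s) * K \<le> N (step s 1)" if s: "s < n" for s
  proof -
    have "Suc s * T \<le> n * T" using s by (intro mult_le_mono1) simp
    then obtain M where M: "M \<in> F T"
      "M (\<lambda>i. if i < T then x (s * T + i) else 0) = N (restr {s * T..<s * T + T} x)"
      using window_norm[OF N x, of "s * T" T] by (auto simp: add.commute)
    have "(\<lambda>i. if i < T then x (s * T + i) else 0) = (\<lambda>i. c s * d i)"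
      using d(1) by (auto simp: x_def tuples_def fun_eq_iff)
    then have "M (\<lambda>i. if i < T then x (s * T + i) else 0) = norm (c s) * M d"
      using scale[OF M(1) d(1)] by simp
    moreover have "norm (c s) * K \<le> norm (c s) * M d"
      using d(3)[OF M(1)] by (intro mult_left_mono) auto
    ultimately show ?thesis using M(2) by (simp add: step_def add.commute)
  qed
  have contained: "norm (c s') * K \<le> 4 * N (step s l)" if "s \<le> s'" "s' < s + l" "s + l \<le> n" for s s' l
  proof -
    have "s * T \<le> s' * T" by (rule mult_le_mono1[OF that(1)])
    moreover have "(s' + 1) * T \<le> (s + l) * T" by (rule mult_le_mono1) (use that in simp)
    ultimately have "restr {s' * T..<(s' + 1) * T} (step s l) = step s' 1"
      unfolding step_def by (auto simp: restr_restr intro!: arg_cong[of _ _ "\<lambda>I. restr I x"])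
    then have "N (step s' 1) \<le> 4 * N (step s l)"
      using interval[OF N step, of "s' * T" "(s' + 1) * T" s l] by simp
    then show ?thesis using one_step[of s'] that by simp
  qed
  define low where "low = (\<lambda>l. Min ((\<lambda>s. N (step s l)) ` {..n - l}))"
  have low_le: "low l \<le> N (step s l)" if "s + l \<le> n" for s l
    unfolding low_def using that by (intro Min_le) auto
  have low_attained: "\<exists>s. s + l \<le> n \<and> low l = N (step s l)" if "l \<le> n" for l
  proof -
    have "low l \<in> (\<lambda>s. N (step s l)) ` {..n - l}" unfolding low_def by (intro Min_in) auto
    then obtain s where "s \<le> n - l" "low l = N (step s l)" by auto
    then show ?thesis using that by (intro exI[of _ s]) auto
  qed
  have low_ge: "1 \<le> low l" if l: "1 \<le> l" "l \<le> n" for l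
  proof -
    obtain s where s: "s + l \<le> n" "low l = N (step s l)" using low_attained[OF l(2)] by blast
    have "1 * 4 \<le> norm (c s) * K" using c(2)[of s] K s(1) l(1) by (intro mult_mono) auto
    also have "\<dots> \<le> 4 * N (step s l)" by (rule contained) (use s l in auto)
    finally show ?thesis using s(2) by simp
  qed
  define \<Psi> where "\<Psi> = (\<lambda>l. low l / real l powr (\<alpha> + \<eta>))"
  have start: "\<Psi> n \<le> \<Psi> l" if l: "1 \<le> l" "l \<le> L0" for l
  proof -
    have "step 0 n = x" unfolding step_def using x by (auto simp: restr_def tuples_def fun_eq_iff)
    then have "low n \<le> 3 * real T * real n powr \<alpha>" using low_le[of 0 n] Nx by simp
    then have "\<Psi> n \<le> 3 * real T * real n powr \<alpha> / real n powr (\<alpha> + \<eta>)"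
      unfolding \<Psi>_def by (rule divide_right_mono) simp
    also have "\<dots> = 3 * real T / real n powr \<eta>" using n1 by (simp add: powr_add)
    also have "\<dots> \<le> 1 / real L0 powr (\<alpha> + \<eta>)"
    proof -
      have "0 < real L0 powr (\<alpha> + \<eta>)" "0 < real n powr \<eta>" using n1 L0 by auto
      then show ?thesis using n(2) by (simp add: field_simps)
    qed
    also have "\<dots> \<le> 1 / real l powr (\<alpha> + \<eta>)"
      using l \<alpha>(1) \<eta> by (intro divide_left_mono powr_mono2 mult_pos_pos) auto
    also have "\<dots> \<le> \<Psi> l"
      unfolding \<Psi>_def using low_ge[of l] l n(1) by (intro divide_right_mono) auto
    finally show ?thesis .
  qed
  obtain L where L: "L0 \<le> L" "L \<le> n" "\<And>l. 1 \<le> l \<Longrightarrow> l \<le> L \<Longrightarrow> \<Psi> L \<le> \<Psi> l"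
    using record_low[of L0 n \<Psi>] n(1) start by blast
  have L1: "1 \<le> L" using L(1) L0 by simp
  obtain t where t: "t 0 = 0" "t m = L" "\<forall>j<m. t j < t (Suc j)"
    and ratio: "\<forall>j<m. let q = real (t (Suc j) - t j) / real L in \<gamma> j / 2 \<le> q \<and> q \<le> 2 * \<gamma> j \<and> 1 / 2 \<le> q powr \<eta>"
    using parts[OF L(1)] by blast
  have tL: "t (Suc j) \<le> L" if "j < m" for j
    using blocks_strict[OF t(3), of "Suc j" m] t(2) that by (cases "Suc j = m") auto
  \<comment> \<open>A factor \<open>4\<close> is lost in \<open>low_piece\<close> and a factor \<open>3\<close> to the tail projection in the greedy step.\<close>
  define \<Lambda> where "\<Lambda> = low L / 12"
  have \<Lambda>: "0 < \<Lambda>" using low_ge[OF L1 L(2)] by (simp add: \<Lambda>_def)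
  have low_piece: "3 * (\<Lambda> * b j) \<le> low (t (Suc j) - t j)" if j: "j < m" for j
  proof -
    define l where "l = t (Suc j) - t j"
    have lt: "t j < t (Suc j)" using t(3) j by blast
    have l: "1 \<le> l" "l \<le> L" using lt tL[OF j] by (auto simp: l_def)
    define q where "q = real l / real L"
    have q: "\<gamma> j / 2 \<le> q" "1 / 2 \<le> q powr \<eta>"
      using ratio j unfolding q_def l_def Let_def by simp_all
    have "1 / 2 * \<gamma> j powr \<alpha> \<le> (1 / 2) powr \<alpha> * \<gamma> j powr \<alpha>"
      using powr_mono'[of \<alpha> 1 "1 / 2 :: real"] \<alpha> by (intro mult_right_mono) auto
    also have "\<dots> = (\<gamma> j / 2) powr \<alpha>" using \<gamma>(1)[OF j] by (simp add: powr_mult[symmetric])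
    also have "\<dots> \<le> q powr \<alpha>" using q(1) \<gamma>(1)[OF j] \<alpha>(1) by (intro powr_mono2) auto
    finally have "1 / 2 * \<gamma> j powr \<alpha> * (1 / 2) \<le> q powr \<alpha> * q powr \<eta>"
      using q(2) by (intro mult_mono) auto
    then have "b j / 4 \<le> q powr (\<alpha> + \<eta>)" using b(2)[OF j] by (simp add: powr_add)
    then have "low L * (b j / 4) \<le> low L * q powr (\<alpha> + \<eta>)"
      using low_ge[OF L1 L(2)] by (intro mult_left_mono) auto
    also have "\<dots> = \<Psi> L * real l powr (\<alpha> + \<eta>)"
      by (simp add: \<Psi>_def q_def powr_divide)
    also have "\<dots> \<le> \<Psi> l * real l powr (\<alpha> + \<eta>)" using L(3)[OF l] by (intro mult_right_mono) auto
    also have "\<dots> = low l" using l by (simp add: \<Psi>_def)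
    finally show ?thesis by (simp add: \<Lambda>_def l_def mult.commute)
  qed
  obtain s0 where s0: "s0 + L \<le> n" "low L = N (step s0 L)" using low_attained[OF L(2)] by blast
  have top: "(s0 + L) * T \<le> n * T" using s0(1) by (rule mult_le_mono1)
  have small: "norm (x i) \<le> \<Lambda> / real m" if i: "s0 * T \<le> i" "i < (s0 + L) * T" for i
  proof -
    have "s0 \<le> i div T" using i(1) T by (simp add: less_eq_div_iff_mult_less_eq)
    moreover have "i div T < s0 + L" using i(2) T by (simp add: div_less_iff_less_mult)
    ultimately have "norm (c (i div T)) * K \<le> 4 * N (step s0 L)" using contained s0(1) by blast
    then have "norm (c (i div T)) * K \<le> 48 * \<Lambda>" using s0(2) by (simp add: \<Lambda>_def)
    then have "norm (c (i div T)) \<le> \<Lambda> / real m" using m by (simp add: K_def field_simps)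
    moreover have "norm (x i) \<le> norm (c (i div T)) * 1"
      unfolding x_def norm_mult by (intro mult_left_mono d(2)) simp
    ultimately show ?thesis by simp
  qed
  \<comment> \<open>The greedy cut points \<open>p j\<close> never overtake the proportional ones.\<close>
  have pieces: "\<exists>p. p 0 = s0 * T \<and> (\<forall>j<k. p j < p (Suc j) \<and> p (Suc j) \<le> (s0 + t (Suc j)) * T \<and>
      \<Lambda> * b j \<le> N (restr {p j..<p (Suc j)} x) \<and> N (restr {p j..<p (Suc j)} x) \<le> \<Lambda> * b j + \<Lambda> / real m)"
    if "k \<le> m" for k
    using that
  proof (induction k)
    case 0
    show ?case by (rule exI[of _ "\<lambda>_. s0 * T"]) simp
  next
    case (Suc k)
    then obtain p where p0: "p 0 = s0 * T" and p: "\<forall>j<k. p j < p (Suc j) \<and> p (Suc j) \<le> (s0 + t (Suc j)) * T \<and>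
      \<Lambda> * b j \<le> N (restr {p j..<p (Suc j)} x) \<and> N (restr {p j..<p (Suc j)} x) \<le> \<Lambda> * b j + \<Lambda> / real m"
      by (meson Suc_leD)
    have k: "k < m" using Suc.prems by simp
    have pk: "p k \<le> (s0 + t k) * T" using p p0 t(1) by (cases k) auto
    have pk0: "s0 * T \<le> p k"
    proof -
      have "\<forall>j<k. p j < p (Suc j)" using p by simp
      then show ?thesis using blocks_strict[of k p 0 k] p0 by (cases "k = 0") auto
    qed
    define e where "e = (s0 + t (Suc k)) * T"
    have eL: "e \<le> (s0 + L) * T" unfolding e_def using tL[OF k] by (intro mult_le_mono1) simp
    have tk: "t k < t (Suc k)" using t(3) k by blast
    then have "t k \<le> t (Suc k)" by simp
    then have e': "(s0 + t k + (t (Suc k) - t k)) * T = e" by (simp add: e_def)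
    have "3 * (\<Lambda> * b k) \<le> N (step (s0 + t k) (t (Suc k) - t k))"
      using low_piece[OF k] low_le[of "s0 + t k" "t (Suc k) - t k"] tL[OF k] s0(1) tk by linarith
    also have "step (s0 + t k) (t (Suc k) - t k) = restr {(s0 + t k) * T..} (restr {p k..<e} x)"
      unfolding step_def e' restr_restr using pk by (auto intro!: arg_cong[of _ _ "\<lambda>I. restr I x"])
    also have "N \<dots> \<le> 3 * N (restr {p k..<e} x)" by (rule final[OF N restr_tuples[OF x]])
    finally have w: "\<Lambda> * b k \<le> N (restr {p k..<e} x)" by simp
    obtain s' where s': "p k < s'" "s' \<le> e" "\<Lambda> * b k \<le> N (restr {p k..<s'} x)"
      "N (restr {p k..<s'} x) \<le> \<Lambda> * b k + \<Lambda> / real m"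
    proof -
      have "\<exists>s'. p k < s' \<and> s' \<le> e \<and> \<Lambda> * b k \<le> N (restr {p k..<s'} x) \<and>
        N (restr {p k..<s'} x) \<le> \<Lambda> * b k + \<Lambda> / real m"
      proof (rule greedy_piece[OF N x _ w])
        show "0 < \<Lambda> * b k" using \<Lambda> b(1)[OF k] by simp
        show "e \<le> n * T" using eL top by linarith
        fix i assume "p k \<le> i" "i < e"
        then show "norm (x i) \<le> \<Lambda> / real m" by (intro small) (use pk0 eL in linarith)+
      qed
      then show thesis using that by blast
    qed
    define p' where "p' = p(Suc k := s')"
    have "p' j < p' (Suc j) \<and> p' (Suc j) \<le> (s0 + t (Suc j)) * T \<and>
      \<Lambda> * b j \<le> N (restr {p' j..<p' (Suc j)} x) \<and> N (restr {p' j..<p' (Suc j)} x) \<le> \<Lambda> * b j + \<Lambda> / real m"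
      if j: "j < Suc k" for j
    proof (cases "j = k")
      case True
      then have "p' j = p k" "p' (Suc j) = s'" by (simp_all add: p'_def)
      then show ?thesis using s' True by (simp add: e_def)
    next
      case False
      then have "p' j = p j" "p' (Suc j) = p (Suc j)" "j < k" using j by (simp_all add: p'_def)
      then show ?thesis using p by simp
    qed
    moreover have "p' 0 = s0 * T" using p0 by (simp add: p'_def)
    ultimately have "p' 0 = s0 * T \<and> (\<forall>j<Suc k. p' j < p' (Suc j) \<and> p' (Suc j) \<le> (s0 + t (Suc j)) * T \<and>
      \<Lambda> * b j \<le> N (restr {p' j..<p' (Suc j)} x) \<and> N (restr {p' j..<p' (Suc j)} x) \<le> \<Lambda> * b j + \<Lambda> / real m)"
      by blast
    then show ?case by blast
  qed
  obtain p where p0: "p 0 = s0 * T" and pp: "\<forall>j<m. p j < p (Suc j) \<and> p (Suc j) \<le> (s0 + t (Suc j)) * T \<and>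
      \<Lambda> * b j \<le> N (restr {p j..<p (Suc j)} x) \<and> N (restr {p j..<p (Suc j)} x) \<le> \<Lambda> * b j + \<Lambda> / real m"
    using pieces[OF order.refl] by blast
  have p: "p j < p (Suc j)" "p (Suc j) \<le> (s0 + t (Suc j)) * T" "\<Lambda> * b j \<le> N (restr {p j..<p (Suc j)} x)"
    "N (restr {p j..<p (Suc j)} x) \<le> \<Lambda> * b j + \<Lambda> / real m" if "j < m" for j
    using pp that by simp_all
  have strict: "\<forall>j<m. p j < p (Suc j)" using p(1) by blast
  have pm: "p m \<le> (s0 + L) * T" using p(2)[of "m - 1"] m t(2) by simp
  obtain M where M: "M \<in> F m"
    "M (\<lambda>j. if j < m then of_real (N (restr {p j..<p (Suc j)} x)) else 0) = N (restr {p 0..<p m} x)"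
    using block_norms[OF N x strict] pm top by (meson order.trans)
  have "restr {p 0..<p m} x = restr {..<p m} (step s0 L)"
    unfolding step_def restr_restr p0 using pm by (auto intro!: arg_cong[of _ _ "\<lambda>I. restr I x"])
  then have "N (restr {p 0..<p m} x) \<le> 2 * N (step s0 L)" using initial[OF N step] by simp
  then have total: "N (restr {p 0..<p m} x) \<le> 24 * \<Lambda>" using s0(2) by (simp add: \<Lambda>_def)
  define y :: "nat \<Rightarrow> 'k" where "y = (\<lambda>j. if j < m then of_real (N (restr {p j..<p (Suc j)} x) / \<Lambda>) else 0)"
  have y: "y \<in> tuples m" by (simp add: y_def tuples_def)
  have "M (\<lambda>j. if j < m then of_real (N (restr {p j..<p (Suc j)} x)) else 0) = \<Lambda> * M y"
    by (rule scale_real[OF M(1) y]) (use \<Lambda> in \<open>auto simp: y_def\<close>)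
  then have "\<Lambda> * M y \<le> \<Lambda> * 24" using M(2) total by simp
  then have My: "M y \<le> 24" using \<Lambda> by simp
  have "M (\<lambda>j. if j < m then of_real (b j) else 0) \<le> M y + (\<Sum>j<m. 1 / real m)"
  proof (rule le_add_sum[OF M(1) _ y])
    fix j assume j: "j < m"
    have "\<Lambda> * b j \<le> N (restr {p j..<p (Suc j)} x)" "N (restr {p j..<p (Suc j)} x) \<le> \<Lambda> * (b j + 1 / real m)"
      using p(3,4)[OF j] by (simp_all add: distrib_left)
    then have "b j \<le> N (restr {p j..<p (Suc j)} x) / \<Lambda>"
      "N (restr {p j..<p (Suc j)} x) / \<Lambda> \<le> b j + 1 / real m"
      using \<Lambda> by (simp_all add: pos_le_divide_eq pos_divide_le_eq mult.commute)
    then have "\<bar>b j - N (restr {p j..<p (Suc j)} x) / \<Lambda>\<bar> \<le> 1 / real m" by linarith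
    then show "norm ((if j < m then of_real (b j) else 0) - y j) \<le> 1 / real m"
      using j by (simp add: y_def del: of_real_divide flip: of_real_diff)
  qed (simp add: tuples_def)
  then have "M (\<lambda>j. if j < m then of_real (b j) else 0) \<le> 25" using My m by simp
  then show ?thesis using M(1) by blast
qed

lemma rotate_positive:
  assumes N: "N \<in> F n" and a: "a \<in> tuples n"
  shows "\<exists>M\<in>F n. M a = N (\<lambda>i. of_real (norm (a i)))"
proof -
  define \<theta> where "\<theta> = (\<lambda>i. if a i = 0 then 1 else of_real (norm (a i)) / a i)"
  have "\<forall>i<n. norm (\<theta> i) = 1" by (simp add: \<theta>_def norm_divide)
  then obtain M where M: "M \<in> F n" "\<And>b. b \<in> tuples n \<Longrightarrow> M b = N (\<lambda>i. \<theta> i * b i)"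
    using twist[OF N, of \<theta>] by blast
  have "(\<lambda>i. \<theta> i * a i) = (\<lambda>i. of_real (norm (a i)))" by (auto simp: \<theta>_def fun_eq_iff)
  then have "M a = N (\<lambda>i. of_real (norm (a i)))" using M(2)[OF a] by simp
  then show ?thesis using M(1) by blast
qed

text \<open>
  If the lower envelope is bounded on coefficients of modulus at most \<open>1\<close>, that bound serves as \<open>C\<close>.
  Otherwise \<open>spread_out_minimizer\<close> applies to \<open>b\<close>, half of \<open>\<bar>a\<bar>\<close> made bounded away from zero.
\<close>
lemma lower_envelope_upper_estimate:
  assumes \<alpha>: "0 \<le> \<alpha>" "\<alpha> \<le> 1" "\<And>n. 1 \<le> n \<Longrightarrow> min_spread n \<le> real n powr \<alpha>"
  shows "\<exists>C>0. \<forall>m\<ge>1. \<forall>a\<in>tuples m. (\<forall>i. norm (a i) \<le> 1) \<and>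
    (0 < \<alpha> \<longrightarrow> (\<Sum>i<m. norm (a i) powr (1 / \<alpha>)) \<le> 1) \<longrightarrow> (\<exists>N\<in>F m. N a \<le> C)"
proof (cases "\<exists>K. \<forall>T\<ge>1. \<forall>d\<in>tuples T. (\<forall>k. norm (d k) \<le> 1) \<longrightarrow> (\<exists>N\<in>F T. N d \<le> K)")
  case True
  then obtain K where K: "\<And>T d. 1 \<le> T \<Longrightarrow> d \<in> tuples T \<Longrightarrow> \<forall>k. norm (d k) \<le> 1 \<Longrightarrow> \<exists>N\<in>F T. N d \<le> K"
    by blast
  have "\<exists>N\<in>F m. N a \<le> max K 1" if a: "1 \<le> m" "a \<in> tuples m" "\<forall>i. norm (a i) \<le> 1" for m a
  proof -
    obtain N where "N \<in> F m" "N a \<le> K" using K[OF a] by blast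
    then show ?thesis by (intro bexI[of _ N]) auto
  qed
  then show ?thesis by (intro exI[of _ "max K 1"]) auto
next
  case False
  then have big: "\<exists>T\<ge>1. \<exists>d\<in>tuples T. (\<forall>k. norm (d k) \<le> 1) \<and> (\<forall>N\<in>F T. K < N d)" for K
    by (meson not_le)
  have "\<exists>N\<in>F m. N a \<le> 51"
    if m: "1 \<le> m" and a: "a \<in> tuples m" "\<And>i. norm (a i) \<le> 1"
      and one: "0 < \<alpha> \<Longrightarrow> (\<Sum>i<m. norm (a i) powr (1 / \<alpha>)) \<le> 1" for m a
  proof -
    define b where "b = (\<lambda>j. max (norm (a j)) (1 / real m) / 2)"
    have b0: "0 < b j" for j using m by (simp add: b_def less_max_iff_disj)
    have "1 / real m \<le> 1" using m by simp
    then have b1: "b j \<le> 1 / 2" for j using a(2)[of j] by (simp add: b_def)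
    obtain \<gamma> where \<gamma>: "\<And>j. 0 < \<gamma> j" "(\<Sum>j<m. \<gamma> j) = 1" "\<And>j. b j \<le> \<gamma> j powr \<alpha>"
    proof (cases "\<alpha> = 0")
      case True
      have "b j \<le> 1" for j using b1[of j] by linarith
      then show thesis by (intro that[of "\<lambda>_. 1 / real m"]) (use m True in auto)
    next
      case False
      then have \<alpha>0: "0 < \<alpha>" using \<alpha>(1) by simp
      define S where "S = (\<Sum>i<m. norm (a i) powr (1 / \<alpha>))"
      have S: "0 \<le> S" "S \<le> 1" using one[OF \<alpha>0] by (auto simp: S_def sum_nonneg)
      define \<gamma> where "\<gamma> = (\<lambda>j. (norm (a j) powr (1 / \<alpha>) + 1 / real m) / (S + 1))"
      show thesis
      proof (rule that[of \<gamma>])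
        show "0 < \<gamma> j" for j
          unfolding \<gamma>_def using m S(1) by (intro divide_pos_pos add_nonneg_pos) auto
        show "(\<Sum>j<m. \<gamma> j) = 1"
          unfolding \<gamma>_def sum_divide_distrib[symmetric] sum.distrib S_def[symmetric] using m S(1) by simp
        show "b j \<le> \<gamma> j powr \<alpha>" for j
        proof -
          define u where "u = max (norm (a j)) (1 / real m)"
          have u: "0 < u" "u \<le> 1" using b0[of j] b1[of j] by (auto simp: u_def b_def)
          have "u powr (1 / \<alpha>) \<le> norm (a j) powr (1 / \<alpha>) + 1 / real m"
          proof (cases "norm (a j) \<le> 1 / real m")
            case True
            have "u powr (1 / \<alpha>) \<le> u powr 1" using u \<alpha>0 \<alpha>(2) by (intro powr_mono') auto
            also have "\<dots> = 1 / real m" using True u by (simp add: u_def)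
            finally show ?thesis by (simp add: add_increasing)
          next
            case False
            then show ?thesis using m by (simp add: u_def)
          qed
          also have "\<dots> \<le> 2 * \<gamma> j"
          proof -
            define z where "z = norm (a j) powr (1 / \<alpha>) + 1 / real m"
            have "0 \<le> z" unfolding z_def by (intro add_nonneg_nonneg) auto
            then have "z * (S + 1) \<le> z * 2" using S by (intro mult_left_mono) auto
            then show ?thesis using S(1) unfolding \<gamma>_def z_def[symmetric] by (simp add: field_simps)
          qed
          finally have "(u powr (1 / \<alpha>)) powr \<alpha> \<le> (2 * \<gamma> j) powr \<alpha>"
            using \<alpha>0 by (intro powr_mono2) auto
          then have "u \<le> (2 * \<gamma> j) powr \<alpha>" using u(1) \<alpha>0 by (simp add: powr_powr)
          also have "\<dots> = 2 powr \<alpha> * \<gamma> j powr \<alpha>" by (simp add: powr_mult)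
          also have "\<dots> \<le> 2 * \<gamma> j powr \<alpha>"
            using powr_mono[of \<alpha> 1 "2::real"] \<alpha>(2) by (intro mult_right_mono) auto
          finally show ?thesis by (simp add: b_def u_def)
        qed
      qed
    qed
    obtain N where N: "N \<in> F m" "N (\<lambda>j. if j < m then of_real (b j) else 0) \<le> 25"
      using spread_out_minimizer[OF \<alpha> big m \<gamma>(1,2) b0 \<gamma>(3)] by blast
    define b' :: "nat \<Rightarrow> 'k" where "b' = (\<lambda>j. if j < m then of_real (b j) else 0)"
    have b': "b' \<in> tuples m" by (simp add: b'_def tuples_def)
    have tup: "(\<lambda>i. of_real (norm (a i))) \<in> tuples m" "(\<lambda>i. of_real 2 * b' i) \<in> tuples m"
      using a(1) b' by (simp_all add: tuples_def)
    have "N (\<lambda>i. of_real (norm (a i))) \<le> N (\<lambda>i. of_real 2 * b' i) + (\<Sum>i<m. 1 / real m)"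
    proof (rule le_add_sum[OF N(1) tup])
      fix i assume i: "i < m"
      have eq: "of_real (norm (a i)) - of_real 2 * b' i = (of_real (norm (a i) - 2 * b i) :: 'k)"
        using i by (simp add: b'_def)
      have "\<bar>norm (a i) - 2 * b i\<bar> \<le> 1 / real m" by (simp add: b_def max_def)
      then show "norm (of_real (norm (a i)) - of_real 2 * b' i) \<le> 1 / real m"
        unfolding eq norm_of_real .
    qed
    moreover have "N (\<lambda>i. of_real 2 * b' i) = 2 * N b'" by (rule scale_real[OF N(1) b']) auto
    ultimately have "N (\<lambda>i. of_real (norm (a i))) \<le> 51" using N(2) m by (simp add: b'_def)
    moreover obtain M where "M \<in> F m" "M a = N (\<lambda>i. of_real (norm (a i)))"
      using rotate_positive[OF N(1) a(1)] by blast
    ultimately show ?thesis by (intro bexI[of _ M]) auto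
  qed
  then show ?thesis by (intro exI[of _ 51]) auto
qed

end

section \<open>Iterated limits along an ultrafilter\<close>

lemma ultrafilter_exists:
  assumes "F \<noteq> (bot :: 'z filter)"
  obtains U where "U \<le> F" "U \<noteq> bot" "\<And>P. eventually P U \<or> eventually (\<lambda>z. \<not> P z) U"
proof -
  define A where "A = {G. G \<noteq> bot \<and> G \<le> F}"
  define R where "R = (\<lambda>G H :: 'z filter. H \<le> G)"
  have "\<exists>m\<in>A. \<forall>a\<in>A. R m a \<longrightarrow> a = m"
  proof (rule predicate_Zorn)
    show "partial_order_on A (relation_of R A)"
      by (rule partial_order_on_relation_ofI) (auto simp: R_def)
    fix C assume C: "C \<in> Chains (relation_of R A)"
    have CA: "C \<subseteq> A" using Chains_relation_of[OF C] .
    have total: "G \<le> H \<or> H \<le> G" if "G \<in> C" "H \<in> C" for G H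
      using C that by (auto simp: Chains_def relation_of_def R_def)
    show "\<exists>u\<in>A. \<forall>a\<in>C. R a u"
    proof (cases "C = {}")
      case True
      then show ?thesis using assms by (auto simp: A_def)
    next
      case False
      have ev: "eventually P (Inf C) \<longleftrightarrow> (\<exists>b\<in>C. eventually P b)" for P
      proof (rule eventually_Inf_base[OF False])
        fix G H assume GH: "G \<in> C" "H \<in> C"
        from total[OF GH] show "\<exists>x\<in>C. x \<le> inf G H"
        proof
          assume "G \<le> H"
          then show ?thesis using GH by (intro bexI[of _ G]) simp_all
        next
          assume "H \<le> G"
          then show ?thesis using GH by (intro bexI[of _ H]) simp_all
        qed
      qed
      have "Inf C \<noteq> bot"
        using ev[of "\<lambda>_. False"] CA by (auto simp: A_def trivial_limit_def)
      moreover obtain G where "G \<in> C" using False by blast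
      then have "Inf C \<le> F" using CA Inf_lower[of G C] by (auto simp: A_def)
      ultimately have "Inf C \<in> A" by (simp add: A_def)
      then show ?thesis by (intro bexI[of _ "Inf C"]) (auto simp: R_def intro: Inf_lower)
    qed
  qed
  then obtain U where U: "U \<in> A" and max: "\<And>G. G \<in> A \<Longrightarrow> G \<le> U \<Longrightarrow> G = U" by (auto simp: R_def)
  have "eventually P U" if "\<not> eventually (\<lambda>z. \<not> P z) U" for P
  proof -
    have "inf U (principal {z. P z}) \<noteq> bot"
      using that by (simp add: trivial_limit_def eventually_inf_principal)
    then have "inf U (principal {z. P z}) \<in> A" using U by (auto simp: A_def intro: le_infI1)
    then have "inf U (principal {z. P z}) = U" by (rule max) simp
    then have "U \<le> principal {z. P z}" by (metis inf.cobounded2)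
    then show ?thesis by (simp add: le_principal)
  qed
  then show thesis using that[of U] U by (auto simp: A_def)
qed

locale ultrafilter =
  fixes U :: "'z filter"
  assumes proper: "U \<noteq> bot" and ultra: "eventually P U \<or> eventually (\<lambda>z. \<not> P z) U"
begin

lemma bounded_convergent:
  fixes f :: "'z \<Rightarrow> real"
  assumes "\<And>z. \<bar>f z\<bar> \<le> K"
  shows "\<exists>l. (f \<longlongrightarrow> l) U"
proof -
  have "filtermap f U \<noteq> bot" using proper by (simp add: filtermap_bot_iff)
  moreover have "- K \<le> f z \<and> f z \<le> K" for z using assms[of z] by linarith
  then have "eventually (\<lambda>x. x \<in> {-K..K}) (filtermap f U)"
    by (simp add: eventually_filtermap)
  ultimately obtain l where l: "inf (nhds l) (filtermap f U) \<noteq> bot"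
    using compact_Icc[of "-K" K] unfolding compact_filter by blast
  have "(f \<longlongrightarrow> l) U"
  proof (rule topological_tendstoI)
    fix S assume S: "open S" "l \<in> S"
    show "eventually (\<lambda>z. f z \<in> S) U"
    proof (rule ccontr)
      assume "\<not> eventually (\<lambda>z. f z \<in> S) U"
      then have "eventually (\<lambda>x. x \<notin> S) (filtermap f U)"
        using ultra[of "\<lambda>z. f z \<in> S"] by (simp add: eventually_filtermap)
      moreover have "eventually (\<lambda>x. x \<in> S) (nhds l)" using S by (rule eventually_nhds_in_open)
      ultimately have "eventually (\<lambda>_. False) (inf (nhds l) (filtermap f U))"
        unfolding eventually_inf by (intro exI[of _ "\<lambda>x. x \<in> S"] exI[of _ "\<lambda>x. x \<notin> S"]) simp
      then show False using l by (simp add: trivial_limit_def)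
    qed
  qed
  then show ?thesis by blast
qed

primrec iterated_limit :: "('z list \<Rightarrow> real) \<Rightarrow> nat \<Rightarrow> 'z list \<Rightarrow> real" where
  "iterated_limit f 0 zs = f zs"
| "iterated_limit f (Suc r) zs = Lim U (\<lambda>z. iterated_limit f r (zs @ [z]))"

lemma iterated_limit_bounded:
  assumes "\<And>zs. \<bar>f zs\<bar> \<le> K"
  shows "\<bar>iterated_limit f r zs\<bar> \<le> K"
    and "((\<lambda>z. iterated_limit f r (zs @ [z])) \<longlongrightarrow> iterated_limit f (Suc r) zs) U"
proof -
  have lim: "((\<lambda>z. iterated_limit f r (zs @ [z])) \<longlongrightarrow> iterated_limit f (Suc r) zs) U"
    if b: "\<And>zs. \<bar>iterated_limit f r zs\<bar> \<le> K" for r zs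
  proof -
    obtain l where l: "((\<lambda>z. iterated_limit f r (zs @ [z])) \<longlongrightarrow> l) U"
      using bounded_convergent[of "\<lambda>z. iterated_limit f r (zs @ [z])" K] b by blast
    then show ?thesis using tendsto_Lim[OF proper l] by simp
  qed
  have b: "\<bar>iterated_limit f r zs\<bar> \<le> K" for r zs
  proof (induction r arbitrary: zs)
    case 0
    then show ?case using assms by simp
  next
    case (Suc r)
    have "((\<lambda>z. \<bar>iterated_limit f r (zs @ [z])\<bar>) \<longlongrightarrow> \<bar>iterated_limit f (Suc r) zs\<bar>) U"
      by (rule tendsto_rabs[OF lim[OF Suc.IH]])
    then show ?case by (rule tendsto_upperbound) (use Suc.IH proper in auto)
  qed
  show "\<bar>iterated_limit f r zs\<bar> \<le> K" by (rule b)
  show "((\<lambda>z. iterated_limit f r (zs @ [z])) \<longlongrightarrow> iterated_limit f (Suc r) zs) U" by (rule lim[OF b])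
qed

text \<open>
  The comparison is needed only for lists that satisfy an invariant \<open>V\<close> preserved by almost all one-step
  extensions.
\<close>
lemma iterated_limit_mono:
  assumes f: "\<And>zs. \<bar>f zs\<bar> \<le> K" and g: "\<And>zs. \<bar>g zs\<bar> \<le> K'"
    and V: "V zs" "\<And>zs. V zs \<Longrightarrow> eventually (\<lambda>z. V (zs @ [z])) U"
    and le: "\<And>zs'. V zs' \<Longrightarrow> length zs' = length zs + r \<Longrightarrow> f zs' \<le> g zs'"
  shows "iterated_limit f r zs \<le> iterated_limit g r zs"
  using V(1) le
proof (induction r arbitrary: zs)
  case 0
  then show ?case by simp
next
  case (Suc r)
  have "eventually (\<lambda>z. iterated_limit f r (zs @ [z]) \<le> iterated_limit g r (zs @ [z])) U"
    using V(2)[OF Suc.prems(1)]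
  proof (rule eventually_mono)
    fix z assume "V (zs @ [z])"
    then show "iterated_limit f r (zs @ [z]) \<le> iterated_limit g r (zs @ [z])"
      by (rule Suc.IH) (rule Suc.prems(2), simp_all)
  qed
  then show ?case
    by (rule tendsto_le[OF proper iterated_limit_bounded(2)[of g, OF g] iterated_limit_bounded(2)[of f, OF f]])
qed

lemma iterated_limit_const: "iterated_limit (\<lambda>_. c) r zs = c"
proof (induction r arbitrary: zs)
  case (Suc r)
  then show ?case using tendsto_Lim[OF proper, of "\<lambda>_. c" c] by simp
qed simp

lemma iterated_limit_scale:
  assumes "\<And>zs. \<bar>f zs\<bar> \<le> K"
  shows "iterated_limit (\<lambda>zs. c * f zs) r zs = c * iterated_limit f r zs"
proof (induction r arbitrary: zs)
  case (Suc r)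
  have "((\<lambda>z. c * iterated_limit f r (zs @ [z])) \<longlongrightarrow> c * iterated_limit f (Suc r) zs) U"
    by (rule tendsto_mult_left[OF iterated_limit_bounded(2)[of f, OF assms]])
  then show ?case using Suc tendsto_Lim[OF proper] by simp
qed simp

lemma iterated_limit_add:
  assumes f: "\<And>zs. \<bar>f zs\<bar> \<le> K" and g: "\<And>zs. \<bar>g zs\<bar> \<le> K'"
  shows "iterated_limit (\<lambda>zs. f zs + g zs) r zs = iterated_limit f r zs + iterated_limit g r zs"
proof (induction r arbitrary: zs)
  case (Suc r)
  have "((\<lambda>z. iterated_limit f r (zs @ [z]) + iterated_limit g r (zs @ [z]))
      \<longlongrightarrow> iterated_limit f (Suc r) zs + iterated_limit g (Suc r) zs) U"
    by (rule tendsto_add[OF iterated_limit_bounded(2)[of f, OF f] iterated_limit_bounded(2)[of g, OF g]])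
  then show ?case using Suc tendsto_Lim[OF proper] by simp
qed simp

end

section \<open>Finite nets\<close>

lemma finite_net_tuples:
  fixes \<eta> :: real
  assumes "0 < \<eta>"
  obtains D :: "(nat \<Rightarrow> 'k::{real_normed_field,euclidean_space}) set"
  where "finite D" "D \<subseteq> tuples n"
    "\<And>a. a \<in> tuples n \<Longrightarrow> (\<And>i. norm (a i) \<le> 1) \<Longrightarrow> \<exists>b\<in>D. \<forall>i. norm (a i - b i) \<le> \<eta>"
proof -
  have "compact (cball (0::'k) 1)" by simp
  then have "\<forall>e>0. \<exists>A. finite A \<and> cball (0::'k) 1 \<subseteq> (\<Union>x\<in>A. ball x e)"
    unfolding compact_eq_totally_bounded by (rule conjunct2)
  then obtain A where A: "finite A" "cball (0::'k) 1 \<subseteq> (\<Union>x\<in>A. ball x \<eta>)"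
    using assms by meson
  define D where "D = {f. \<forall>i. (i \<in> {..<n} \<longrightarrow> f i \<in> A) \<and> (i \<notin> {..<n} \<longrightarrow> f i = (0::'k))}"
  have "finite D" unfolding D_def by (rule finite_set_of_finite_funs[OF finite_lessThan A(1)])
  moreover have "f i = 0" if "f \<in> D" "n \<le> i" for f i
    using that by (simp add: D_def)
  then have "D \<subseteq> tuples n" unfolding tuples_def by blast
  moreover have "\<exists>b\<in>D. \<forall>i. norm (a i - b i) \<le> \<eta>"
    if a: "a \<in> tuples n" "\<And>i. norm (a i) \<le> 1" for a
  proof -
    have "\<exists>x\<in>A. norm (a i - x) \<le> \<eta>" for i
    proof -
      have "a i \<in> cball 0 1" using a(2) by simp
      then have "a i \<in> (\<Union>x\<in>A. ball x \<eta>)" using A(2) by (rule rev_subsetD)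
      then obtain x where "x \<in> A" "dist x (a i) < \<eta>" by auto
      then show ?thesis by (intro bexI[of _ x]) (simp_all add: dist_norm norm_minus_commute)
    qed
    then obtain c where c: "\<And>i. c i \<in> A" "\<And>i. norm (a i - c i) \<le> \<eta>" by metis
    define b where "b = (\<lambda>i. if i < n then c i else 0)"
    have "b \<in> D" using c(1) by (simp add: b_def D_def)
    moreover have "norm (a i - b i) \<le> \<eta>" for i
      using c(2)[of i] a(1) assms by (auto simp: b_def tuples_def)
    ultimately show ?thesis by blast
  qed
  ultimately show thesis using that by blast
qed

text \<open>
  Since every coordinate is at most \<open>4 * N a\<close>, closeness on a net of the unit ball of the sup norm gives
  closeness up to a factor on the whole space.
\<close>
lemma close_on_net:
  fixes p N :: "(nat \<Rightarrow> 'k::{real_normed_field,euclidean_space}) \<Rightarrow> real"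
  assumes N: "N \<in> based_spaces n" and \<kappa>: "0 < \<kappa>" "\<kappa> \<le> 1 / 8" and \<eta>: "0 < \<eta>" "3 * real (Suc n) * \<eta> \<le> \<kappa>"
    and D: "D \<subseteq> tuples n" "\<And>a. a \<in> tuples n \<Longrightarrow> (\<And>i. norm (a i) \<le> 1) \<Longrightarrow> \<exists>b\<in>D. \<forall>i. norm (a i - b i) \<le> \<eta>"
    and scale: "\<And>a c. a \<in> tuples n \<Longrightarrow> p (\<lambda>i. c * a i) = norm c * p a"
    and lip: "\<And>a b. a \<in> tuples n \<Longrightarrow> b \<in> tuples n \<Longrightarrow> \<bar>p a - p b\<bar> \<le> (\<Sum>i<n. norm (a i - b i))"
    and close: "\<And>b. b \<in> D \<Longrightarrow> \<bar>p b - N b\<bar> \<le> real n * \<eta>"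
    and a: "a \<in> tuples n"
  shows "p a \<le> (1 + 8 * \<kappa>) * N a" and "N a \<le> (1 + 8 * \<kappa>) * p a"
proof -
  have "p a \<le> (1 + 8 * \<kappa>) * N a \<and> N a \<le> (1 + 8 * \<kappa>) * p a"
  proof (cases "a = (\<lambda>_. 0)")
    case True
    then show ?thesis using scale[OF a, of 0] based.zero[OF N] by simp
  next
    case False
    define l where "l = Max ((\<lambda>i. norm (a i)) ` {..<n})"
    obtain i0 where i0: "a i0 \<noteq> 0" using False by blast
    then have i0n: "i0 < n" by (rule tuples_supportD[OF a])
    have le: "norm (a i) \<le> l" if "i < n" for i unfolding l_def using that by (intro Max_ge) auto
    have l: "0 < l" using le[OF i0n] i0 zero_less_norm_iff[of "a i0"] by linarith
    have "l \<in> (\<lambda>i. norm (a i)) ` {..<n}" unfolding l_def using i0n by (intro Max_in) auto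
    then obtain i1 where i1: "i1 < n" "norm (a i1) = l" by auto
    define a' where "a' = (\<lambda>i. of_real (1 / l) * a i)"
    have a': "a' \<in> tuples n" using a by (simp add: a'_def tuples_def)
    have na': "norm (a' i) = norm (a i) / l" for i using l by (simp add: a'_def norm_mult norm_divide)
    have "norm (a' i) \<le> 1" for i
      using le[of i] l a unfolding na' by (cases "i < n") (auto simp: tuples_def)
    then obtain b where b: "b \<in> D" "\<And>i. norm (a' i - b i) \<le> \<eta>" using D(2)[OF a'] by blast
    then have bt: "b \<in> tuples n" using D(1) by blast
    have "(\<Sum>i<n. norm (a' i - b i)) \<le> (\<Sum>i<n. \<eta>)" by (rule sum_mono) (use b in auto)
    then have s: "(\<Sum>i<n. norm (a' i - b i)) \<le> real n * \<eta>" by simp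
    have dt: "(\<lambda>i. a' i - b i) \<in> tuples n" "(\<lambda>i. b i - a' i) \<in> tuples n" using a' bt by (simp_all add: tuples_def)
    have "N a' \<le> N b + N (\<lambda>i. a' i - b i)" by (rule based.add_le[OF N bt dt(1)]) simp
    moreover have "N b \<le> N a' + N (\<lambda>i. b i - a' i)" by (rule based.add_le[OF N a' dt(2)]) simp
    moreover have "(\<Sum>i<n. norm (b i - a' i)) \<le> real n * \<eta>" using s by (simp add: norm_minus_commute)
    ultimately have "\<bar>N a' - N b\<bar> \<le> real n * \<eta>"
      using based.le_sum_norms[OF N dt(1)] based.le_sum_norms[OF N dt(2)] s by linarith
    moreover have "\<bar>p a' - p b\<bar> \<le> real n * \<eta>" using lip[OF a' bt] s by linarith
    moreover have "real n * \<eta> \<le> \<kappa> / 3" using \<eta> by (simp add: algebra_simps)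
    ultimately have cl: "\<bar>p a' - N a'\<bar> \<le> \<kappa>" using close[OF b(1)] by linarith
    have "norm (a' i1) = 1" unfolding na' i1(2) using l by simp
    then have N1: "1 \<le> 4 * N a'" using based.coordinate[OF N a', of i1] by simp
    have "\<kappa> * 1 \<le> \<kappa> * (4 * N a')" using N1 \<kappa>(1) by (intro mult_left_mono) auto
    then have k4: "\<kappa> \<le> 4 * \<kappa> * N a'" by simp
    have up: "p a' \<le> (1 + 8 * \<kappa>) * N a'"
    proof -
      have "p a' \<le> N a' + 4 * \<kappa> * N a'" using cl k4 by linarith
      also have "\<dots> \<le> (1 + 8 * \<kappa>) * N a'" using N1 \<kappa>(1) by (simp add: algebra_simps)
      finally show ?thesis .
    qed
    have low: "N a' \<le> (1 + 8 * \<kappa>) * p a'"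
    proof -
      have "(1 - 4 * \<kappa>) * N a' \<le> p a'" using cl k4 by (simp add: algebra_simps)
      then have "(1 + 8 * \<kappa>) * ((1 - 4 * \<kappa>) * N a') \<le> (1 + 8 * \<kappa>) * p a'"
        using \<kappa>(1) by (intro mult_left_mono) auto
      moreover have "1 \<le> (1 + 8 * \<kappa>) * (1 - 4 * \<kappa>)"
      proof -
        have "0 \<le> 4 * \<kappa> * (1 - 8 * \<kappa>)" using \<kappa> by (intro mult_nonneg_nonneg) auto
        then show ?thesis by (simp add: algebra_simps)
      qed
      then have "1 * N a' \<le> (1 + 8 * \<kappa>) * (1 - 4 * \<kappa>) * N a'" using N1 by (intro mult_right_mono) auto
      ultimately show ?thesis by (simp add: mult.assoc)
    qed
    have pl: "p a' = 1 / l * p a" using scale[OF a, of "of_real (1 / l)"] l by (simp add: a'_def norm_divide)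
    have Nl: "N a' = 1 / l * N a" by (rule based.scale_real[OF N a]) (use l in \<open>simp_all add: a'_def\<close>)
    have "1 / l * p a \<le> 1 / l * ((1 + 8 * \<kappa>) * N a)" "1 / l * N a \<le> 1 / l * ((1 + 8 * \<kappa>) * p a)"
      using up low unfolding pl Nl by (simp_all add: mult_ac)
    then show ?thesis using l by (simp_all add: mult_le_cancel_left_pos divide_le_cancel)
  qed
  then show "p a \<le> (1 + 8 * \<kappa>) * N a" "N a \<le> (1 + 8 * \<kappa>) * p a" by simp_all
qed

section \<open>The game\<close>

definition play :: "('a set list \<Rightarrow> 'a) \<Rightarrow> (nat \<Rightarrow> 'a set) \<Rightarrow> nat \<Rightarrow> 'a" where
  "play \<sigma> Y k = \<sigma> (map Y [0..<Suc k])"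

locale asymptotic_game = banach_space_over scal
  for scal :: "'k::{real_normed_field,euclidean_space} \<Rightarrow> 'a::banach \<Rightarrow> 'a" +
  fixes B :: "'a set set"
  assumes family: "asymptotic_family scal B"
begin

abbreviation cn :: "nat \<Rightarrow> (nat \<Rightarrow> 'a) \<Rightarrow> (nat \<Rightarrow> 'k) \<Rightarrow> real" where
  "cn \<equiv> coord_norm scal"

lemma subspace_member: "Z \<in> B \<Longrightarrow> subspace Z"
  and infinite_dimensional: "Z \<in> B \<Longrightarrow> \<not> fin_dim scal Z"
  and filtration: "Y \<in> B \<Longrightarrow> Z \<in> B \<Longrightarrow> \<exists>W\<in>B. W \<subseteq> Y \<inter> Z"
  and separated: "subspace G \<Longrightarrow> fin_dim scal G \<Longrightarrow> 0 < \<delta> \<Longrightarrow>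
    \<exists>Z\<in>B. \<forall>f\<in>G. \<forall>z\<in>Z. norm f \<le> (1 + \<delta>) * norm (f + z)"
  using family unfolding asymptotic_family_def by blast+

lemma family_nonempty: "B \<noteq> {}"
proof -
  have "fin_dim scal {0}" unfolding fin_dim_def by (rule exI[of _ "{0}"]) (auto intro: span_base)
  then show ?thesis using separated[of "{0}" 1] subspace_single_0 by auto
qed

lemma unit_vector:
  assumes "Z \<in> B"
  obtains z where "z \<in> Z" "norm z = 1"
proof -
  have "Z \<noteq> {0}"
  proof
    assume "Z = {0}"
    then have "fin_dim scal Z" unfolding fin_dim_def by (intro exI[of _ "{0}"]) (auto intro: span_base)
    then show False using infinite_dimensional[OF assms] by blast
  qed
  moreover have sub: "subspace Z" by (rule subspace_member[OF assms])
  ultimately obtain v where v: "v \<in> Z" "v \<noteq> 0" using subspace_0 by blast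
  have "scal (of_real (1 / norm v)) v \<in> Z" by (rule subspace_scale[OF sub v(1)])
  moreover have "norm (scal (of_real (1 / norm v)) v) = 1" using v(2) by (simp add: norm_scal norm_divide)
  ultimately show thesis using that by blast
qed

lemma cn_scale: "cn n x (\<lambda>i. c * a i) = norm c * cn n x a"
proof -
  have "(\<Sum>i<n. scal (c * a i) (x i)) = scal c (\<Sum>i<n. scal (a i) (x i))"
    by (simp add: scale_sum_right)
  then show ?thesis by (simp add: coord_norm_def norm_scal)
qed

lemma cn_nonneg: "0 \<le> cn n x a"
  by (simp add: coord_norm_def)

lemma cn_lipschitz:
  assumes "\<And>k. k < n \<Longrightarrow> norm (x k) \<le> 1"
  shows "\<bar>cn n x a - cn n x b\<bar> \<le> (\<Sum>i<n. norm (a i - b i))"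
proof -
  have "\<bar>cn n x a - cn n x b\<bar> \<le> norm ((\<Sum>i<n. scal (a i) (x i)) - (\<Sum>i<n. scal (b i) (x i)))"
    unfolding coord_norm_def by (rule norm_triangle_ineq3)
  also have "(\<Sum>i<n. scal (a i) (x i)) - (\<Sum>i<n. scal (b i) (x i)) = (\<Sum>i<n. scal (a i - b i) (x i))"
    by (simp add: scale_left_diff_distrib sum_subtractf)
  also have "norm \<dots> \<le> (\<Sum>i<n. norm (a i - b i))"
  proof (rule sum_norm_le)
    fix i assume "i \<in> {..<n}"
    then have "norm (x i) \<le> 1" using assms by simp
    then have "norm (a i - b i) * norm (x i) \<le> norm (a i - b i) * 1" by (intro mult_left_mono) auto
    then show "norm (scal (a i - b i) (x i)) \<le> norm (a i - b i)" by (simp add: norm_scal)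
  qed
  finally show ?thesis .
qed

lemma cn_restrict:
  assumes "a \<in> tuples m" "m \<le> n"
  shows "cn n x a = cn m x a"
proof -
  have "(\<Sum>i<n. scal (a i) (x i)) = (\<Sum>i<m. scal (a i) (x i))"
    by (rule sum.mono_neutral_right) (use assms in \<open>auto simp: tuples_def\<close>)
  then show ?thesis by (simp add: coord_norm_def)
qed

lemma cn_cong: "(\<And>k. k < n \<Longrightarrow> x k = y k) \<Longrightarrow> cn n x a = cn n y a"
  by (simp add: coord_norm_def)

lemma independent_iff:
  "inj_on x {..<n} \<and> independent (x ` {..<n}) \<longleftrightarrow>
    (\<forall>a\<in>tuples n. cn n x a = 0 \<longrightarrow> a = (\<lambda>_. 0))"
proof
  assume inj: "inj_on x {..<n} \<and> independent (x ` {..<n})"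
  show "\<forall>a\<in>tuples n. cn n x a = 0 \<longrightarrow> a = (\<lambda>_. 0)"
  proof (intro ballI impI)
    fix a :: "nat \<Rightarrow> 'k" assume a: "a \<in> tuples n" "cn n x a = 0"
    define u where "u = (\<lambda>v. a (inv_into {..<n} x v))"
    have ux: "u (x i) = a i" if "i < n" for i using inj that by (simp add: u_def inv_into_f_f)
    have "(\<Sum>v\<in>x ` {..<n}. scal (u v) v) = (\<Sum>i<n. scal (u (x i)) (x i))"
      using inj by (simp add: sum.reindex)
    also have "\<dots> = (\<Sum>i<n. scal (a i) (x i))" by (rule sum.cong) (simp_all add: ux)
    also have "\<dots> = 0" using a(2) by (simp add: coord_norm_def)
    finally have "(\<Sum>v\<in>x ` {..<n}. scal (u v) v) = 0" .
    then have "u v = 0" if "v \<in> x ` {..<n}" for v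
      using independentD[of "x ` {..<n}" "x ` {..<n}" u v] inj that by simp
    then have "a i = 0" if "i < n" for i using ux[OF that] that by simp
    moreover have "a i = 0" if "\<not> i < n" for i using a(1) that by (simp add: tuples_def)
    ultimately show "a = (\<lambda>_. 0)" by blast
  qed
next
  assume z: "\<forall>a\<in>tuples n. cn n x a = 0 \<longrightarrow> a = (\<lambda>_. 0)"
  have inj: "inj_on x {..<n}"
  proof (rule inj_onI, rule ccontr)
    fix i j assume ij: "i \<in> {..<n}" "j \<in> {..<n}" "x i = x j" "i \<noteq> j"
    define a where "a = (\<lambda>l. if l = i then 1 else if l = j then - 1 else (0::'k))"
    have "(\<Sum>l<n. scal (a l) (x l)) = (\<Sum>l\<in>{i, j}. scal (a l) (x l))"
      by (rule sum.mono_neutral_right) (use ij in \<open>auto simp: a_def\<close>)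
    also have "\<dots> = 0" using ij by (simp add: a_def)
    finally have "cn n x a = 0" by (simp add: coord_norm_def)
    moreover have "a \<in> tuples n" using ij by (simp add: a_def tuples_def)
    ultimately have "a = (\<lambda>_. 0)" using z by blast
    then have "a i = 0" by simp
    then show False by (simp add: a_def)
  qed
  moreover have "independent (x ` {..<n})"
  proof
    assume "dependent (x ` {..<n})"
    then obtain u where u: "\<exists>v\<in>x ` {..<n}. u v \<noteq> 0" "(\<Sum>v\<in>x ` {..<n}. scal (u v) v) = 0"
      using dependent_finite[of "x ` {..<n}"] by auto
    define a where "a = (\<lambda>i. if i < n then u (x i) else 0)"
    have "(\<Sum>i<n. scal (a i) (x i)) = (\<Sum>i<n. scal (u (x i)) (x i))"
      by (rule sum.cong) (simp_all add: a_def)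
    also have "\<dots> = (\<Sum>v\<in>x ` {..<n}. scal (u v) v)" using inj by (simp add: sum.reindex)
    finally have "cn n x a = 0" using u(2) by (simp add: coord_norm_def)
    moreover have "a \<in> tuples n" by (simp add: a_def tuples_def)
    ultimately have "a = (\<lambda>_. 0)" using z by blast
    then have "u (x i) = 0" if "i < n" for i using that by (metis a_def)
    then show False using u(1) by auto
  qed
  ultimately show "inj_on x {..<n} \<and> independent (x ` {..<n})" by blast
qed

text \<open>
  The vector player has won if she realizes \<open>N\<close> up to the factor \<open>1 + \<delta>\<close> in both directions.  No scaling
  is involved, because the bases on both sides are normalized.
\<close>
definition good :: "nat \<Rightarrow> real \<Rightarrow> ((nat \<Rightarrow> 'k) \<Rightarrow> real) \<Rightarrow> (nat \<Rightarrow> 'a set) \<Rightarrow> (nat \<Rightarrow> 'a) \<Rightarrow> bool" where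
  "good n \<delta> N Y x \<longleftrightarrow> (\<forall>k<n. x k \<in> Y k \<and> norm (x k) = 1) \<and>
    (\<forall>a\<in>tuples n. \<forall>m. cn n x (restr {..<m} a) \<le> 2 * cn n x a) \<and>
    (\<forall>a\<in>tuples n. N a \<le> (1 + \<delta>) * cn n x a \<and> cn n x a \<le> (1 + \<delta>) * N a)"

lemma id_norm_le:
  fixes M N :: "(nat \<Rightarrow> 'k) \<Rightarrow> real"
  assumes "\<And>a. a \<in> tuples n \<Longrightarrow> M a \<le> K * N a" "\<And>a. a \<in> tuples n \<Longrightarrow> 0 \<le> N a" "0 \<le> K"
  shows "id_norm n N M \<le> ereal K"
  unfolding id_norm_def
proof (rule SUP_least)
  fix a :: "nat \<Rightarrow> 'k" assume a: "a \<in> tuples n"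
  have "M a / N a \<le> K"
    using assms(1)[OF a] assms(2)[OF a] assms(3) by (cases "N a = 0") (simp_all add: pos_divide_le_eq)
  then show "ereal (M a / N a) \<le> ereal K" by simp
qed

lemma good_basic_sequence:
  assumes good: "good n \<delta> N Y x" and N: "N \<in> based_spaces n" and k: "k < n"
  shows "basic_sequence scal 2 (Suc k) x"
proof -
  have sub: "a \<in> tuples n" if "a \<in> tuples (Suc k)" for a :: "nat \<Rightarrow> 'k"
    using that k by (simp add: tuples_def)
  have eq: "cn (Suc k) x a = cn n x a" if "a \<in> tuples (Suc k)" for a
    using cn_restrict[OF that, of n x] k by simp
  have "a = (\<lambda>_. 0)" if a: "a \<in> tuples (Suc k)" "cn (Suc k) x a = 0" for a
  proof -
    have "N a \<le> (1 + \<delta>) * cn n x a" using good sub[OF a(1)] by (simp add: good_def)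
    then have "N a \<le> 0" using a eq by simp
    then have "N a = 0" using based.nonneg[OF N sub[OF a(1)]] by simp
    then show ?thesis using based.zero_iff[OF N sub[OF a(1)]] by simp
  qed
  then have "inj_on x {..<Suc k} \<and> independent (x ` {..<Suc k})" unfolding independent_iff by blast
  moreover have "basis_constant (Suc k) (cn (Suc k) x) \<le> 2"
  proof (rule basis_constant_le_two)
    fix a :: "nat \<Rightarrow> 'k" and m assume a: "a \<in> tuples (Suc k)"
    have "cn n x (restr {..<m} a) \<le> 2 * cn n x a" using good sub[OF a] by (simp add: good_def)
    then show "cn (Suc k) x (restr {..<m} a) \<le> 2 * cn (Suc k) x a"
      using eq[OF a] eq[OF restr_tuples[OF a]] by simp
  qed (rule cn_nonneg)
  ultimately show ?thesis by (simp add: basic_sequence_def)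
qed

lemma good_equivalent:
  assumes good: "good n \<delta> N Y x" and N: "N \<in> based_spaces n" and \<delta>: "0 < \<delta>" "(1 + \<delta>)\<^sup>2 \<le> 1 + \<epsilon>"
  shows "equivalent_bases n (1 + \<epsilon>) (cn n x) N"
proof -
  have "id_norm n (cn n x) N \<le> ereal (1 + \<delta>)"
    by (rule id_norm_le) (use good \<delta> cn_nonneg in \<open>auto simp: good_def\<close>)
  moreover have "id_norm n N (cn n x) \<le> ereal (1 + \<delta>)"
    by (rule id_norm_le) (use good \<delta> based.nonneg[OF N] in \<open>auto simp: good_def\<close>)
  moreover have "0 \<le> id_norm n N (cn n x)" "0 \<le> id_norm n (cn n x) N"
    unfolding id_norm_def by (rule SUP_upper2[of "\<lambda>_. 0"], auto simp: tuples_def coord_norm_def)+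
  ultimately have "id_norm n (cn n x) N * id_norm n N (cn n x) \<le> ereal (1 + \<delta>) * ereal (1 + \<delta>)"
    using \<delta>(1) by (intro ereal_mult_mono') auto
  also have "\<dots> \<le> ereal (1 + \<epsilon>)" using \<delta>(2) by (simp add: power2_eq_square)
  finally show ?thesis by (simp add: equivalent_bases_def)
qed

lemma good_cong:
  assumes "good n \<delta> N Y x" "\<And>k. k < n \<Longrightarrow> y k = x k"
  shows "good n \<delta> N Y y"
proof -
  have "cn n y a = cn n x a" for a by (rule cn_cong) (rule assms(2))
  then show ?thesis using assms by (simp add: good_def)
qed

lemma asymptotic_spacesI:
  assumes N: "N \<in> based_spaces n"
    and win: "\<And>\<delta>. 0 < \<delta> \<Longrightarrow> \<exists>\<sigma>. \<forall>Y. (\<forall>k<n. Y k \<in> B) \<longrightarrow> good n \<delta> N Y (play \<sigma> Y)"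
  shows "N \<in> asymptotic_spaces scal B n"
proof -
  have "vector_player_wins scal B n N \<epsilon>" if \<epsilon>: "0 < \<epsilon>" for \<epsilon>
  proof -
    define \<delta> where "\<delta> = min \<epsilon> 1 / 3"
    have \<delta>: "0 < \<delta>" "\<delta> \<le> 1" "3 * \<delta> \<le> \<epsilon>" using \<epsilon> by (auto simp: \<delta>_def)
    have "\<delta> * \<delta> \<le> \<delta> * 1" using \<delta> by (intro mult_left_mono) auto
    moreover have "(1 + \<delta>)\<^sup>2 = 1 + 2 * \<delta> + \<delta> * \<delta>" by (simp add: power2_eq_square algebra_simps)
    ultimately have sq: "(1 + \<delta>)\<^sup>2 \<le> 1 + \<epsilon>" using \<delta> by linarith
    obtain \<sigma> where \<sigma>: "\<And>Y. (\<forall>k<n. Y k \<in> B) \<Longrightarrow> good n \<delta> N Y (play \<sigma> Y)" using win[OF \<delta>(1)] by blast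
    show ?thesis
      unfolding vector_player_wins_def
    proof (rule exI[of _ \<sigma>], intro allI impI)
      fix Y x assume a: "(\<forall>k<n. Y k \<in> B) \<and> (\<forall>k<n. x k = \<sigma> (map Y [0..<Suc k]))"
      have g: "good n \<delta> N Y x"
        by (rule good_cong[OF \<sigma>]) (use a in \<open>simp_all add: play_def\<close>)
      have "x k \<in> Y k \<inter> sphere 0 1" if "k < n" for k using g that by (simp add: good_def)
      moreover have "basic_sequence scal 2 (Suc k) x" if "k < n" for k by (rule good_basic_sequence[OF g N that])
      moreover have "equivalent_bases n (1 + \<epsilon>) (cn n x) N" by (rule good_equivalent[OF g N \<delta>(1) sq])
      ultimately show "(\<forall>k<n. x k \<in> Y k \<inter> sphere 0 1 \<and> basic_sequence scal 2 (Suc k) x) \<and>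
          equivalent_bases n (1 + \<epsilon>) (cn n x) N" by blast
    qed
  qed
  then show ?thesis using N by (simp add: asymptotic_spaces_def)
qed

lemma id_norm_bound:
  fixes M N :: "(nat \<Rightarrow> 'k) \<Rightarrow> real"
  assumes "id_norm n N M \<le> ereal K" "a \<in> tuples n" "0 < N a"
  shows "M a \<le> K * N a"
proof -
  have "ereal (M a / N a) \<le> id_norm n N M" unfolding id_norm_def by (rule SUP_upper[OF assms(2)])
  then have "M a / N a \<le> K" using assms(1) by (meson order.trans ereal_less_eq(3))
  then show ?thesis using assms(3) by (simp add: pos_divide_le_eq)
qed

text \<open>
  Both operator norms in the definition of equivalence are at least \<open>1\<close>, as a unit basis vector is mapped
  to a unit vector.  A bound for their product therefore bounds each of them.
\<close>
lemma asymptotic_spacesD: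
  assumes N: "N \<in> asymptotic_spaces scal B n" and \<delta>: "0 < \<delta>"
  obtains \<sigma> where "\<And>Y. (\<And>k. k < n \<Longrightarrow> Y k \<in> B) \<Longrightarrow> good n \<delta> N Y (play \<sigma> Y)"
proof -
  have Nb: "N \<in> based_spaces n" using N by (simp add: asymptotic_spaces_def)
  obtain \<sigma> where \<sigma>: "\<And>Y x. (\<forall>k<n. Y k \<in> B) \<and> (\<forall>k<n. x k = \<sigma> (map Y [0..<Suc k])) \<Longrightarrow>
      (\<forall>k<n. x k \<in> Y k \<inter> sphere 0 1 \<and> basic_sequence scal 2 (Suc k) x) \<and>
      equivalent_bases n (1 + \<delta>) (cn n x) N"
    using N \<delta> unfolding asymptotic_spaces_def vector_player_wins_def by blast
  have "good n \<delta> N Y (play \<sigma> Y)" if Y: "\<And>k. k < n \<Longrightarrow> Y k \<in> B" for Y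
  proof -
    define x where "x = play \<sigma> Y"
    have w: "\<And>k. k < n \<Longrightarrow> x k \<in> Y k \<inter> sphere 0 1 \<and> basic_sequence scal 2 (Suc k) x"
      "equivalent_bases n (1 + \<delta>) (cn n x) N"
      using \<sigma>[of Y x] Y by (simp_all add: x_def play_def)
    show ?thesis
    proof (cases n)
      case 0
      have "a = (\<lambda>_. 0)" if "a \<in> tuples 0" for a :: "nat \<Rightarrow> 'k" using that by (auto simp: tuples_def)
      then have "N a = 0" if "a \<in> tuples 0" for a using based.zero[OF Nb] that by auto
      then show ?thesis using 0 by (simp add: good_def coord_norm_def)
    next
      case (Suc k)
      have bs: "basic_sequence scal 2 n x" using w(1)[of k] Suc by simp
      then have ind: "\<And>a. a \<in> tuples n \<Longrightarrow> cn n x a = 0 \<Longrightarrow> a = (\<lambda>_. 0)"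
        using independent_iff[of x n] by (simp add: basic_sequence_def)
      have unit: "x k \<in> Y k \<and> norm (x k) = 1" if "k < n" for k using w(1)[OF that] by simp
      have proj: "cn n x (restr {..<m} a) \<le> 2 * cn n x a" if a: "a \<in> tuples n" for a m
      proof (cases "m \<le> n \<and> cn n x a \<noteq> 0")
        case True
        have "id_norm n (cn n x) (\<lambda>a. cn n x (\<lambda>i. if i < m then a i else 0)) \<le> basis_constant n (cn n x)"
          unfolding basis_constant_def by (rule SUP_upper) (use True in simp)
        also have "\<dots> \<le> ereal 2" using bs by (simp add: basic_sequence_def)
        finally have "cn n x (\<lambda>i. if i < m then a i else 0) \<le> 2 * cn n x a"
          by (rule id_norm_bound[OF _ a]) (use True cn_nonneg[of n x a] in simp)
        then show ?thesis by (simp add: restr_def)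
      next
        case False
        then consider "n < m" | "cn n x a = 0" by linarith
        then show ?thesis
        proof cases
          case 1
          then have "restr {..<m} a = a" using a by (auto simp: restr_def tuples_def fun_eq_iff)
          then show ?thesis using cn_nonneg[of n x a] by simp
        next
          case 2
          then have "a = (\<lambda>_. 0)" using ind a by blast
          then show ?thesis by (simp add: restr_def coord_norm_def)
        qed
      qed
      define e where "e = (\<lambda>i. if i = k then 1 else (0::'k))"
      have e: "e \<in> tuples n" using Suc by (simp add: e_def tuples_def)
      have Ne: "N e = 1" unfolding e_def using based.unit[OF Nb, of k] Suc by simp
      have ce: "cn n x e = 1"
      proof -
        have "(\<Sum>i<n. scal (e i) (x i)) = (\<Sum>i<n. if i = k then x k else 0)"
          by (rule sum.cong) (auto simp: e_def)
        then show ?thesis using unit[of k] Suc by (simp add: coord_norm_def)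
      qed
      define A where "A = id_norm n (cn n x) N"
      define A' where "A' = id_norm n N (cn n x)"
      have "ereal (N e / cn n x e) \<le> A" unfolding A_def id_norm_def by (rule SUP_upper[OF e])
      then have A1: "1 \<le> A" using Ne ce by (simp add: one_ereal_def)
      have "ereal (cn n x e / N e) \<le> A'" unfolding A'_def id_norm_def by (rule SUP_upper[OF e])
      then have A1': "1 \<le> A'" using Ne ce by (simp add: one_ereal_def)
      have AA: "A * A' \<le> ereal (1 + \<delta>)" using w(2) by (simp add: equivalent_bases_def A_def A'_def)
      have "A * 1 \<le> A * A'" using A1 A1' by (intro ereal_mult_left_mono) (auto intro: order.trans[of 0 1])
      then have Al: "A \<le> ereal (1 + \<delta>)" using AA by (simp del: plus_ereal.simps)
      have "1 * A' \<le> A * A'" using A1 A1' by (intro ereal_mult_right_mono) (auto intro: order.trans[of 0 1])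
      then have Al': "A' \<le> ereal (1 + \<delta>)" using AA by (simp del: plus_ereal.simps)
      have cmp: "N a \<le> (1 + \<delta>) * cn n x a \<and> cn n x a \<le> (1 + \<delta>) * N a" if a: "a \<in> tuples n" for a
      proof (cases "a = (\<lambda>_. 0)")
        case True
        then show ?thesis using based.zero[OF Nb] by (simp add: coord_norm_def)
      next
        case False
        then have "0 < cn n x a" using ind[OF a] cn_nonneg[of n x a] by fastforce
        moreover have "0 < N a" using False based.zero_iff[OF Nb a] based.nonneg[OF Nb a] by linarith
        ultimately show ?thesis
          using id_norm_bound[OF Al[unfolded A_def] a] id_norm_bound[OF Al'[unfolded A'_def] a] by blast
      qed
      show ?thesis unfolding good_def x_def[symmetric] using unit proj cmp by blast
    qed
  qed
  then show thesis using that by blast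
qed

end

section \<open>Asymptotic spaces from trees of vectors\<close>

context asymptotic_game
begin

definition refinements :: "'a set filter" where
  "refinements = (INF Y\<in>B. principal {Z \<in> B. Z \<subseteq> Y})"

lemma eventually_refinements:
  "eventually P refinements \<longleftrightarrow> (\<exists>Y\<in>B. \<forall>Z\<in>B. Z \<subseteq> Y \<longrightarrow> P Z)"
proof -
  have "eventually P refinements \<longleftrightarrow> (\<exists>Y\<in>B. eventually P (principal {Z \<in> B. Z \<subseteq> Y}))"
    unfolding refinements_def
  proof (rule eventually_INF_base[OF family_nonempty])
    fix Y Z assume "Y \<in> B" "Z \<in> B"
    then obtain W where W: "W \<in> B" "W \<subseteq> Y \<inter> Z" using filtration by blast
    then have "{V \<in> B. V \<subseteq> W} \<subseteq> {V \<in> B. V \<subseteq> Y} \<inter> {V \<in> B. V \<subseteq> Z}" by blast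
    then show "\<exists>x\<in>B. principal {V \<in> B. V \<subseteq> x} \<le> inf (principal {V \<in> B. V \<subseteq> Y}) (principal {V \<in> B. V \<subseteq> Z})"
      using W(1) by (intro bexI[of _ W]) simp_all
  qed
  then show ?thesis unfolding eventually_principal by (simp add: Ball_def Bex_def imp_conjL)
qed

lemma refinements_nontrivial: "refinements \<noteq> bot"
  unfolding trivial_limit_def eventually_refinements by blast

text \<open>
  Let \<open>N a\<close> be the iterated limit of the norms of \<open>\<Sum>i. a i \<tau>(Z1, \<dots>, Zi)\<close> along an ultrafilter \<open>U\<close> that
  contains all sets \<open>{Z \<in> B. Z \<subseteq> Y}\<close>.  Given a finite-dimensional subspace and \<open>\<delta>\<close>, almost all \<open>Z\<close> are nearly
  orthogonal to it, which makes the basis constant of \<open>N\<close> equal to \<open>1\<close>.  To realize \<open>N\<close> against moves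
  \<open>Y1, Y2, \<dots>\<close>, the vector player secretly picks \<open>Zi \<subseteq> Yi\<close> such that on a finite net the partial iterated
  limit at \<open>Z1, \<dots>, Zi\<close> is close to the previous one, and plays \<open>\<tau>(Z1, \<dots>, Zi)\<close>.  After the last
  move the partial limit is the actual norm.
\<close>
lemma tree_limit:
  assumes \<tau>: "\<And>Zs. Zs \<noteq> [] \<Longrightarrow> set Zs \<subseteq> B \<Longrightarrow> length Zs \<le> n \<Longrightarrow> \<tau> Zs \<in> last Zs \<and> norm (\<tau> Zs) = 1"
  shows "\<exists>N\<in>asymptotic_spaces scal B n. \<forall>b\<in>tuples n. \<forall>s.
    (\<forall>Y. (\<forall>k<n. Y k \<in> B) \<longrightarrow> cn n (play \<tau> Y) b \<le> s) \<longrightarrow> N b \<le> s"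
proof -
  obtain U where U: "U \<le> refinements" "U \<noteq> bot" "\<And>P. eventually P U \<or> eventually (\<lambda>z. \<not> P z) U"
    using ultrafilter_exists[OF refinements_nontrivial] by blast
  interpret ultrafilter U using U by unfold_locales
  have evU: "eventually P U" if "Y \<in> B" "\<And>Z. Z \<in> B \<Longrightarrow> Z \<subseteq> Y \<Longrightarrow> P Z" for P Y
    using that eventually_refinements[of P] U(1) by (meson filter_leD)
  \<comment> \<open>The default value \<open>0\<close> keeps the norms bounded on arbitrary lists, so that all limits exist.\<close>
  define \<rho> where "\<rho> = (\<lambda>Zs. if Zs \<noteq> [] \<and> set Zs \<subseteq> B \<and> length Zs \<le> n then \<tau> Zs else 0)"
  have \<rho>1: "norm (\<rho> Zs) \<le> 1" for Zs using \<tau>[of Zs] by (simp add: \<rho>_def)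
  define val where "val = (\<lambda>(b :: nat \<Rightarrow> 'k) Zs. norm (\<Sum>i<length Zs. scal (b i) (\<rho> (take (Suc i) Zs))))"
  define K where "K = (\<lambda>b :: nat \<Rightarrow> 'k. \<Sum>i<n. norm (b i))"
  have bnd: "\<bar>val b Zs\<bar> \<le> K b" if b: "b \<in> tuples n" for b Zs
  proof -
    have "val b Zs \<le> (\<Sum>i<length Zs. norm (b i))"
      unfolding val_def
    proof (rule sum_norm_le)
      fix i
      have "norm (b i) * norm (\<rho> (take (Suc i) Zs)) \<le> norm (b i) * 1"
        using \<rho>1 by (intro mult_left_mono) auto
      then show "norm (scal (b i) (\<rho> (take (Suc i) Zs))) \<le> norm (b i)" by (simp add: norm_scal)
    qed
    also have "\<dots> = (\<Sum>i\<in>{..<length Zs} \<inter> {..<n}. norm (b i))"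
      by (rule sum.mono_neutral_right) (use tuples_supportD[OF b] in auto)
    also have "\<dots> \<le> K b" unfolding K_def by (rule sum_mono2) auto
    finally show ?thesis by (simp add: val_def)
  qed
  define V where "V = (\<lambda>Zs. set Zs \<subseteq> B)"
  have V0: "V []" by (simp add: V_def)
  have Vs: "eventually (\<lambda>Z. V (Zs @ [Z])) U" if "V Zs" for Zs
  proof -
    obtain Y where "Y \<in> B" using family_nonempty by blast
    then show ?thesis by (rule evU) (use that in \<open>simp add: V_def\<close>)
  qed
  define N where "N = (\<lambda>b. iterated_limit (val b) n [])"
  have scal_N: "N (\<lambda>i. c * a i) = norm c * N a" if a: "a \<in> tuples n" for a c
  proof -
    have "val (\<lambda>i. c * a i) Zs = norm c * val a Zs" for Zs
    proof -
      have "(\<Sum>i<length Zs. scal (c * a i) (\<rho> (take (Suc i) Zs)))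
          = scal c (\<Sum>i<length Zs. scal (a i) (\<rho> (take (Suc i) Zs)))"
        by (simp add: scale_sum_right)
      then show ?thesis by (simp add: val_def norm_scal)
    qed
    then have "val (\<lambda>i. c * a i) = (\<lambda>Zs. norm c * val a Zs)" by blast
    then show ?thesis unfolding N_def using iterated_limit_scale[of "val a", OF bnd[OF a]] by simp
  qed
  have tri_N: "N (\<lambda>i. a i + b i) \<le> N a + N b" if a: "a \<in> tuples n" and b: "b \<in> tuples n" for a b
  proof -
    have ab: "(\<lambda>i. a i + b i) \<in> tuples n" using a b by (simp add: tuples_def)
    have le: "val (\<lambda>i. a i + b i) Zs \<le> val a Zs + val b Zs" for Zs
    proof -
      have "(\<Sum>i<length Zs. scal (a i + b i) (\<rho> (take (Suc i) Zs)))
          = (\<Sum>i<length Zs. scal (a i) (\<rho> (take (Suc i) Zs))) + (\<Sum>i<length Zs. scal (b i) (\<rho> (take (Suc i) Zs)))"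
        by (simp add: scale_left_distrib sum.distrib)
      then show ?thesis unfolding val_def by (simp add: norm_triangle_ineq)
    qed
    have bs: "\<bar>val a Zs + val b Zs\<bar> \<le> K a + K b" for Zs using bnd[OF a, of Zs] bnd[OF b, of Zs] by linarith
    have "N (\<lambda>i. a i + b i) \<le> iterated_limit (\<lambda>Zs. val a Zs + val b Zs) n []"
      unfolding N_def by (rule iterated_limit_mono[where V = V, OF bnd[OF ab] bs V0 Vs le])
    also have "\<dots> = N a + N b"
      unfolding N_def by (rule iterated_limit_add[of "val a" "K a" "val b" "K b", OF bnd[OF a] bnd[OF b]])
    finally show ?thesis .
  qed
  have val_append: "val b (Zs @ [Z]) = val b Zs" if "b \<in> tuples (length Zs)" for b Zs Z
  proof -
    have "(\<Sum>i<length Zs. scal (b i) (\<rho> (take (Suc i) (Zs @ [Z])))) = (\<Sum>i<length Zs. scal (b i) (\<rho> (take (Suc i) Zs)))"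
      by (rule sum.cong) auto
    moreover have "b (length Zs) = 0" using that by (simp add: tuples_def)
    ultimately show ?thesis by (simp add: val_def)
  qed
  have const: "iterated_limit (val b) r Zs = val b Zs" if "b \<in> tuples (length Zs)" for b r Zs
    using that
  proof (induction r arbitrary: Zs)
    case (Suc r)
    have "iterated_limit (val b) r (Zs @ [Z]) = val b Zs" for Z
    proof -
      have "b \<in> tuples (length (Zs @ [Z]))" using Suc.prems by (simp add: tuples_def)
      then show ?thesis using Suc.IH val_append[OF Suc.prems] by simp
    qed
    then show ?case using tendsto_Lim[OF proper, of "\<lambda>_. val b Zs" "val b Zs"] by simp
  qed simp
  have proj: "iterated_limit (val (restr {..<m} b)) r Zs \<le> iterated_limit (val b) r Zs"
    if b: "b \<in> tuples n" and "set Zs \<subseteq> B" "length Zs + r = n" "length Zs \<le> m" for b r Zs m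
    using that(2-)
  proof (induction r arbitrary: Zs m)
    case 0
    have "(\<Sum>i<length Zs. scal (restr {..<m} b i) (\<rho> (take (Suc i) Zs)))
        = (\<Sum>i<length Zs. scal (b i) (\<rho> (take (Suc i) Zs)))"
      by (rule sum.cong) (use 0 in \<open>auto simp: restr_def\<close>)
    then show ?case by (simp add: val_def)
  next
    case (Suc r)
    note lim = iterated_limit_bounded(2)[of "val b", OF bnd[OF b]]
    note lim' = iterated_limit_bounded(2)[of "val (restr {..<m} b)", OF bnd[OF restr_tuples[OF b]]]
    obtain Y0 where Y0: "Y0 \<in> B" using family_nonempty by blast
    show ?case
    proof (cases "length Zs < m")
      case True
      have "eventually (\<lambda>Z. iterated_limit (val (restr {..<m} b)) r (Zs @ [Z]) \<le> iterated_limit (val b) r (Zs @ [Z])) U"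
        by (rule evU[OF Y0], rule Suc.IH) (use True Suc.prems in auto)
      then show ?thesis by (rule tendsto_le[OF proper lim lim'])
    next
      case False
      then have m: "m = length Zs" using Suc.prems by simp
      have ct: "restr {..<m} b \<in> tuples (length Zs)" by (simp add: m restr_def tuples_def)
      have c: "iterated_limit (val (restr {..<m} b)) (Suc r) Zs = val (restr {..<m} b) Zs" by (rule const[OF ct])
      define f where "f = (\<Sum>i<length Zs. scal (b i) (\<rho> (take (Suc i) Zs)))"
      have f: "val (restr {..<m} b) Zs = norm f"
        unfolding val_def f_def m by (rule arg_cong[of _ _ norm], rule sum.cong) (auto simp: restr_def)
      define G where "G = span ((\<lambda>i. \<rho> (take (Suc i) Zs)) ` {..<length Zs})"
      have G: "subspace G" "fin_dim scal G"
        by (auto simp: G_def fin_dim_def intro!: exI[of _ "(\<lambda>i. \<rho> (take (Suc i) Zs)) ` {..<length Zs}"])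
      have fG: "f \<in> G"
        unfolding f_def G_def by (intro span_sum span_scale span_base) auto
      have eps: "norm f \<le> (1 + \<delta>) * iterated_limit (val b) (Suc r) Zs" if \<delta>: "0 < \<delta>" for \<delta>
      proof -
        obtain Y where Y: "Y \<in> B" "\<And>f z. f \<in> G \<Longrightarrow> z \<in> Y \<Longrightarrow> norm f \<le> (1 + \<delta>) * norm (f + z)"
          using separated[OF G \<delta>] by blast
        have "norm f \<le> (1 + \<delta>) * iterated_limit (val b) r (Zs @ [Z])" if Z: "Z \<in> B" "Z \<subseteq> Y" for Z
        proof -
          have ZB: "set (Zs @ [Z]) \<subseteq> B" using Z Suc.prems by simp
          have "\<rho> (Zs @ [Z]) = \<tau> (Zs @ [Z])" using ZB Suc.prems(2) by (simp add: \<rho>_def)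
          then have "\<rho> (Zs @ [Z]) \<in> Y" using \<tau>[of "Zs @ [Z]"] ZB Suc.prems(2) Z(2) by auto
          moreover have "subspace Y" by (rule subspace_member[OF Y(1)])
          ultimately have "scal (b m) (\<rho> (Zs @ [Z])) \<in> Y" by (simp add: subspace_scale)
          then have "norm f \<le> (1 + \<delta>) * norm (f + scal (b m) (\<rho> (Zs @ [Z])))" by (rule Y(2)[OF fG])
          also have "norm (f + scal (b m) (\<rho> (Zs @ [Z]))) = val (restr {..<Suc m} b) (Zs @ [Z])"
          proof -
            have "(\<Sum>i<length Zs. scal (restr {..<Suc m} b i) (\<rho> (take (Suc i) (Zs @ [Z])))) = f"
              unfolding f_def by (rule sum.cong) (auto simp: restr_def m)
            then show ?thesis by (simp add: val_def m restr_def)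
          qed
          also have "\<dots> = iterated_limit (val (restr {..<Suc m} b)) r (Zs @ [Z])"
            by (rule const[symmetric]) (simp add: restr_def tuples_def m)
          also have "\<dots> \<le> iterated_limit (val b) r (Zs @ [Z])"
            by (rule Suc.IH) (use ZB Suc.prems m in auto)
          finally show ?thesis using \<delta> by simp
        qed
        then have "eventually (\<lambda>Z. norm f \<le> (1 + \<delta>) * iterated_limit (val b) r (Zs @ [Z])) U" by (rule evU[OF Y(1)])
        then show ?thesis by (rule tendsto_lowerbound[OF tendsto_mult_left[OF lim] _ proper])
      qed
      have "norm f \<le> iterated_limit (val b) (Suc r) Zs + e" if "0 < e" for e
      proof -
        define I where "I = iterated_limit (val b) (Suc r) Zs"
        define \<delta> where "\<delta> = e / (\<bar>I\<bar> + 1)"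
        have \<delta>: "0 < \<delta>" using that by (simp add: \<delta>_def)
        have "norm f \<le> (1 + \<delta>) * I" unfolding I_def by (rule eps[OF \<delta>])
        moreover have "\<delta> * I \<le> \<delta> * (\<bar>I\<bar> + 1)" using \<delta> by (intro mult_left_mono) auto
        moreover have "\<delta> * (\<bar>I\<bar> + 1) = e" by (simp add: \<delta>_def)
        ultimately show ?thesis by (simp add: I_def distrib_right)
      qed
      then have "norm f \<le> iterated_limit (val b) (Suc r) Zs" by (rule field_le_epsilon)
      then show ?thesis using c f by simp
    qed
  qed
  have projN: "N (restr {..<m} b) \<le> N b" if "b \<in> tuples n" for b m
    unfolding N_def by (rule proj[OF that]) auto
  have val_play: "val b Zs = cn n (play \<tau> ((!) Zs)) b" if Zs: "set Zs \<subseteq> B" "length Zs = n" for b Zs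
  proof -
    have "\<rho> (take (Suc i) Zs) = play \<tau> ((!) Zs) i" if i: "i < n" for i
    proof -
      have "take (Suc i) Zs = map ((!) Zs) [0..<Suc i]" using i Zs(2) by (intro nth_equalityI) (simp_all del: upt_Suc)
      moreover have "set (take (Suc i) Zs) \<subseteq> B" using Zs(1) set_take_subset by fast
      moreover have "take (Suc i) Zs \<noteq> []" using i Zs(2) by auto
      ultimately show ?thesis using i by (simp add: \<rho>_def play_def)
    qed
    then have "(\<Sum>i<n. scal (b i) (\<rho> (take (Suc i) Zs))) = (\<Sum>i<n. scal (b i) (play \<tau> ((!) Zs) i))"
      by (intro sum.cong) auto
    then show ?thesis by (simp add: val_def coord_norm_def Zs(2))
  qed
  have unitN: "N (\<lambda>i. if i = j then 1 else 0) = 1" if j: "j < n" for j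
  proof -
    define e where "e = (\<lambda>i. if i = j then 1 else (0::'k))"
    have e: "e \<in> tuples n" using j by (simp add: e_def tuples_def)
    have one: "val e Zs = 1" if "V Zs" "length Zs = length [] + n" for Zs
    proof -
      have Zs: "set Zs \<subseteq> B" "length Zs = n" using that by (auto simp: V_def)
      have "(\<Sum>i<n. scal (e i) (\<rho> (take (Suc i) Zs))) = (\<Sum>i<n. if i = j then \<rho> (take (Suc j) Zs) else 0)"
        by (rule sum.cong) (auto simp: e_def)
      then have "val e Zs = norm (\<rho> (take (Suc j) Zs))" using j Zs(2) by (simp add: val_def)
      moreover have "set (take (Suc j) Zs) \<subseteq> B" using Zs(1) set_take_subset by fast
      moreover have "take (Suc j) Zs \<noteq> []" using j Zs(2) by auto
      ultimately show ?thesis using \<tau>[of "take (Suc j) Zs"] Zs(2) by (simp add: \<rho>_def)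
    qed
    have c1: "\<bar>(\<lambda>_. 1::real) zs\<bar> \<le> 1" for zs :: "'a set list" by simp
    have "N e \<le> iterated_limit (\<lambda>_. 1) n []"
      unfolding N_def by (rule iterated_limit_mono[where V = V, OF bnd[OF e] c1 V0 Vs]) (simp_all add: one)
    moreover have "iterated_limit (\<lambda>_. 1) n [] \<le> N e"
      unfolding N_def by (rule iterated_limit_mono[where V = V, OF c1 bnd[OF e] V0 Vs]) (simp_all add: one)
    ultimately show ?thesis by (simp add: iterated_limit_const e_def)
  qed
  have nonnegN: "0 \<le> N a" if a: "a \<in> tuples n" for a
  proof -
    have "restr {..<0} a = (\<lambda>i. 0 * a i)" by (simp add: restr_def)
    then have "N (restr {..<0} a) = 0" using scal_N[OF a, of 0] by simp
    then show ?thesis using projN[OF a, of 0] by simp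
  qed
  have coordN: "norm (a j) \<le> 2 * N a" if a: "a \<in> tuples n" and j: "j < n" for a j
  proof -
    define e where "e = (\<lambda>i. if i = j then 1 else (0::'k))"
    have e: "e \<in> tuples n" using j by (simp add: e_def tuples_def)
    have "(\<lambda>i. a j * e i) = (\<lambda>i. restr {..<Suc j} a i + (-1) * restr {..<j} a i)"
      by (auto simp: e_def restr_def fun_eq_iff less_Suc_eq)
    moreover have "(\<lambda>i. (-1) * restr {..<j} a i) \<in> tuples n" using a by (simp add: restr_def tuples_def)
    ultimately have "N (\<lambda>i. a j * e i) \<le> N (restr {..<Suc j} a) + N (\<lambda>i. (-1) * restr {..<j} a i)"
      using tri_N[OF restr_tuples[OF a], of "\<lambda>i. (-1) * restr {..<j} a i" "{..<Suc j}"] by simp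
    also have "N (\<lambda>i. (-1) * restr {..<j} a i) = N (restr {..<j} a)"
      using scal_N[OF restr_tuples[OF a], of "-1"] by simp
    finally have "norm (a j) * N e \<le> N (restr {..<Suc j} a) + N (restr {..<j} a)"
      using scal_N[OF e, of "a j"] by simp
    then show ?thesis using projN[OF a, of "Suc j"] projN[OF a, of j] unitN[OF j] by (simp add: e_def)
  qed
  have "is_norm n N"
    unfolding is_norm_def
  proof (intro conjI ballI allI impI)
    fix a :: "nat \<Rightarrow> 'k" assume a: "a \<in> tuples n" "N a = 0"
    have "a j = 0" for j using coordN[OF a(1), of j] a by (cases "j < n") (auto simp: tuples_def)
    then show "a = (\<lambda>_. 0)" by blast
  qed (use scal_N tri_N in auto)
  moreover have "basis_constant n N \<le> 2"
  proof (rule basis_constant_le_two)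
    fix a :: "nat \<Rightarrow> 'k" and m assume "a \<in> tuples n"
    then show "N (restr {..<m} a) \<le> 2 * N a" using projN[of a m] nonnegN[of a] by simp
  qed (rule nonnegN)
  ultimately have NB: "N \<in> based_spaces n" using unitN by (simp add: based_spaces_def)
  have "N \<in> asymptotic_spaces scal B n"
  proof (rule asymptotic_spacesI[OF NB])
    fix \<delta> :: real assume \<delta>: "0 < \<delta>"
    define \<kappa> where "\<kappa> = min \<delta> (1 / 4) / 8"
    have \<kappa>: "0 < \<kappa>" "\<kappa> \<le> 1 / 8" "8 * \<kappa> \<le> \<delta>" "8 * \<kappa> \<le> 1 / 4" using \<delta> by (auto simp: \<kappa>_def)
    define \<eta> where "\<eta> = \<kappa> / (3 * real (Suc n))"
    have \<eta>: "0 < \<eta>" "3 * real (Suc n) * \<eta> \<le> \<kappa>" using \<kappa>(1) by (simp_all add: \<eta>_def)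
    obtain D :: "(nat \<Rightarrow> 'k) set" where D: "finite D" "D \<subseteq> tuples n"
      "\<And>a. a \<in> tuples n \<Longrightarrow> (\<And>i. norm (a i) \<le> 1) \<Longrightarrow> \<exists>b\<in>D. \<forall>i. norm (a i - b i) \<le> \<eta>"
      using finite_net_tuples[OF \<eta>(1), of n] by blast
    define ok where "ok = (\<lambda>Zs Y Z. Z \<in> B \<and> Z \<subseteq> Y \<and> (\<forall>b\<in>D.
      \<bar>iterated_limit (val b) (n - Suc (length Zs)) (Zs @ [Z]) - iterated_limit (val b) (n - length Zs) Zs\<bar> < \<eta>))"
    have ok_ex: "\<exists>Z. ok Zs Y Z" if Zs: "length Zs < n" and Y: "Y \<in> B" for Zs Y
    proof -
      have "eventually (\<lambda>Z. \<forall>b\<in>D. \<bar>iterated_limit (val b) (n - Suc (length Zs)) (Zs @ [Z])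
          - iterated_limit (val b) (n - length Zs) Zs\<bar> < \<eta>) U"
        unfolding eventually_ball_finite_distrib[OF D(1)]
      proof
        fix b assume "b \<in> D"
        then have b: "b \<in> tuples n" using D(2) by blast
        have "n - length Zs = Suc (n - Suc (length Zs))" using Zs by simp
        then have "((\<lambda>Z. iterated_limit (val b) (n - Suc (length Zs)) (Zs @ [Z]))
            \<longlongrightarrow> iterated_limit (val b) (n - length Zs) Zs) U"
          using iterated_limit_bounded(2)[of "val b", OF bnd[OF b], of "n - Suc (length Zs)" Zs] by simp
        from tendstoD[OF this \<eta>(1)]
        show "eventually (\<lambda>Z. \<bar>iterated_limit (val b) (n - Suc (length Zs)) (Zs @ [Z])
            - iterated_limit (val b) (n - length Zs) Zs\<bar> < \<eta>) U" by (simp add: dist_real_def)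
      qed
      moreover have "eventually (\<lambda>Z. Z \<in> B \<and> Z \<subseteq> Y) U" by (rule evU[OF Y]) simp
      ultimately have "eventually (ok Zs Y) U" unfolding ok_def by (simp add: eventually_conj_iff)
      then show ?thesis using eventually_happens[of "ok Zs Y" U] proper by blast
    qed
    define pick where "pick = (\<lambda>Zs Y. SOME Z. ok Zs Y Z)"
    have pick: "ok Zs Y (pick Zs Y)" if "length Zs < n" "Y \<in> B" for Zs Y
      unfolding pick_def by (rule someI_ex[OF ok_ex[OF that]])
    define zs where "zs = foldl (\<lambda>Zs Y. Zs @ [pick Zs Y]) []"
    define \<sigma> where "\<sigma> = (\<lambda>Ys. \<tau> (zs Ys))"
    have "good n \<delta> N Y (play \<sigma> Y)" if Y: "\<forall>k<n. Y k \<in> B" for Y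
    proof -
      define W where "W = (\<lambda>k. zs (map Y [0..<k]))"
      have W0: "W 0 = []" by (simp add: W_def zs_def)
      have WS: "W (Suc k) = W k @ [pick (W k) (Y k)]" for k by (simp add: W_def zs_def)
      have lenW: "length (W k) = k" for k by (induction k) (simp_all add: W0 WS)
      have takeW: "take i (W k) = W i" if "i \<le> k" for i k
        using that
      proof (induction k)
        case (Suc k)
        then show ?case by (cases "i = Suc k") (simp_all add: lenW WS)
      qed (simp add: W0)
      have okW: "ok (W k) (Y k) (pick (W k) (Y k))" if "k < n" for k
        by (rule pick) (use that Y lenW in auto)
      have setW: "set (W k) \<subseteq> B" if "k \<le> n" for k
        using that
      proof (induction k)
        case (Suc k)
        then show ?case using okW[of k] by (simp add: WS ok_def)
      qed (simp add: W0)
      have closeW: "\<bar>iterated_limit (val b) (n - k) (W k) - N b\<bar> \<le> real k * \<eta>" if b: "b \<in> D" and "k \<le> n" for b k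
        using that(2)
      proof (induction k)
        case 0
        then show ?case by (simp add: W0 N_def)
      next
        case (Suc k)
        have "\<bar>iterated_limit (val b) (n - Suc k) (W (Suc k)) - iterated_limit (val b) (n - k) (W k)\<bar> < \<eta>"
          using okW[of k] Suc.prems b unfolding ok_def lenW WS by simp
        then show ?case using Suc by (simp add: distrib_right)
      qed
      define x where "x = play \<sigma> Y"
      have xW: "x k = \<tau> (W (Suc k))" for k by (simp add: x_def play_def \<sigma>_def W_def)
      have xk: "x k \<in> Y k \<and> norm (x k) = 1" if k: "k < n" for k
      proof -
        have "\<tau> (W (Suc k)) \<in> last (W (Suc k)) \<and> norm (\<tau> (W (Suc k))) = 1"
          by (rule \<tau>) (use k setW[of "Suc k"] lenW in \<open>auto simp: WS\<close>)
        moreover have "last (W (Suc k)) \<subseteq> Y k" using okW[OF k] by (simp add: WS ok_def)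
        ultimately show ?thesis unfolding xW by blast
      qed
      have pW: "val b (W n) = cn n x b" for b
      proof -
        have "\<rho> (take (Suc i) (W n)) = x i" if i: "i < n" for i
        proof -
          have "take (Suc i) (W n) = W (Suc i)" by (rule takeW) (use i in simp)
          moreover have "set (W (Suc i)) \<subseteq> B" by (rule setW) (use i in simp)
          ultimately show ?thesis using i lenW[of "Suc i"] by (auto simp: \<rho>_def xW)
        qed
        then have "(\<Sum>i<n. scal (b i) (\<rho> (take (Suc i) (W n)))) = (\<Sum>i<n. scal (b i) (x i))"
          by (intro sum.cong) auto
        then show ?thesis by (simp add: val_def coord_norm_def lenW)
      qed
      have close: "\<bar>cn n x b - N b\<bar> \<le> real n * \<eta>" if "b \<in> D" for b
        using closeW[OF that, of n] by (simp add: pW)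
      have lip: "\<bar>cn n x a - cn n x b\<bar> \<le> (\<Sum>i<n. norm (a i - b i))" for a b
        by (rule cn_lipschitz) (use xk in simp)
      have cmp: "cn n x a \<le> (1 + 8 * \<kappa>) * N a" "N a \<le> (1 + 8 * \<kappa>) * cn n x a" if "a \<in> tuples n" for a
        using close_on_net[OF NB \<kappa>(1,2) \<eta> D(2,3) cn_scale lip close that] by simp_all
      have "N a \<le> (1 + \<delta>) * cn n x a \<and> cn n x a \<le> (1 + \<delta>) * N a" if a: "a \<in> tuples n" for a
      proof -
        have "(1 + 8 * \<kappa>) * cn n x a \<le> (1 + \<delta>) * cn n x a" "(1 + 8 * \<kappa>) * N a \<le> (1 + \<delta>) * N a"
          using \<kappa>(3) cn_nonneg[of n x a] nonnegN[OF a] by (intro mult_right_mono; simp)+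
        then show ?thesis using cmp[OF a] by linarith
      qed
      moreover have "cn n x (restr {..<m} a) \<le> 2 * cn n x a" if a: "a \<in> tuples n" for a m
      proof -
        have "cn n x (restr {..<m} a) \<le> (1 + 8 * \<kappa>) * N (restr {..<m} a)" by (rule cmp(1)[OF restr_tuples[OF a]])
        also have "\<dots> \<le> (1 + 8 * \<kappa>) * ((1 + 8 * \<kappa>) * cn n x a)"
          using projN[OF a, of m] cmp(2)[OF a] \<kappa>(1) by (intro mult_left_mono) auto
        also have "\<dots> \<le> (5 / 4) * ((5 / 4) * cn n x a)"
          using \<kappa> cn_nonneg[of n x a] by (intro mult_mono mult_right_mono mult_nonneg_nonneg) auto
        also have "\<dots> \<le> 2 * cn n x a" using cn_nonneg[of n x a] by simp
        finally show ?thesis .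
      qed
      ultimately show ?thesis unfolding good_def x_def[symmetric] using xk by blast
    qed
    then show "\<exists>\<sigma>. \<forall>Y. (\<forall>k<n. Y k \<in> B) \<longrightarrow> good n \<delta> N Y (play \<sigma> Y)" by blast
  qed
  moreover have "N b \<le> s" if b: "b \<in> tuples n" and s: "\<forall>Y. (\<forall>k<n. Y k \<in> B) \<longrightarrow> cn n (play \<tau> Y) b \<le> s" for b s
  proof -
    have le: "val b Zs \<le> s" if "V Zs" "length Zs = length [] + n" for Zs
    proof -
      have Zs: "set Zs \<subseteq> B" "length Zs = n" using that by (auto simp: V_def)
      then have "\<forall>k<n. Zs ! k \<in> B" using nth_mem by blast
      then show ?thesis using s val_play[OF Zs] by simp
    qed
    have cs: "\<bar>(\<lambda>_. s) zs\<bar> \<le> \<bar>s\<bar>" for zs :: "'a set list" by simp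
    have "N b \<le> iterated_limit (\<lambda>_. s) n []"
      unfolding N_def by (rule iterated_limit_mono[where V = V, OF bnd[OF b] cs V0 Vs]) (simp_all add: le)
    then show ?thesis by (simp add: iterated_limit_const)
  qed
  ultimately show ?thesis by blast
qed

end

section \<open>Closure properties of the asymptotic spaces\<close>

context asymptotic_game
begin

lemma asymptotic_spaces_nonempty: "asymptotic_spaces scal B n \<noteq> {}"
proof -
  define \<tau> where "\<tau> = (\<lambda>Zs :: 'a set list. SOME z. z \<in> last Zs \<and> norm z = 1)"
  have "\<tau> Zs \<in> last Zs \<and> norm (\<tau> Zs) = 1" if "Zs \<noteq> []" "set Zs \<subseteq> B" for Zs
  proof -
    have "last Zs \<in> B" using that last_in_set by blast
    then obtain z where "z \<in> last Zs" "norm z = 1" using unit_vector by blast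
    then show ?thesis unfolding \<tau>_def by (intro someI_ex[of "\<lambda>z. z \<in> last Zs \<and> norm z = 1"]) blast
  qed
  then show ?thesis using tree_limit[of n \<tau>] by blast
qed

text \<open>
  In the tree, the move at position \<open>j * T + k\<close> is the \<open>j\<close>-th move of the \<open>k\<close>-th of \<open>T\<close> independent
  games for \<open>N\<close>, each of which sees only the moves of the subspace player at its own positions.
\<close>
lemma asymptotic_spaces_parallel:
  assumes N: "N \<in> asymptotic_spaces scal B n" and c: "c \<in> tuples n" and d: "d \<in> tuples T" and \<delta>: "0 < \<delta>"
  shows "\<exists>M\<in>asymptotic_spaces scal B (n * T).
    M (\<lambda>i. c (i div T) * d (i mod T)) \<le> (\<Sum>k<T. norm (d k)) * N c + \<delta>"
proof -
  define S where "S = (\<Sum>k<T. norm (d k))"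
  have Nb: "N \<in> based_spaces n" using N by (simp add: asymptotic_spaces_def)
  have S: "0 \<le> S * N c" using based.nonneg[OF Nb c] by (simp add: S_def sum_nonneg)
  define \<delta>' where "\<delta>' = \<delta> / (S * N c + 1)"
  have \<delta>': "0 < \<delta>'" using S \<delta> by (simp add: \<delta>'_def)
  obtain \<sigma> where \<sigma>: "\<And>Y. (\<And>k. k < n \<Longrightarrow> Y k \<in> B) \<Longrightarrow> good n \<delta>' N Y (play \<sigma> Y)"
    using asymptotic_spacesD[OF N \<delta>'] by blast
  define \<tau> where "\<tau> = (\<lambda>Ys :: 'a set list. let i = length Ys - 1 in
    \<sigma> (map (\<lambda>l. Ys ! (l * T + i mod T)) [0..<Suc (i div T)]))"
  obtain B0 where B0: "B0 \<in> B" using family_nonempty by blast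
  have lt: "l * T + k < n * T" if "l < n" "k < T" for l k
  proof -
    have "l * T + k < Suc l * T" using that by simp
    also have "\<dots> \<le> n * T" using that by (intro mult_le_mono1) simp
    finally show ?thesis .
  qed
  have tree: "\<tau> Ys \<in> last Ys \<and> norm (\<tau> Ys) = 1" if Ys: "Ys \<noteq> []" "set Ys \<subseteq> B" "length Ys \<le> n * T" for Ys
  proof -
    define i where "i = length Ys - 1"
    have "0 < length Ys" using Ys(1) by simp
    then have i: "i < length Ys" "i < n * T" using Ys(3) unfolding i_def by linarith+
    have T: "0 < T" using i(2) by (cases T) auto
    define Y where "Y = (\<lambda>l. if l * T + i mod T < length Ys then Ys ! (l * T + i mod T) else B0)"
    have "Y l \<in> B" for l using Ys(2) B0 nth_mem by (auto simp: Y_def)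
    then have g: "good n \<delta>' N Y (play \<sigma> Y)" by (rule \<sigma>)
    have below: "l * T + i mod T < length Ys" if "l \<le> i div T" for l
    proof -
      have "l * T \<le> i div T * T" using that by (rule mult_le_mono1)
      then have "l * T + i mod T \<le> i" using div_mult_mod_eq[of i T] by linarith
      then show ?thesis using i(1) by simp
    qed
    have "map (\<lambda>l. Ys ! (l * T + i mod T)) [0..<Suc (i div T)] = map Y [0..<Suc (i div T)]"
      by (rule map_cong) (use below in \<open>simp_all add: Y_def less_Suc_eq_le del: upt_Suc\<close>)
    then have "\<tau> Ys = play \<sigma> Y (i div T)" by (simp only: \<tau>_def Let_def i_def[symmetric] play_def)
    moreover have "i div T < n" using i(2) T by (simp add: div_less_iff_less_mult)
    moreover have "Y (i div T) = last Ys" using Ys(1) i(1) by (simp add: Y_def last_conv_nth i_def)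
    ultimately show ?thesis using g by (auto simp: good_def)
  qed
  obtain M where M: "M \<in> asymptotic_spaces scal B (n * T)"
    and Mle: "\<And>b s. b \<in> tuples (n * T) \<Longrightarrow>
      (\<And>Y. (\<And>k. k < n * T \<Longrightarrow> Y k \<in> B) \<Longrightarrow> cn (n * T) (play \<tau> Y) b \<le> s) \<Longrightarrow> M b \<le> s"
    using tree_limit[of "n * T" \<tau>, OF tree] by blast
  define x where "x = (\<lambda>i. c (i div T) * d (i mod T))"
  have x: "x \<in> tuples (n * T)"
    unfolding tuples_def
  proof (intro CollectI allI impI)
    fix i assume i: "n * T \<le> i"
    show "x i = 0"
    proof (cases "T = 0")
      case True
      then show ?thesis using d by (simp add: x_def tuples_def)
    next
      case False
      then have "n \<le> i div T" using i by (simp add: less_eq_div_iff_mult_less_eq)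
      then show ?thesis using c by (simp add: x_def tuples_def)
    qed
  qed
  have "M x \<le> S * N c + \<delta>"
  proof (rule Mle[OF x])
    fix Y assume Y: "\<And>k. k < n * T \<Longrightarrow> Y k \<in> B"
    define z where "z = (\<lambda>k. play \<sigma> (\<lambda>l. Y (l * T + k)))"
    have zc: "cn n (z k) c \<le> (1 + \<delta>') * N c" if "k < T" for k
    proof -
      have "good n \<delta>' N (\<lambda>l. Y (l * T + k)) (z k)"
        unfolding z_def by (rule \<sigma>) (rule Y[OF lt[OF _ that]])
      then show ?thesis using c by (simp add: good_def)
    qed
    have y: "play \<tau> Y (j * T + k) = z k j" if k: "k < T" for j k
    proof -
      define i where "i = j * T + k"
      have i: "i div T = j" "i mod T = k" using k by (simp_all add: i_def)
      have hist: "map (\<lambda>l. map Y [0..<Suc i] ! (l * T + k)) [0..<Suc j] = map (\<lambda>l. Y (l * T + k)) [0..<Suc j]"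
      proof (rule map_cong[OF refl])
        fix l assume "l \<in> set [0..<Suc j]"
        then have "l * T \<le> j * T" by (intro mult_le_mono1) auto
        then have "l * T + k < Suc i" unfolding i_def by linarith
        then show "map Y [0..<Suc i] ! (l * T + k) = Y (l * T + k)" by (simp del: upt_Suc)
      qed
      have len: "length (map Y [0..<Suc i]) - 1 = i" by simp
      have "play \<tau> Y i = z k j"
        unfolding play_def z_def \<tau>_def Let_def len i hist ..
      then show ?thesis by (simp add: i_def)
    qed
    have "(\<Sum>i<n * T. scal (x i) (play \<tau> Y i)) = (\<Sum>j<n. \<Sum>i\<in>{j * T..<j * T + T}. scal (x i) (play \<tau> Y i))"
      by (rule sum.nat_group[symmetric])
    also have "\<dots> = (\<Sum>j<n. \<Sum>k<T. scal (c j * d k) (z k j))"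
    proof (rule sum.cong[OF refl])
      fix j
      have "(\<Sum>i\<in>{j * T..<j * T + T}. scal (x i) (play \<tau> Y i)) = (\<Sum>k<T. scal (x (j * T + k)) (play \<tau> Y (j * T + k)))"
        using sum.atLeastLessThan_shift_0[of "\<lambda>i. scal (x i) (play \<tau> Y i)" "j * T" "j * T + T"]
        by (simp add: lessThan_atLeast0)
      also have "\<dots> = (\<Sum>k<T. scal (c j * d k) (z k j))"
        by (rule sum.cong) (simp_all add: y x_def)
      finally show "(\<Sum>i\<in>{j * T..<j * T + T}. scal (x i) (play \<tau> Y i)) = (\<Sum>k<T. scal (c j * d k) (z k j))" .
    qed
    also have "\<dots> = (\<Sum>k<T. \<Sum>j<n. scal (c j * d k) (z k j))" by (rule sum.swap)
    also have "\<dots> = (\<Sum>k<T. scal (d k) (\<Sum>j<n. scal (c j) (z k j)))"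
      by (simp add: scale_sum_right mult.commute)
    finally have "cn (n * T) (play \<tau> Y) x = norm (\<Sum>k<T. scal (d k) (\<Sum>j<n. scal (c j) (z k j)))"
      by (simp add: coord_norm_def)
    also have "\<dots> \<le> (\<Sum>k<T. norm (d k) * ((1 + \<delta>') * N c))"
    proof (rule sum_norm_le)
      fix k assume "k \<in> {..<T}"
      then show "norm (scal (d k) (\<Sum>j<n. scal (c j) (z k j))) \<le> norm (d k) * ((1 + \<delta>') * N c)"
        using zc[of k] by (simp add: norm_scal coord_norm_def mult_left_mono)
    qed
    also have "\<dots> = S * ((1 + \<delta>') * N c)" by (simp add: S_def sum_distrib_right)
    also have "\<dots> = S * N c + \<delta>' * (S * N c)" by (simp add: algebra_simps)
    also have "\<delta>' * (S * N c) \<le> \<delta>' * (S * N c + 1)" using \<delta>' by (intro mult_left_mono) auto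
    also have "\<delta>' * (S * N c + 1) = \<delta>" using S by (simp add: \<delta>'_def)
    finally show "cn (n * T) (play \<tau> Y) x \<le> S * N c + \<delta>" by simp
  qed
  then show ?thesis using M unfolding x_def S_def by blast
qed

text \<open>
  While the subspace player makes one move \<open>Y j\<close> in the game for the blocks, the vector player runs the
  game for \<open>N\<close> through all positions of the \<open>j\<close>-th block with \<open>Y j\<close> as the answer each time, and plays the
  normalized combination of the vectors obtained.
\<close>
lemma asymptotic_spaces_block:
  assumes N: "N \<in> asymptotic_spaces scal B n" and u: "u \<in> tuples n"
    and t: "\<forall>j<k. t j < t (Suc j)" "t k \<le> n"
    and unit: "\<forall>j<k. N (restr {t j..<t (Suc j)} u) = 1"
  shows "(\<lambda>b. N (\<lambda>i. \<Sum>j<k. b j * restr {t j..<t (Suc j)} u i)) \<in> asymptotic_spaces scal B k"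
proof -
  have Nb: "N \<in> based_spaces n" using N by (simp add: asymptotic_spaces_def)
  define A where "A = (\<lambda>j. restr {t j..<t (Suc j)} u)"
  define ex where "ex = (\<lambda>(b :: nat \<Rightarrow> 'k) i. \<Sum>j<k. b j * A j i)"
  define M where "M = (\<lambda>b. N (ex b))"
  have A: "A j \<in> tuples n" for j unfolding A_def by (rule restr_tuples[OF u])
  have ex: "ex b \<in> tuples n" for b using A by (simp add: ex_def tuples_def)
  have inside: "ex b i = b j * u i" if "j < k" "i \<in> {t j..<t (Suc j)}" for b i j
    unfolding ex_def A_def by (rule sum_delta_blocks[OF t(1) that])
  have ex_linear: "ex (\<lambda>j. c * b j) = (\<lambda>i. c * ex b i)" "ex (\<lambda>j. b j + b' j) = (\<lambda>i. ex b i + ex b' i)" for b b' c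
    by (simp_all add: ex_def sum_distrib_left mult.assoc distrib_right sum.distrib)
  have initial_ex: "restr {..<t m} (ex b) = ex (restr {..<m} b)" if m: "m \<le> k" for b m
  proof
    fix i
    have "restr {..<t m} (ex b) i = (\<Sum>j<k. if i < t m then b j * A j i else 0)"
      by (simp add: restr_def ex_def)
    also have "\<dots> = ex (restr {..<m} b) i"
      unfolding ex_def
    proof (rule sum.cong[OF refl])
      fix j assume "j \<in> {..<k}"
      then have j: "j < k" by simp
      show "(if i < t m then b j * A j i else 0) = restr {..<m} b j * A j i"
      proof (cases "i \<in> {t j..<t (Suc j)}")
        case True
        have "i < t m \<longleftrightarrow> j < m"
        proof
          assume "i < t m"
          then show "j < m" using blocks_strict[OF t(1), of m j] j True by (cases "m < j"; cases "m = j") auto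
        next
          assume "j < m"
          then have "t (Suc j) \<le> t m" using blocks_strict[OF t(1), of "Suc j" m] m by (cases "Suc j = m") auto
          then show "i < t m" using True by simp
        qed
        then show ?thesis by (simp add: restr_def)
      next
        case False
        then have "A j i = 0" unfolding A_def by (rule restr_out)
        then show ?thesis by simp
      qed
    qed
    finally show "restr {..<t m} (ex b) i = ex (restr {..<m} b) i" .
  qed
  have "is_norm k M"
    unfolding is_norm_def
  proof (intro conjI ballI allI impI)
    fix b :: "nat \<Rightarrow> 'k" assume b: "b \<in> tuples k" "M b = 0"
    have z: "ex b = (\<lambda>_. 0)" using b(2) based.zero_iff[OF Nb ex] by (simp add: M_def)
    have "b j = 0" for j
    proof (cases "j < k")
      case True
      have "N (A j) = 1" using unit True by (simp add: A_def)
      then have "A j \<noteq> (\<lambda>_. 0)" using based.zero[OF Nb] by auto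
      then obtain i where i: "A j i \<noteq> 0" by blast
      have mem: "i \<in> {t j..<t (Suc j)}"
      proof (rule ccontr)
        assume "i \<notin> {t j..<t (Suc j)}"
        then have "A j i = 0" unfolding A_def by (rule restr_out)
        then show False using i by simp
      qed
      then have "A j i = u i" unfolding A_def by (rule restr_in)
      then have "u i \<noteq> 0" using i by simp
      moreover have "b j * u i = 0" using inside[OF True mem, of b] z by simp
      ultimately show ?thesis by simp
    qed (use b(1) in \<open>simp add: tuples_def\<close>)
    then show "b = (\<lambda>_. 0)" by blast
  next
    fix b :: "nat \<Rightarrow> 'k" and c
    show "M (\<lambda>i. c * b i) = norm c * M b"
      unfolding M_def ex_linear by (rule based.scale[OF Nb ex])
  next
    fix b b' :: "nat \<Rightarrow> 'k"
    show "M (\<lambda>i. b i + b' i) \<le> M b + M b'"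
      unfolding M_def ex_linear by (rule based.triangle[OF Nb ex ex])
  qed
  moreover have "M (\<lambda>i. if i = j then 1 else 0) = 1" if j: "j < k" for j
  proof -
    have "ex (\<lambda>i. if i = j then 1 else 0) = A j"
    proof
      fix i
      have "ex (\<lambda>i. if i = j then 1 else 0) i = (\<Sum>l<k. if l = j then A j i else 0)"
        unfolding ex_def by (rule sum.cong) auto
      then show "ex (\<lambda>i. if i = j then 1 else 0) i = A j i" using j by simp
    qed
    then show ?thesis using unit j by (simp add: M_def A_def)
  qed
  moreover have "basis_constant k M \<le> 2"
  proof (rule basis_constant_le_two)
    fix b :: "nat \<Rightarrow> 'k" and m assume m: "m \<le> k"
    show "M (restr {..<m} b) \<le> 2 * M b"
      unfolding M_def initial_ex[OF m, symmetric] by (rule based.initial[OF Nb ex])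
  qed (simp add: M_def based.nonneg[OF Nb ex])
  ultimately have Mb: "M \<in> based_spaces k" by (simp add: based_spaces_def)
  have "M \<in> asymptotic_spaces scal B k"
  proof (cases "k = 0")
    case True
    have "b = (\<lambda>_. 0)" if "b \<in> tuples 0" for b :: "nat \<Rightarrow> 'k" using that by (auto simp: tuples_def)
    then have "M b = 0" if "b \<in> tuples 0" for b using based.zero[OF Mb] that by auto
    then have "good k \<delta> M Y x" for \<delta> Y x using True by (simp add: good_def coord_norm_def)
    then show ?thesis by (intro asymptotic_spacesI[OF Mb]) blast
  next
    case False
    show ?thesis
    proof (rule asymptotic_spacesI[OF Mb])
      fix \<delta> :: real assume \<delta>: "0 < \<delta>"
      define c where "c = min \<delta> 1 / 32"
      have c: "0 < c" "c \<le> 1 / 32" "32 * c \<le> \<delta>" using \<delta> by (auto simp: c_def)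
      define \<delta>' where "\<delta>' = c / real k"
      have k1: "1 \<le> real k" using False by simp
      have \<delta>': "0 < \<delta>'" "\<delta>' \<le> c" "real k * \<delta>' = c"
      proof -
        show "0 < \<delta>'" using c k1 by (simp add: \<delta>'_def)
        show "real k * \<delta>' = c" using k1 by (simp add: \<delta>'_def)
        have "c * 1 \<le> c * real k" using c k1 by (intro mult_left_mono) auto
        then show "\<delta>' \<le> c" using k1 by (simp add: \<delta>'_def pos_divide_le_eq)
      qed
      obtain \<sigma> where \<sigma>: "\<And>Y. (\<And>k. k < n \<Longrightarrow> Y k \<in> B) \<Longrightarrow> good n \<delta>' N Y (play \<sigma> Y)"
        using asymptotic_spacesD[OF N \<delta>'(1)] by blast
      \<comment> \<open>The index of the block that contains position \<open>i\<close>; positions before the first block belong to the first move and positions after the last block to the last one.\<close>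
      define blk where "blk = (\<lambda>i. card {l \<in> {1..<k}. t l \<le> i})"
      have blk_lt: "blk i < k" for i
      proof -
        have "blk i \<le> card {1..<k}" unfolding blk_def by (rule card_mono) auto
        then show ?thesis using False by simp
      qed
      have tmono: "t i \<le> t j" if "i \<le> j" "j \<le> k" for i j
        using blocks_strict[OF t(1), of i j] that by (cases "i = j") auto
      have blk_le: "blk i \<le> j" if "i < t (Suc j)" "j < k" for i j
      proof -
        have "{l \<in> {1..<k}. t l \<le> i} \<subseteq> {1..j}"
        proof
          fix l assume l: "l \<in> {l \<in> {1..<k}. t l \<le> i}"
          show "l \<in> {1..j}"
          proof (rule ccontr)
            assume "l \<notin> {1..j}"
            then have "Suc j \<le> l" using l by auto
            then have "t (Suc j) \<le> t l" using l by (intro tmono) auto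
            then show False using l that by simp
          qed
        qed
        then have "blk i \<le> card {1..j}" unfolding blk_def by (intro card_mono) auto
        then show ?thesis by simp
      qed
      have blk_eq: "blk i = j" if j: "j < k" and i: "i \<in> {t j..<t (Suc j)}" for i j
      proof -
        have "{1..j} \<subseteq> {l \<in> {1..<k}. t l \<le> i}"
        proof
          fix l assume l: "l \<in> {1..j}"
          then have "t l \<le> t j" using j by (intro tmono) auto
          then show "l \<in> {l \<in> {1..<k}. t l \<le> i}" using l i j by auto
        qed
        then have "card {1..j} \<le> blk i" unfolding blk_def by (intro card_mono) auto
        then show ?thesis using blk_le[of i j] i j by simp
      qed
      define w where "w = (\<lambda>Ys :: 'a set list. \<Sum>i\<in>{t (length Ys - 1)..<t (length Ys)}.
        scal (u i) (\<sigma> (map (\<lambda>l. Ys ! blk l) [0..<Suc i])))"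
      define \<sigma>' where "\<sigma>' = (\<lambda>Ys. scal (of_real (1 / norm (w Ys))) (w Ys))"
      have "good k \<delta> M Y (play \<sigma>' Y)" if Y: "\<forall>j<k. Y j \<in> B" for Y
      proof -
        define x where "x = play \<sigma> (\<lambda>i. Y (blk i))"
        have g: "good n \<delta>' N (\<lambda>i. Y (blk i)) x" unfolding x_def by (rule \<sigma>) (use Y blk_lt in blast)
        define v where "v = (\<lambda>j. \<Sum>i\<in>{t j..<t (Suc j)}. scal (u i) (x i))"
        have wv: "w (map Y [0..<Suc j]) = v j" if j: "j < k" for j
        proof -
          have hist: "map (\<lambda>l. map Y [0..<Suc j] ! blk l) [0..<Suc i] = map (\<lambda>l. Y (blk l)) [0..<Suc i]"
            if i: "i \<in> {t j..<t (Suc j)}" for i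
          proof (rule map_cong[OF refl])
            fix l assume "l \<in> set [0..<Suc i]"
            then have "l < t (Suc j)" using i by auto
            then have "blk l < Suc j" using blk_le[of l j] j by simp
            then show "map Y [0..<Suc j] ! blk l = Y (blk l)" by (simp del: upt_Suc)
          qed
          have len: "length (map Y [0..<Suc j]) = Suc j" by simp
          show ?thesis
            unfolding w_def v_def x_def play_def len diff_Suc_1
          proof (rule sum.cong[OF refl])
            fix i assume "i \<in> {t j..<t (Suc j)}"
            then show "scal (u i) (\<sigma> (map (\<lambda>l. map Y [0..<Suc j] ! blk l) [0..<Suc i]))
                = scal (u i) (\<sigma> (map (\<lambda>l. Y (blk l)) [0..<Suc i]))" by (simp only: hist)
          qed
        qed
        define y where "y = play \<sigma>' Y"
        have y: "y j = scal (of_real (1 / norm (v j))) (v j)" if "j < k" for j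
          using wv[OF that] by (simp add: y_def play_def \<sigma>'_def del: upt_Suc)
        have vA: "(\<Sum>i<n. scal (A j i) (x i)) = v j" if j: "j < k" for j
        proof -
          have sub: "{t j..<t (Suc j)} \<subseteq> {..<n}" using tmono[of "Suc j" k] j t(2) by auto
          have "(\<Sum>i<n. scal (A j i) (x i)) = (\<Sum>i\<in>{t j..<t (Suc j)}. scal (A j i) (x i))"
            by (rule sum.mono_neutral_right) (use sub in \<open>auto simp: A_def restr_def\<close>)
          also have "\<dots> = v j" unfolding v_def by (rule sum.cong) (simp_all add: A_def restr_def)
          finally show ?thesis .
        qed
        have expand: "(\<Sum>i<n. scal (ex b i) (x i)) = (\<Sum>j<k. scal (b j) (v j))" for b
        proof -
          have "(\<Sum>i<n. scal (ex b i) (x i)) = (\<Sum>i<n. \<Sum>j<k. scal (b j) (scal (A j i) (x i)))"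
            by (simp add: ex_def scale_sum_left)
          also have "\<dots> = (\<Sum>j<k. \<Sum>i<n. scal (b j) (scal (A j i) (x i)))" by (rule sum.swap)
          also have "\<dots> = (\<Sum>j<k. scal (b j) (v j))"
          proof (rule sum.cong[OF refl])
            fix j assume "j \<in> {..<k}"
            then have "(\<Sum>i<n. scal (A j i) (x i)) = v j" using vA by simp
            then show "(\<Sum>i<n. scal (b j) (scal (A j i) (x i))) = scal (b j) (v j)"
              unfolding scale_sum_right[symmetric] by simp
          qed
          finally show ?thesis .
        qed
        have gN: "N a \<le> (1 + \<delta>') * cn n x a" "cn n x a \<le> (1 + \<delta>') * N a"
          "cn n x (restr {..<m} a) \<le> 2 * cn n x a" if "a \<in> tuples n" for a m
          using g that by (simp_all add: good_def)
        have nv: "1 \<le> (1 + \<delta>') * norm (v j)" "norm (v j) \<le> 1 + \<delta>'" if j: "j < k" for j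
          using gN(1,2)[OF A, of j] unit j vA[OF j] by (simp_all add: coord_norm_def A_def)
        have v0: "0 < norm (v j)" if j: "j < k" for j
        proof (rule ccontr)
          assume "\<not> 0 < norm (v j)"
          then have "norm (v j) = 0" by simp
          then show False using nv(1)[OF j] by simp
        qed
        have inv: "\<bar>1 / norm (v j) - 1\<bar> \<le> \<delta>'" if j: "j < k" for j
        proof -
          have "1 / norm (v j) \<le> 1 + \<delta>'" using nv(1)[OF j] v0[OF j] by (simp add: pos_divide_le_eq)
          moreover have "1 - \<delta>' \<le> 1 / norm (v j)"
          proof -
            have "(1 - \<delta>') * norm (v j) \<le> (1 - \<delta>') * (1 + \<delta>')"
              using nv(2)[OF j] \<delta>'(2) c(2) by (intro mult_left_mono) auto
            also have "\<dots> \<le> 1" by (simp add: algebra_simps)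
            finally show ?thesis using v0[OF j] by (simp add: pos_le_divide_eq)
          qed
          ultimately show ?thesis by linarith
        qed
        define resc where "resc = (\<lambda>(b :: nat \<Rightarrow> 'k) j. if j < k then b j * of_real (1 / norm (v j)) else 0)"
        have resc: "resc b \<in> tuples k" for b by (simp add: resc_def tuples_def)
        have cy: "cn k y b = cn n x (ex (resc b))" for b
        proof -
          have "(\<Sum>j<k. scal (b j) (y j)) = (\<Sum>j<k. scal (resc b j) (v j))"
            by (rule sum.cong) (simp_all add: y resc_def)
          then show ?thesis unfolding coord_norm_def expand by simp
        qed
        have Mclose: "M (resc b) \<le> (1 + 4 * c) * M b" "M b \<le> M (resc b) + 4 * c * M b" if b: "b \<in> tuples k" for b
        proof -
          have diff: "norm (resc b j - b j) \<le> 4 * \<delta>' * M b" if j: "j < k" for j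
          proof -
            have "resc b j - b j = b j * of_real (1 / norm (v j) - 1)"
              using j by (simp add: resc_def algebra_simps)
            then have "norm (resc b j - b j) = norm (b j) * \<bar>1 / norm (v j) - 1\<bar>"
              by (simp only: norm_mult norm_of_real)
            also have "\<dots> \<le> (4 * M b) * \<delta>'"
              using based.coordinate[OF Mb b, of j] inv[OF j] based.nonneg[OF Mb b] by (intro mult_mono) auto
            finally show ?thesis by (simp add: mult_ac)
          qed
          have total: "(\<Sum>j<k. 4 * \<delta>' * M b) = 4 * c * M b"
          proof -
            have "(\<Sum>j<k. 4 * \<delta>' * M b) = 4 * (real k * \<delta>') * M b" by simp
            then show ?thesis using \<delta>'(3) by simp
          qed
          have t1: "(\<lambda>j. resc b j - b j) \<in> tuples k" "(\<lambda>j. b j - resc b j) \<in> tuples k"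
            using b resc[of b] by (simp_all add: tuples_def)
          have s: "(\<Sum>j<k. norm (resc b j - b j)) \<le> 4 * c * M b"
            unfolding total[symmetric] by (rule sum_mono) (use diff in simp)
          have "M (resc b) \<le> M b + M (\<lambda>j. resc b j - b j)" by (rule based.add_le[OF Mb b t1(1)]) simp
          then show "M (resc b) \<le> (1 + 4 * c) * M b"
            using based.le_sum_norms[OF Mb t1(1)] s by (simp add: distrib_right)
          have "M b \<le> M (resc b) + M (\<lambda>j. b j - resc b j)" by (rule based.add_le[OF Mb resc t1(2)]) simp
          then show "M b \<le> M (resc b) + 4 * c * M b"
            using based.le_sum_norms[OF Mb t1(2)] s by (simp add: norm_minus_commute)
        qed
        have "y j \<in> Y j \<and> norm (y j) = 1" if j: "j < k" for j
        proof -
          have sub: "subspace (Y j)" by (rule subspace_member) (use Y j in blast)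
          have "x i \<in> Y j" if i: "i \<in> {t j..<t (Suc j)}" for i
          proof -
            have "i < n" using i tmono[of "Suc j" k] j t(2) by simp
            then show ?thesis using g blk_eq[OF j i] by (auto simp: good_def)
          qed
          then have "v j \<in> Y j" unfolding v_def by (intro subspace_sum[OF sub] subspace_scale[OF sub])
          then show ?thesis using v0[OF j] by (simp add: y[OF j] subspace_scale[OF sub] norm_scal norm_divide)
        qed
        moreover have "cn k y (restr {..<m} b) \<le> 2 * cn k y b" for b m
        proof -
          have "restr {..<m} b j = restr {..<min m k} b j" if "j < k" for j using that by (simp add: restr_def)
          then have "resc (restr {..<m} b) = restr {..<min m k} (resc b)"
            by (auto simp: resc_def restr_def fun_eq_iff)
          then have "ex (resc (restr {..<m} b)) = restr {..<t (min m k)} (ex (resc b))"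
            using initial_ex[of "min m k" "resc b"] by simp
          then show ?thesis unfolding cy using gN(3)[OF ex] by simp
        qed
        moreover have "M b \<le> (1 + \<delta>) * cn k y b \<and> cn k y b \<le> (1 + \<delta>) * M b" if b: "b \<in> tuples k" for b
        proof -
          have M0: "0 \<le> M b" by (rule based.nonneg[OF Mb b])
          have "c * c \<le> c * 1" using c by (intro mult_left_mono) auto
          then have num: "(1 + c) * (1 + 4 * c) \<le> 1 + \<delta>" "1 + c \<le> (1 + \<delta>) * (1 - 4 * c)"
          proof -
            have "(1 + c) * (1 + 4 * c) = 1 + 5 * c + 4 * (c * c)" by (simp add: algebra_simps)
            then show "(1 + c) * (1 + 4 * c) \<le> 1 + \<delta>" using \<open>c * c \<le> c * 1\<close> c by linarith
            have "(1 + 32 * c) * (1 - 4 * c) \<le> (1 + \<delta>) * (1 - 4 * c)"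
              using c by (intro mult_right_mono) auto
            moreover have "(1 + 32 * c) * (1 - 4 * c) = 1 + 28 * c - 128 * (c * c)" by (simp add: algebra_simps)
            moreover have "c * c \<le> c * (1 / 32)" using c by (intro mult_left_mono) auto
            ultimately show "1 + c \<le> (1 + \<delta>) * (1 - 4 * c)" using c by linarith
          qed
          have "cn k y b \<le> (1 + \<delta>') * M (resc b)" unfolding cy M_def by (rule gN(2)[OF ex])
          also have "\<dots> \<le> (1 + c) * ((1 + 4 * c) * M b)"
            using Mclose(1)[OF b] \<delta>' c based.nonneg[OF Mb resc[of b]] by (intro mult_mono) auto
          also have "\<dots> \<le> (1 + \<delta>) * M b" using num(1) M0 by (simp add: mult_right_mono flip: mult.assoc)
          finally have up: "cn k y b \<le> (1 + \<delta>) * M b" .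
          have "M (resc b) \<le> (1 + \<delta>') * cn k y b" unfolding cy M_def by (rule gN(1)[OF ex])
          also have "\<dots> \<le> (1 + c) * cn k y b" using \<delta>'(2) cn_nonneg[of k y b] by (intro mult_right_mono) auto
          also have "\<dots> \<le> (1 + \<delta>) * (1 - 4 * c) * cn k y b" using num(2) cn_nonneg[of k y b] by (intro mult_right_mono)
          finally have "M b - 4 * c * M b \<le> (1 + \<delta>) * (1 - 4 * c) * cn k y b" using Mclose(2)[OF b] by linarith
          then have "(1 - 4 * c) * M b \<le> (1 - 4 * c) * ((1 + \<delta>) * cn k y b)" by (simp add: algebra_simps)
          moreover have "0 < 1 - 4 * c" using c by simp
          ultimately have "M b \<le> (1 + \<delta>) * cn k y b" by (simp only: mult_le_cancel_left_pos)
          then show ?thesis using up by blast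
        qed
        ultimately show ?thesis unfolding good_def y_def[symmetric] by blast
      qed
      then show "\<exists>\<sigma>. \<forall>Y. (\<forall>j<k. Y j \<in> B) \<longrightarrow> good k \<delta> M Y (play \<sigma> Y)" by blast
    qed
  qed
  then show ?thesis by (simp only: M_def ex_def A_def)
qed

sublocale envelope_class "asymptotic_spaces scal B"
proof unfold_locales
  fix N n assume "N \<in> asymptotic_spaces scal B n"
  then show "N \<in> based_spaces n" by (simp add: asymptotic_spaces_def)
qed (use asymptotic_spaces_nonempty asymptotic_spaces_block asymptotic_spaces_parallel in blast)+

end

section \<open>Comparison with the lp norms\<close>

lemma c00_tuples:
  assumes "a \<in> c00"
  obtains n where "1 \<le> n" "a \<in> tuples n"
proof -
  obtain n where n: "{i. a i \<noteq> 0} \<subseteq> {..<n}"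
    using assms finite_nat_iff_bounded unfolding c00_def by blast
  have "a i = 0" if "Suc n \<le> i" for i
  proof (rule ccontr)
    assume "a i \<noteq> 0"
    then have "i < n" using n by blast
    then show False using that by simp
  qed
  then show thesis by (intro that[of "Suc n"]) (simp_all add: tuples_def)
qed

lemma lp_norm_tuples:
  assumes "a \<in> tuples n"
  shows "lp_norm (ereal s) a = (\<Sum>i<n. norm (a i) powr s) powr (1 / s)"
proof -
  have "(\<Sum>i | a i \<noteq> 0. norm (a i) powr s) = (\<Sum>i<n. norm (a i) powr s)"
    by (rule sum.mono_neutral_left[OF _ tuples_support[OF assms]]) auto
  then show ?thesis by (simp add: lp_norm_def)
qed

lemma sup_norm_tuples:
  assumes a: "a \<in> tuples n"
  shows "norm (a i) \<le> lp_norm \<infinity> a"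
proof -
  have "finite ((\<lambda>i. norm (a i)) ` UNIV)"
  proof (rule finite_subset)
    show "(\<lambda>i. norm (a i)) ` UNIV \<subseteq> insert 0 ((\<lambda>i. norm (a i)) ` {..<n})"
    proof
      fix y assume "y \<in> (\<lambda>i. norm (a i)) ` UNIV"
      then obtain i where "y = norm (a i)" by blast
      then show "y \<in> insert 0 ((\<lambda>i. norm (a i)) ` {..<n})"
        using tuples_supportD[OF a, of i] by (cases "a i = 0") auto
    qed
  qed simp
  then have "bdd_above (range (\<lambda>i. norm (a i)))" by (rule bdd_above_finite)
  then have "norm (a i) \<le> (SUP i. norm (a i))" by (rule cSUP_upper2[of _ _ i]) simp_all
  then show ?thesis by (simp add: lp_norm_def)
qed

lemma sup_norm_le: "(\<And>i. norm (a i) \<le> K) \<Longrightarrow> lp_norm \<infinity> a \<le> K"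
  by (simp add: lp_norm_def cSUP_least)

context envelope_class
begin

lemma finite_lp_upper:
  assumes \<beta>: "\<And>s. \<beta> < s \<Longrightarrow> \<exists>C>0. \<forall>n\<ge>1. max_flat n \<le> C * real n powr s" "0 \<le> \<beta>"
    and s: "0 < s" "\<beta> < 1 / s"
  shows "\<exists>C>0. \<forall>n. \<forall>N\<in>F n. \<forall>a\<in>tuples n. N a \<le> C * lp_norm (ereal s) a"
proof -
  obtain b where b: "\<beta> < b" "b < 1 / s" using dense[OF s(2)] by blast
  obtain C where "0 < C" "\<And>n. 1 \<le> n \<Longrightarrow> max_flat n \<le> C * real n powr b" using \<beta>(1)[OF b(1)] by blast
  then show ?thesis
    using upper_estimate[of b s C] b \<beta>(2) s(1) by (simp add: lp_norm_tuples cong: ball_cong)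
qed

lemma finite_lp_lower:
  assumes \<alpha>: "\<And>s. 0 < s \<Longrightarrow> s < \<alpha> \<Longrightarrow> \<exists>c>0. \<forall>n\<ge>1. c * real n powr s \<le> min_spread n"
    and s: "0 < s" "1 / s < \<alpha>"
  shows "\<exists>c>0. \<forall>n. \<forall>N\<in>F n. \<forall>a\<in>tuples n. c * lp_norm (ereal s) a \<le> N a"
proof -
  obtain b where b: "1 / s < b" "b < \<alpha>" using dense[OF s(2)] by blast
  have "0 < 1 / s" using s(1) by simp
  then have b0: "0 < b" using b(1) by linarith
  obtain c where "0 < c" "\<And>n. 1 \<le> n \<Longrightarrow> c * real n powr b \<le> min_spread n" using \<alpha>[OF b0 b(2)] by blast
  then show ?thesis
    using lower_estimate[of b s c] b b0 s(1) by (simp add: lp_norm_tuples cong: ball_cong)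
qed

lemma sup_norm_lower: "N \<in> F n \<Longrightarrow> a \<in> tuples n \<Longrightarrow> 1 / 16 * lp_norm \<infinity> a \<le> N a"
  using sup_norm_le[of a "4 * N a"] coordinate[of N n a] nonneg[of N n a] by simp

lemma envelope_attained_above:
  assumes \<beta>: "0 \<le> \<beta>" "\<beta> \<le> 1" "\<And>n. 1 \<le> n \<Longrightarrow> real n powr \<beta> \<le> max_flat n"
    and a: "1 \<le> n" "a \<in> tuples n"
  shows "\<exists>N\<in>F n. 1 / 16 * lp_norm (if \<beta> = 0 then \<infinity> else ereal (1 / \<beta>)) a \<le> N a"
proof (cases "\<beta> = 0")
  case True
  obtain N where "N \<in> F n" using nonempty by blast
  then show ?thesis using True sup_norm_lower[OF _ a(2)] by auto
next
  case False
  then show ?thesis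
    using upper_envelope_lower_estimate[of \<beta> n a] \<beta> a by (simp add: lp_norm_tuples)
qed

lemma envelope_attained_below:
  assumes \<alpha>: "0 \<le> \<alpha>" "\<alpha> \<le> 1" "\<And>n. 1 \<le> n \<Longrightarrow> min_spread n \<le> real n powr \<alpha>"
  shows "\<exists>C>0. \<forall>n\<ge>1. \<forall>a\<in>tuples n. \<exists>N\<in>F n.
    N a \<le> C * lp_norm (if \<alpha> = 0 then \<infinity> else ereal (1 / \<alpha>)) a"
proof -
  define q where "q = (if \<alpha> = 0 then \<infinity> else ereal (1 / \<alpha>))"
  obtain C where C: "0 < C" and small: "\<And>m a. 1 \<le> m \<Longrightarrow> a \<in> tuples m \<Longrightarrow> (\<And>i. norm (a i) \<le> 1) \<Longrightarrow>
    (0 < \<alpha> \<Longrightarrow> (\<Sum>i<m. norm (a i) powr (1 / \<alpha>)) \<le> 1) \<Longrightarrow> \<exists>N\<in>F m. N a \<le> C"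
    using lower_envelope_upper_estimate[OF \<alpha>] by blast
  have "\<exists>N\<in>F n. N a \<le> C * lp_norm q a" if n: "1 \<le> n" and a: "a \<in> tuples n" for n a
  proof -
    define l where "l = lp_norm q a"
    have le: "norm (a i) \<le> l" for i
    proof (cases "\<alpha> = 0")
      case True
      then show ?thesis using sup_norm_tuples[OF a] by (simp add: l_def q_def)
    next
      case False
      then have \<alpha>0: "0 < \<alpha>" using \<alpha>(1) by simp
      have l: "l = (\<Sum>i<n. norm (a i) powr (1 / \<alpha>)) powr \<alpha>"
        using False lp_norm_tuples[OF a, of "1 / \<alpha>"] by (simp add: l_def q_def)
      show ?thesis
      proof (cases "i < n")
        case True
        have "norm (a i) powr (1 / \<alpha>) \<le> (\<Sum>i<n. norm (a i) powr (1 / \<alpha>))"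
          by (rule member_le_sum) (use True in auto)
        then have "(norm (a i) powr (1 / \<alpha>)) powr \<alpha> \<le> l"
          unfolding l using \<alpha>0 by (intro powr_mono2) auto
        then show ?thesis using \<alpha>0 by (simp add: powr_powr)
      next
        case False
        then show ?thesis using a l by (simp add: tuples_def)
      qed
    qed
    show ?thesis
    proof (cases "a = (\<lambda>_. 0)")
      case True
      obtain N where N: "N \<in> F n" using nonempty by blast
      have "0 \<le> l" using le[of 0] True by simp
      then show ?thesis using N zero[OF N] True C by (intro bexI[of _ N]) (simp_all add: l_def)
    next
      case False
      then obtain i where "a i \<noteq> 0" by blast
      then have l0: "0 < l" using le[of i] zero_less_norm_iff[of "a i"] by linarith
      define a' where "a' = (\<lambda>i. of_real (1 / l) * a i)"
      have a': "a' \<in> tuples n" using a by (simp add: a'_def tuples_def)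
      have na: "norm (a' i) = norm (a i) / l" for i using l0 by (simp add: a'_def norm_mult norm_divide)
      obtain N where N: "N \<in> F n" "N a' \<le> C"
      proof -
        have "\<exists>N\<in>F n. N a' \<le> C"
        proof (rule small[OF n a'])
          show "norm (a' i) \<le> 1" for i unfolding na using le l0 by simp
          assume \<alpha>0: "0 < \<alpha>"
          define S where "S = (\<Sum>i<n. norm (a i) powr (1 / \<alpha>))"
          have "l = S powr \<alpha>"
            using \<alpha>0 lp_norm_tuples[OF a, of "1 / \<alpha>"] by (simp add: l_def q_def S_def)
          moreover have "0 \<le> S" by (simp add: S_def sum_nonneg)
          ultimately have lS: "l powr (1 / \<alpha>) = S" using \<alpha>0 by (simp add: powr_powr)
          have "(\<Sum>i<n. norm (a' i) powr (1 / \<alpha>)) = S / l powr (1 / \<alpha>)"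
            unfolding na S_def using l0 by (simp add: powr_divide sum_divide_distrib)
          then show "(\<Sum>i<n. norm (a' i) powr (1 / \<alpha>)) \<le> 1" unfolding lS by simp
        qed
        then show thesis using that by blast
      qed
      have "N a' = 1 / l * N a" by (rule scale_real[OF N(1) a]) (use l0 in \<open>simp_all add: a'_def\<close>)
      then have "N a \<le> C * l" using N(2) l0 by (simp add: pos_divide_le_eq)
      then show ?thesis using N(1) unfolding l_def by blast
    qed
  qed
  then show ?thesis using C unfolding q_def by blast
qed

end

theorem mainTheorem2:
  fixes scal :: "'k::{real_normed_field,euclidean_space} \<Rightarrow> 'a::banach \<Rightarrow> 'a"
    and B :: "'a set set"
  assumes "banach_space_over scal"
    and "\<not> fin_dim scal (UNIV :: 'a set)"
    and "asymptotic_family scal B"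
  shows "\<exists>p q :: ereal. 1 \<le> p \<and> 1 \<le> q \<and>
    (\<exists>C>0. \<exists>c>0. \<forall>a\<in>c00.
       lower_envelope scal B a \<le> ereal (C * lp_norm q a) \<and>
       ereal (c * lp_norm p a) \<le> upper_envelope scal B a) \<and>
    (\<forall>\<epsilon>::real. 0 < \<epsilon> \<longrightarrow>
       (\<exists>C\<^sub>\<epsilon>>0. \<exists>c\<^sub>\<epsilon>>0. \<forall>a\<in>c00.
          ereal (c\<^sub>\<epsilon> * lp_norm (q + ereal \<epsilon>) a) \<le> lower_envelope scal B a \<and>
          (p < \<infinity> \<and> ereal \<epsilon> < p \<longrightarrow>
             upper_envelope scal B a \<le> ereal (C\<^sub>\<epsilon> * lp_norm (p - ereal \<epsilon>) a)))) \<and>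
    (p = \<infinity> \<longrightarrow>
       (\<forall>s::real. 0 < s \<longrightarrow>
          (\<exists>C\<^sub>s>0. \<forall>a\<in>c00.
             upper_envelope scal B a \<le> ereal (C\<^sub>s * lp_norm (ereal s) a))))"
proof -
  interpret asymptotic_game scal B
    by (intro asymptotic_game.intro asymptotic_game_axioms.intro assms(1,3))
  have mult1: "max_flat (n * m) \<le> max_flat n * max_flat m" if "1 \<le> n" "1 \<le> m" for n m
    by (rule max_flat_mult[OF that(2)])
  obtain \<beta> where \<beta>: "0 \<le> \<beta>" "\<beta> \<le> 1" "\<And>n. 1 \<le> n \<Longrightarrow> real n powr \<beta> \<le> max_flat n"
    "\<And>s. \<beta> < s \<Longrightarrow> \<exists>C>0. \<forall>n\<ge>1. max_flat n \<le> C * real n powr s"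
    using submultiplicative_exponent[of max_flat, OF max_flat_ge max_flat_le mult1 max_flat_add] by blast
  have mult2: "min_spread n * min_spread m \<le> min_spread (n * m)" if "1 \<le> n" "1 \<le> m" for n m
    by (rule min_spread_mult[OF that(2)])
  obtain \<alpha> where \<alpha>: "0 \<le> \<alpha>" "\<alpha> \<le> 1" "\<And>n. 1 \<le> n \<Longrightarrow> min_spread n \<le> real n powr \<alpha>"
    "\<And>s. 0 < s \<Longrightarrow> s < \<alpha> \<Longrightarrow> \<exists>c>0. \<forall>n\<ge>1. c * real n powr s \<le> min_spread n"
    using supermultiplicative_exponent[of min_spread, OF min_spread_half min_spread_le_nat mult2 min_spread_mono]
    by blast
  define p where "p = (if \<beta> = 0 then \<infinity> else ereal (1 / \<beta>))"
  define q where "q = (if \<alpha> = 0 then \<infinity> else ereal (1 / \<alpha>))"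
  have pq: "1 \<le> p" "1 \<le> q" using \<alpha>(1,2) \<beta>(1,2) by (auto simp: p_def q_def one_ereal_def)
  have below: "lower_envelope scal B a \<le> ereal (N a)" and above: "ereal (N a) \<le> upper_envelope scal B a"
    if "1 \<le> n" "a \<in> tuples n" "N \<in> asymptotic_spaces scal B n" for n N a
    unfolding lower_envelope_def upper_envelope_def
    by (rule Inf_lower Sup_upper, use that in blast)+
  obtain C where C: "0 < C" "\<And>n a. 1 \<le> n \<Longrightarrow> a \<in> tuples n \<Longrightarrow>
      \<exists>N\<in>asymptotic_spaces scal B n. N a \<le> C * lp_norm q a"
    using envelope_attained_below[OF \<alpha>(1,2,3)] unfolding q_def by blast
  have lower_le: "lower_envelope scal B a \<le> ereal (C * lp_norm q a)" if a: "a \<in> c00" for a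
  proof -
    obtain n where n: "1 \<le> n" "a \<in> tuples n" using c00_tuples[OF a] by blast
    obtain N where N: "N \<in> asymptotic_spaces scal B n" "N a \<le> C * lp_norm q a" using C(2)[OF n] by blast
    have "lower_envelope scal B a \<le> ereal (N a)" by (rule below[OF n N(1)])
    also have "\<dots> \<le> ereal (C * lp_norm q a)" using N(2) by simp
    finally show ?thesis .
  qed
  have upper_ge: "ereal (1 / 16 * lp_norm p a) \<le> upper_envelope scal B a" if a: "a \<in> c00" for a
  proof -
    obtain n where n: "1 \<le> n" "a \<in> tuples n" using c00_tuples[OF a] by blast
    obtain N where N: "N \<in> asymptotic_spaces scal B n" "1 / 16 * lp_norm p a \<le> N a"
      using envelope_attained_above[OF \<beta>(1,2,3) n] unfolding p_def by blast
    have "ereal (1 / 16 * lp_norm p a) \<le> ereal (N a)" using N(2) by simp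
    also have "\<dots> \<le> upper_envelope scal B a" by (rule above[OF n N(1)])
    finally show ?thesis .
  qed
  have upper_le: "\<exists>K>0. \<forall>a\<in>c00. upper_envelope scal B a \<le> ereal (K * lp_norm (ereal s) a)"
    if s: "0 < s" "\<beta> < 1 / s" for s
  proof -
    obtain K where K: "0 < K" "\<And>n N a. N \<in> asymptotic_spaces scal B n \<Longrightarrow> a \<in> tuples n \<Longrightarrow> N a \<le> K * lp_norm (ereal s) a"
      using finite_lp_upper[OF \<beta>(4,1) s] by blast
    have "upper_envelope scal B a \<le> ereal (K * lp_norm (ereal s) a)" for a
      unfolding upper_envelope_def by (rule Sup_least) (use K(2) in auto)
    then show ?thesis using K(1) by blast
  qed
  have lower_ge: "\<exists>k>0. \<forall>a\<in>c00. ereal (k * lp_norm (q + ereal \<epsilon>) a) \<le> lower_envelope scal B a"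
    if \<epsilon>: "0 < \<epsilon>" for \<epsilon>
  proof -
    obtain k where k: "0 < k" "\<And>n N a. N \<in> asymptotic_spaces scal B n \<Longrightarrow> a \<in> tuples n \<Longrightarrow>
        k * lp_norm (q + ereal \<epsilon>) a \<le> N a"
    proof (cases "\<alpha> = 0")
      case True
      then show thesis using that[of "1 / 16"] sup_norm_lower by (simp add: q_def)
    next
      case False
      then have \<alpha>0: "0 < \<alpha>" using \<alpha>(1) by simp
      have s: "0 < 1 / \<alpha> + \<epsilon>" using \<alpha>0 \<epsilon> by (simp add: add_pos_pos)
      have "1 < (1 / \<alpha> + \<epsilon>) * \<alpha>" using \<alpha>0 \<epsilon> by (simp add: distrib_right)
      then have "1 / (1 / \<alpha> + \<epsilon>) < \<alpha>" using s by (simp add: pos_divide_less_eq mult.commute)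
      from finite_lp_lower[OF \<alpha>(4) s this] show thesis using that False by (auto simp: q_def)
    qed
    have "ereal (k * lp_norm (q + ereal \<epsilon>) a) \<le> lower_envelope scal B a" for a
      unfolding lower_envelope_def by (rule Inf_greatest) (use k(2) in auto)
    then show ?thesis using k(1) by blast
  qed
  have "\<exists>C\<^sub>\<epsilon>>0. \<exists>c\<^sub>\<epsilon>>0. \<forall>a\<in>c00.
      ereal (c\<^sub>\<epsilon> * lp_norm (q + ereal \<epsilon>) a) \<le> lower_envelope scal B a \<and>
      (p < \<infinity> \<and> ereal \<epsilon> < p \<longrightarrow> upper_envelope scal B a \<le> ereal (C\<^sub>\<epsilon> * lp_norm (p - ereal \<epsilon>) a))"
    if \<epsilon>: "0 < \<epsilon>" for \<epsilon>
  proof -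
    obtain k where k: "0 < k" "\<And>a. a \<in> c00 \<Longrightarrow> ereal (k * lp_norm (q + ereal \<epsilon>) a) \<le> lower_envelope scal B a"
      using lower_ge[OF \<epsilon>] by blast
    obtain K where K: "0 < K" "\<And>a. a \<in> c00 \<Longrightarrow> p < \<infinity> \<and> ereal \<epsilon> < p \<Longrightarrow>
        upper_envelope scal B a \<le> ereal (K * lp_norm (p - ereal \<epsilon>) a)"
    proof (cases "p < \<infinity> \<and> ereal \<epsilon> < p")
      case True
      then have b0: "\<beta> \<noteq> 0" "p = ereal (1 / \<beta>)" by (auto simp: p_def split: if_splits)
      then have \<beta>0: "0 < \<beta>" using \<beta>(1) by simp
      have s: "0 < 1 / \<beta> - \<epsilon>" using True b0 by simp
      have "\<beta> * (1 / \<beta> - \<epsilon>) < 1" using \<beta>0 \<epsilon> by (simp add: right_diff_distrib)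
      then have "\<beta> < 1 / (1 / \<beta> - \<epsilon>)" using s by (simp add: pos_less_divide_eq)
      from upper_le[OF s this] show thesis using that b0(2) by auto
    next
      case False
      then show thesis using that[of 1] by auto
    qed
    show ?thesis using k K by blast
  qed
  moreover have "\<exists>K>0. \<forall>a\<in>c00. upper_envelope scal B a \<le> ereal (K * lp_norm (ereal s) a)"
    if "p = \<infinity>" "0 < s" for s
  proof -
    have "\<beta> = 0" using that(1) by (simp add: p_def split: if_splits)
    then show ?thesis using upper_le[OF that(2)] that(2) by simp
  qed
  moreover have "\<exists>C>0. \<exists>c>0. \<forall>a\<in>c00. lower_envelope scal B a \<le> ereal (C * lp_norm q a) \<and>
       ereal (c * lp_norm p a) \<le> upper_envelope scal B a"
    by (rule exI[of _ C], rule conjI[OF C(1)], rule exI[of _ "1 / 16"]) (use lower_le upper_ge in simp)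
  ultimately show ?thesis using pq by blast
qed

end
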